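(* For $m\ge0$, let $\mathscr{L}_m:H^1(\mathbb{R},\mathbb{C}^2)\to L^2(\mathbb{R},\mathbb{C}^2)$ be the operator $$(\mathscr{L}_m f)(x)=\begin{pmatrix} m & -\partial_x\\ \partial_x & -m\end{pmatrix}f(x)+i\,\mathrm{sgn}(x)f(x),$$ and let $S_m=\{z:|\mathrm{Re}\,z|\ge m,|\mathrm{Im}\,z|=1\}$ if $m>0$, $S_0=\{z:|\mathrm{Im}\,z|\le1\}$. Then $\mathbb{C}\setminus S_m\subset\rho(\mathscr{L}_m)$. Moreover, for all $z\in\mathbb{C}\setminus S_m$ and $f\in L^2(\mathbb{R},\mathbb{C}^2)$, $$\left[(\mathscr{L}_m-z)^{-1}f\right](x)=-\int_{\mathbb{R}}\mathcal{R}_z(x,y)f(y)\,dy,$$ where $\mathcal{R}_z(x,y)$ is the explicit matrix kernel given in the context.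
   Context: Square roots are principal (holomorphic on $\mathbb{C}\setminus(-\infty,0]$, positive imaginary part on $(-\infty,0)$). Put $$\mu_z^-=\sqrt{(m+i+z)(m-i-z)},\quad \mu_z^+=\sqrt{(m-i+z)(m+i-z)},\quad w_z^-=\frac{m-i-z}{\mu_z^-},\quad w_z^+=\frac{m+i-z}{\mu_z^+},\quad k_z=\frac{w_z^+-w_z^-}{w_z^++w_z^-}.$$ Define $$N_1=N_{10}=\tfrac12k_z\begin{pmatrix}1/w_z^- & 1 \\ 1 & w_z^-\end{pmatrix},\quad N_2=\tfrac12\begin{pmatrix}-1/w_z^- & -1 \\ 1 & w_z^-\end{pmatrix},\quad N_3=\frac{1}{w_z^++w_z^-}\begin{pmatrix}-1 & -w_z^- \\ w_z^+ & w_z^+w_z^-\end{pmatrix},$$ $$N_4=N_7=\tfrac12k_z\begin{pmatrix}-1/w_z^+ & 1 \\ 1 & -w_z^+\end{pmatrix},\quad N_5=\tfrac12\begin{pmatrix}-1/w_z^+ & -1 \\ 1 & w_z^+\end{pmatrix},\quad N_6=\tfrac12\begin{pmatrix}-1/w_z^+ & 1 \\ -1 & w_z^+\end{pmatrix},$$ $$N_8=\frac{1}{w_z^++w_z^-}\begin{pmatrix}-1 & w_z^+ \\ -w_z^- & w_z^+w_z^-\end{pmatrix},\quad N_9=\tfrac12\begin{pmatrix}-1/w_z^- & 1 \\ -1 & w_z^-\end{pmatrix}.$$ Then $$\mathcal{R}_z(x,y)=\begin{cases}N_1e^{\mu_z^-(x+y)}+N_2e^{-\mu_z^-(x-y)},&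 y<x<0,\\ N_3e^{-\mu_z^+x+\mu_z^-y},& y<0<x,\\ N_4e^{-\mu_z^+(x+y)}+N_5e^{-\mu_z^+(x-y)},&0<y<x,\\ N_6e^{\mu_z^+(x-y)}+N_7e^{-\mu_z^+(x+y)},&0<x<y,\\ N_8e^{\mu_z^-x-\mu_z^+y},&x<0<y,\\ N_9e^{\mu_z^-(x-y)}+N_{10}e^{\mu_z^-(x+y)},&x<y<0.\end{cases}$$ *)

theory Defs
  imports "HOL-Analysis.Analysis"
begin

text \<open>
  Every Lebesgue class has a Borel measurable representative, so that quotienting the Borel
  measurable square integrable functions by almost everywhere equality gives all of \<open>L\<^sup>2\<close>.
\<close>

definition square_integrable :: "(real \<Rightarrow> complex^2) \<Rightarrow> bool" where
  "square_integrable f \<longleftrightarrow>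
     f \<in> borel_measurable lborel \<and> integrable lborel (\<lambda>x. (norm (f x))\<^sup>2)"

definition l2_rel :: "(real \<Rightarrow> complex^2) \<Rightarrow> (real \<Rightarrow> complex^2) \<Rightarrow> bool" where
  "l2_rel f g \<longleftrightarrow> square_integrable f \<and> square_integrable g \<and> (AE x in lborel. f x = g x)"

lemma square_integrable_measurable [measurable_dest]:
  "square_integrable f \<Longrightarrow> f \<in> borel_measurable lborel"
  by (simp add: square_integrable_def)

lemma square_integrable_zero: "square_integrable (\<lambda>x. 0)"
  by (simp add: square_integrable_def)

lemma square_integrable_add:
  assumes f: "square_integrable f" and g: "square_integrable g"
  shows "square_integrable (\<lambda>x. f x + g x)"
  unfolding square_integrable_def
proof
  note [measurable] = square_integrable_measurable[OF f] square_integrable_measurable[OF g]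
  show "(\<lambda>x. f x + g x) \<in> borel_measurable lborel" by measurable
  show "integrable lborel (\<lambda>x. (norm (f x + g x))\<^sup>2)"
  proof (rule Bochner_Integration.integrable_bound)
    show "integrable lborel (\<lambda>x. 2 * (norm (f x))\<^sup>2 + 2 * (norm (g x))\<^sup>2)"
      using f g by (simp add: square_integrable_def)
    have "(norm (f x + g x))\<^sup>2 \<le> 2 * (norm (f x))\<^sup>2 + 2 * (norm (g x))\<^sup>2" for x
    proof -
      have "(norm (f x + g x))\<^sup>2 \<le> (norm (f x) + norm (g x))\<^sup>2"
        by (intro power_mono norm_triangle_ineq) simp
      also have "\<dots> \<le> 2 * (norm (f x))\<^sup>2 + 2 * (norm (g x))\<^sup>2"
        using zero_le_power2[of "norm (f x) - norm (g x)"]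
        by (simp add: power2_sum power2_diff)
      finally show ?thesis .
    qed
    then show "AE x in lborel. norm ((norm (f x + g x))\<^sup>2)
        \<le> norm (2 * (norm (f x))\<^sup>2 + 2 * (norm (g x))\<^sup>2)"
      by auto
  qed measurable
qed

lemma norm_vector_scalar_mult: "norm (c *s v) = norm c * norm (v :: complex^2)"
  by (simp add: norm_vec_def L2_set_def norm_mult power_mult_distrib
      flip: sum_distrib_left) (simp add: real_sqrt_mult)

lemma vector_scalar_mult_measurable [measurable]:
  "(\<lambda>v :: complex^2. c *s v) \<in> borel_measurable borel"
  unfolding vector_scalar_mult_def
  by (intro borel_measurable_continuous_onI continuous_intros)

lemma square_integrable_cscale:
  assumes f: "square_integrable f"
  shows "square_integrable (\<lambda>x. c *s f x)"
proof -
  note [measurable] = square_integrable_measurable[OF f]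
  show ?thesis
    using f by (simp add: square_integrable_def norm_vector_scalar_mult power_mult_distrib)
qed

lemma square_integrable_scaleR:
  "square_integrable f \<Longrightarrow> square_integrable (\<lambda>x. r *\<^sub>R f x)"
  by (auto simp: square_integrable_def power_mult_distrib intro: borel_measurable_scaleR)

lemma square_integrable_uminus:
  "square_integrable f \<Longrightarrow> square_integrable (\<lambda>x. - f x)"
  by (simp add: square_integrable_def)

lemma square_integrable_diff:
  "square_integrable f \<Longrightarrow> square_integrable g \<Longrightarrow> square_integrable (\<lambda>x. f x - g x)"
  using square_integrable_add[of f "\<lambda>x. - g x"] square_integrable_uminus[of g] by simp

lemma integrable_inner_square_integrable:
  assumes f: "square_integrable f" and g: "square_integrable g"
  shows "integrable lborel (\<lambda>x. f x \<bullet> g x)"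
proof (rule Bochner_Integration.integrable_bound)
  note [measurable] = square_integrable_measurable[OF f] square_integrable_measurable[OF g]
  show "integrable lborel (\<lambda>x. (norm (f x))\<^sup>2 + (norm (g x))\<^sup>2)"
    using f g by (simp add: square_integrable_def)
  show "(\<lambda>x. f x \<bullet> g x) \<in> borel_measurable lborel" by measurable
  have "\<bar>f x \<bullet> g x\<bar> \<le> (norm (f x))\<^sup>2 + (norm (g x))\<^sup>2" for x
  proof -
    have "\<bar>f x \<bullet> g x\<bar> \<le> norm (f x) * norm (g x)" by (rule Cauchy_Schwarz_ineq2)
    also have "\<dots> \<le> 2 * (norm (f x) * norm (g x))" by simp
    also have "\<dots> \<le> (norm (f x))\<^sup>2 + (norm (g x))\<^sup>2"
      using zero_le_power2[of "norm (f x) - norm (g x)"] by (simp add: power2_diff)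
    finally show ?thesis .
  qed
  then show "AE x in lborel. norm (f x \<bullet> g x) \<le> norm ((norm (f x))\<^sup>2 + (norm (g x))\<^sup>2)"
    by auto
qed

lemma l2_rel_part_equivp: "part_equivp l2_rel"
proof (rule part_equivpI)
  show "\<exists>f. l2_rel f f"
    using square_integrable_zero by (auto simp: l2_rel_def)
  show "symp l2_rel"
    by (rule sympI) (auto simp: l2_rel_def eq_commute)
  show "transp l2_rel"
    by (rule transpI) (auto simp: l2_rel_def)
qed

quotient_type l2 = "real \<Rightarrow> complex^2" / partial: l2_rel
  by (rule l2_rel_part_equivp)

lift_definition scaleC_l2 :: "complex \<Rightarrow> l2 \<Rightarrow> l2" (infixr "*\<^sub>C" 75)
  is "\<lambda>c f x. c *s f x"
  by (auto simp: l2_rel_def square_integrable_cscale)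

instantiation l2 :: real_inner
begin

lift_definition zero_l2 :: l2 is "\<lambda>x. 0"
  by (simp add: l2_rel_def square_integrable_zero)

lift_definition plus_l2 :: "l2 \<Rightarrow> l2 \<Rightarrow> l2" is "\<lambda>f g x. f x + g x"
  by (auto simp: l2_rel_def square_integrable_add)

lift_definition uminus_l2 :: "l2 \<Rightarrow> l2" is "\<lambda>f x. - f x"
  by (auto simp: l2_rel_def square_integrable_uminus)

lift_definition minus_l2 :: "l2 \<Rightarrow> l2 \<Rightarrow> l2" is "\<lambda>f g x. f x - g x"
  by (auto simp: l2_rel_def square_integrable_diff)

lift_definition scaleR_l2 :: "real \<Rightarrow> l2 \<Rightarrow> l2" is "\<lambda>r f x. r *\<^sub>R f x"
  by (auto simp: l2_rel_def square_integrable_scaleR)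

text \<open>The inner product on \<^typ>\<open>complex^2\<close> is the real part of the Hermitian one.\<close>

lift_definition inner_l2 :: "l2 \<Rightarrow> l2 \<Rightarrow> real" is "\<lambda>f g. LINT x|lborel. f x \<bullet> g x"
proof -
  fix f f' g g' :: "real \<Rightarrow> complex^2"
  assume "l2_rel f f'" "l2_rel g g'"
  then have "square_integrable f" "square_integrable f'" "square_integrable g"
      "square_integrable g'" and ae: "AE x in lborel. f x = f' x" "AE x in lborel. g x = g' x"
    by (auto simp: l2_rel_def)
  note this(1-4)[THEN square_integrable_measurable, measurable]
  show "(LINT x|lborel. f x \<bullet> g x) = (LINT x|lborel. f' x \<bullet> g' x)"
    using ae by (intro integral_cong_AE) auto
qed

definition norm_l2 :: "l2 \<Rightarrow> real" where
  "norm_l2 f = sqrt (f \<bullet> f)"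

definition dist_l2 :: "l2 \<Rightarrow> l2 \<Rightarrow> real" where
  "dist_l2 f g = norm (f - g)"

definition sgn_l2 :: "l2 \<Rightarrow> l2" where
  "sgn_l2 f = inverse (norm f) *\<^sub>R f"

definition uniformity_l2 :: "(l2 \<times> l2) filter" where
  "uniformity_l2 = (INF e\<in>{0<..}. principal {(x, y). dist x y < e})"

definition open_l2 :: "l2 set \<Rightarrow> bool" where
  "open_l2 U \<longleftrightarrow> (\<forall>x\<in>U. eventually (\<lambda>(x', y). x' = x \<longrightarrow> y \<in> U) uniformity)"

instance
proof
  fix f g h :: l2 and a b :: real
  show "f + g + h = f + (g + h)"
    by transfer (auto simp: l2_rel_def ac_simps intro!: square_integrable_add)
  show "f + g = g + f"
    by transfer (auto simp: l2_rel_def ac_simps intro!: square_integrable_add)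
  show "0 + f = f"
    by transfer (auto simp: l2_rel_def)
  show "- f + f = 0"
    by transfer (auto simp: l2_rel_def square_integrable_zero)
  show "f - g = f + - g"
    by transfer (auto simp: l2_rel_def intro!: square_integrable_diff)
  show "a *\<^sub>R (f + g) = a *\<^sub>R f + a *\<^sub>R g"
    by transfer (auto simp: l2_rel_def scaleR_add_right
        intro!: square_integrable_add square_integrable_scaleR)
  show "(a + b) *\<^sub>R f = a *\<^sub>R f + b *\<^sub>R f"
    by transfer (auto simp: l2_rel_def scaleR_add_left
        intro!: square_integrable_add square_integrable_scaleR)
  show "a *\<^sub>R b *\<^sub>R f = (a * b) *\<^sub>R f"
    by transfer (auto simp: l2_rel_def intro!: square_integrable_scaleR)
  show "1 *\<^sub>R f = f"
    by transfer (auto simp: l2_rel_def)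
  show "f \<bullet> g = g \<bullet> f"
    by transfer (simp add: inner_commute)
  show "(f + g) \<bullet> h = f \<bullet> h + g \<bullet> h"
    by transfer (simp add: l2_rel_def inner_add_left integrable_inner_square_integrable)
  show "(a *\<^sub>R f) \<bullet> g = a * (f \<bullet> g)"
    by transfer simp
  show "0 \<le> f \<bullet> f"
    by transfer simp
  show "f \<bullet> f = 0 \<longleftrightarrow> f = 0"
  proof transfer
    fix f assume "l2_rel f f"
    then have f: "square_integrable f" by (simp add: l2_rel_def)
    have "(LINT x|lborel. f x \<bullet> f x) = 0 \<longleftrightarrow> (AE x in lborel. f x \<bullet> f x = 0)"
      by (rule integral_nonneg_eq_0_iff_AE[OF integrable_inner_square_integrable[OF f f]]) simp
    then show "(LINT x|lborel. f x \<bullet> f x) = 0 \<longleftrightarrow> l2_rel f (\<lambda>x. 0)"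
      using f by (simp add: l2_rel_def square_integrable_zero)
  qed
  show "norm f = sqrt (f \<bullet> f)" by (rule norm_l2_def)
  show "dist f g = norm (f - g)" by (rule dist_l2_def)
  show "sgn f = inverse (norm f) *\<^sub>R f" by (rule sgn_l2_def)
next
  show "(uniformity :: (l2 \<times> l2) filter) = (INF e\<in>{0<..}. principal {(x, y). dist x y < e})"
    by (rule uniformity_l2_def)
  fix U :: "l2 set"
  show "open U \<longleftrightarrow> (\<forall>x\<in>U. eventually (\<lambda>(x', y). x' = x \<longrightarrow> y \<in> U) uniformity)"
    by (rule open_l2_def)
qed

end

text \<open>Real valued test functions suffice for complex valued weak derivatives, by linearity.\<close>

definition test_function :: "(real \<Rightarrow> real) \<Rightarrow> bool" where
  "test_function \<phi> \<longleftrightarrow>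
     (\<forall>n. (deriv ^^ n) \<phi> differentiable_on UNIV) \<and> compact (closure {x. \<phi> x \<noteq> 0})"

definition has_weak_deriv :: "l2 \<Rightarrow> l2 \<Rightarrow> bool" where
  "has_weak_deriv u v \<longleftrightarrow>
     (\<forall>\<phi>. test_function \<phi> \<longrightarrow>
        (LINT x|lborel. deriv \<phi> x *\<^sub>R rep_l2 u x) = - (LINT x|lborel. \<phi> x *\<^sub>R rep_l2 v x))"

definition weak_deriv :: "l2 \<Rightarrow> l2" where
  "weak_deriv u = (THE v. has_weak_deriv u v)"

definition H1 :: "l2 set" where
  "H1 = {u. \<exists>v. has_weak_deriv u v}"

text \<open>
  \<^term>\<open>T\<close> is an unbounded operator with domain \<^term>\<open>D\<close>; its values outside \<^term>\<open>D\<close> are irrelevant.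
  As \<^term>\<open>resolvent D T z\<close> inverts a complex linear map, \<^const>\<open>bounded_linear\<close>, which is
  linearity over the reals together with a norm bound, amounts to boundedness.
\<close>

definition resolvent :: "l2 set \<Rightarrow> (l2 \<Rightarrow> l2) \<Rightarrow> complex \<Rightarrow> l2 \<Rightarrow> l2" where
  "resolvent D T z = inv_into D (\<lambda>u. T u - z *\<^sub>C u)"

definition resolvent_set :: "l2 set \<Rightarrow> (l2 \<Rightarrow> l2) \<Rightarrow> complex set" where
  "resolvent_set D T =
     {z. bij_betw (\<lambda>u. T u - z *\<^sub>C u) D UNIV \<and> bounded_linear (resolvent D T z)}"

definition dirac_op :: "real \<Rightarrow> l2 \<Rightarrow> l2" where
  "dirac_op m f =
     (let u = rep_l2 f; u' = rep_l2 (weak_deriv f)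
      in abs_l2 (\<lambda>x. vector [of_real m * u x $ 1 - u' x $ 2, u' x $ 1 - of_real m * u x $ 2]
                    + (\<i> * of_real (sgn x)) *s u x))"

definition sing_set :: "real \<Rightarrow> complex set" where
  "sing_set m = (if m > 0 then {z. \<bar>Re z\<bar> \<ge> m \<and> \<bar>Im z\<bar> = 1} else {z. \<bar>Im z\<bar> \<le> 1})"

definition \<mu>m :: "real \<Rightarrow> complex \<Rightarrow> complex" where
  "\<mu>m m z = csqrt ((of_real m + \<i> + z) * (of_real m - \<i> - z))"

definition \<mu>p :: "real \<Rightarrow> complex \<Rightarrow> complex" where
  "\<mu>p m z = csqrt ((of_real m - \<i> + z) * (of_real m + \<i> - z))"

definition wm :: "real \<Rightarrow> complex \<Rightarrow> complex" where
  "wm m z = (of_real m - \<i> - z) / \<mu>m m z"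

definition wp :: "real \<Rightarrow> complex \<Rightarrow> complex" where
  "wp m z = (of_real m + \<i> - z) / \<mu>p m z"

definition kz :: "real \<Rightarrow> complex \<Rightarrow> complex" where
  "kz m z = (wp m z - wm m z) / (wp m z + wm m z)"

definition mat2 :: "complex \<Rightarrow> complex \<Rightarrow> complex \<Rightarrow> complex \<Rightarrow> complex^2^2" where
  "mat2 a b c d = vector [vector [a, b], vector [c, d]]"

definition smult_mat :: "complex \<Rightarrow> complex^2^2 \<Rightarrow> complex^2^2" (infixr "*\<^sub>M" 75) where
  "c *\<^sub>M A = (\<chi> i. c *s A $ i)"

definition N1 :: "real \<Rightarrow> complex \<Rightarrow> complex^2^2" where
  "N1 m z = (kz m z / 2) *\<^sub>M mat2 (1 / wm m z) 1 1 (wm m z)"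

definition N2 :: "real \<Rightarrow> complex \<Rightarrow> complex^2^2" where
  "N2 m z = (1 / 2) *\<^sub>M mat2 (- 1 / wm m z) (- 1) 1 (wm m z)"

definition N3 :: "real \<Rightarrow> complex \<Rightarrow> complex^2^2" where
  "N3 m z = (1 / (wp m z + wm m z)) *\<^sub>M mat2 (- 1) (- wm m z) (wp m z) (wp m z * wm m z)"

definition N4 :: "real \<Rightarrow> complex \<Rightarrow> complex^2^2" where
  "N4 m z = (kz m z / 2) *\<^sub>M mat2 (- 1 / wp m z) 1 1 (- wp m z)"

definition N5 :: "real \<Rightarrow> complex \<Rightarrow> complex^2^2" where
  "N5 m z = (1 / 2) *\<^sub>M mat2 (- 1 / wp m z) (- 1) 1 (wp m z)"

definition N6 :: "real \<Rightarrow> complex \<Rightarrow> complex^2^2" where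
  "N6 m z = (1 / 2) *\<^sub>M mat2 (- 1 / wp m z) 1 (- 1) (wp m z)"

abbreviation N7 :: "real \<Rightarrow> complex \<Rightarrow> complex^2^2" where
  "N7 \<equiv> N4"

definition N8 :: "real \<Rightarrow> complex \<Rightarrow> complex^2^2" where
  "N8 m z = (1 / (wp m z + wm m z)) *\<^sub>M mat2 (- 1) (wp m z) (- wm m z) (wp m z * wm m z)"

definition N9 :: "real \<Rightarrow> complex \<Rightarrow> complex^2^2" where
  "N9 m z = (1 / 2) *\<^sub>M mat2 (- 1 / wm m z) 1 (- 1) (wm m z)"

abbreviation N10 :: "real \<Rightarrow> complex \<Rightarrow> complex^2^2" where
  "N10 \<equiv> N1"

text \<open>
  The kernel is only specified off the null set where \<open>x = 0\<close>, \<open>y = 0\<close> or \<open>x = y\<close>; there it is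
  set to \<open>0\<close>.
\<close>

definition resolvent_kernel :: "real \<Rightarrow> complex \<Rightarrow> real \<Rightarrow> real \<Rightarrow> complex^2^2" where
  "resolvent_kernel m z x y =
    (if y < x \<and> x < 0 then
       exp (\<mu>m m z * (x + y)) *\<^sub>M N1 m z + exp (- \<mu>m m z * (x - y)) *\<^sub>M N2 m z
     else if y < 0 \<and> 0 < x then
       exp (- \<mu>p m z * x + \<mu>m m z * y) *\<^sub>M N3 m z
     else if 0 < y \<and> y < x then
       exp (- \<mu>p m z * (x + y)) *\<^sub>M N4 m z + exp (- \<mu>p m z * (x - y)) *\<^sub>M N5 m z
     else if 0 < x \<and> x < y then
       exp (\<mu>p m z * (x - y)) *\<^sub>M N6 m z + exp (- \<mu>p m z * (x + y)) *\<^sub>M N7 m z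
     else if x < 0 \<and> 0 < y then
       exp (\<mu>m m z * x - \<mu>p m z * y) *\<^sub>M N8 m z
     else if x < y \<and> y < 0 then
       exp (\<mu>m m z * (x - y)) *\<^sub>M N9 m z + exp (\<mu>m m z * (x + y)) *\<^sub>M N10 m z
     else 0)"

end

theory Submission
  imports Defs
begin

text \<open>
  On each half line the equation \<open>(L\<^sub>m - z) u = f\<close> is the system \<open>u\<^sub>1' = a u\<^sub>2 + f\<^sub>2\<close>, \<open>u\<^sub>2' = b u\<^sub>1 - f\<^sub>1\<close>
  with constant coefficients \<open>a\<close>, \<open>b\<close> that satisfy \<open>a b = \<mu>\<^sup>2\<close>, where \<open>\<mu>\<close> is \<open>\<mu>m\<close> on the left and \<open>\<mu>p\<close>
  on the right. Its homogeneous solutions are combinations of \<open>exp (\<plusminus> \<mu> x)\<close>. Off the singular set both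
  square roots have positive real part (\<open>Re_\<mu>_pos\<close>), so up to a factor there is one solution \<open>right\<close>
  on the whole line that decays at \<open>\<infinity>\<close>, and one solution \<open>left\<close> that decays at \<open>-\<infinity>\<close>. The system has trace
  zero, so the Wronskian of two solutions is constant; for these two it is \<open>wp + wm\<close>, which is
  nonzero off the singular set (\<open>w_sum_nonzero\<close>). If \<open>m = 0\<close> this sum vanishes for all \<open>\<bar>Im z\<bar> < 1\<close>,
  which is why the singular set is then a whole strip.

  Existence is variation of constants: with \<open>W = wp + wm\<close>, the function
  \<open>u(x) = (right(x) \<integral>\<^bsub>y < x\<^esub> left(y)\<cdot>f(y) dy + left(x) \<integral>\<^bsub>y > x\<^esub> right(y)\<cdot>f(y) dy) / W\<close>
  solves the equation (\<open>solution_ac\<close>). The matrices \<open>N1\<close> to \<open>N10\<close> are what is obtained when this product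
  kernel, with the opposite sign, is written out in the six regions (\<open>resolvent_kernel_below\<close>,
  \<open>resolvent_kernel_above\<close>). The kernel is bounded by a multiple of \<open>exp (- gap \<bar>x - y\<bar>)\<close> with
  \<open>gap > 0\<close>, and convolution with this function is bounded on \<open>L\<^sup>2\<close> by Schur's test
  (\<open>exp_convolution_Schur\<close>); hence \<open>u\<close> is square integrable and depends boundedly on \<open>f\<close>.

  Uniqueness: the difference of two solutions in \<open>H1\<close> is a square integrable solution of the homogeneous
  system. Its Wronskian with \<open>left\<close> is constant, and on the negative half line, where \<open>left\<close> is bounded,
  it is square integrable; so it is zero. The same holds for \<open>right\<close> on the positive half line. As \<open>left\<close> and
  \<open>right\<close> are independent, the difference vanishes (\<open>homogeneous_square_integrable_zero\<close>).

  All of this takes place for absolutely continuous functions, because \<open>f\<close> is only square integrable.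
  A class lies in \<open>H1\<close> if and only if its components have absolutely continuous representatives whose
  derivatives are square integrable (\<open>has_weak_deriv_iff_ac\<close>), which rests on the lemma of du Bois-Reymond.
  The product rule \<open>ac_deriv_mult\<close>, an application of Fubini's theorem to a triangle, then supplies the
  integration by parts against test functions, the variation of constants and the constancy of
  Wronskians.
\<close>

section \<open>Absolutely continuous functions\<close>

definition locally_integrable :: "(real \<Rightarrow> 'a::{banach, second_countable_topology}) \<Rightarrow> bool" where
  "locally_integrable h \<longleftrightarrow>
     h \<in> borel_measurable borel \<and> (\<forall>a b. set_integrable lborel {a..b} h)"

lemma locally_integrable_measurable [measurable_dest]:
  "locally_integrable h \<Longrightarrow> h \<in> borel_measurable borel"
  by (simp add: locally_integrable_def)

lemma locally_integrable_interval: "locally_integrable h \<Longrightarrow> set_integrable lborel {a..b} h"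
  by (simp add: locally_integrable_def)

lemma locally_integrable_bound:
  assumes "locally_integrable h" and [measurable]: "k \<in> borel_measurable borel"
    and bound: "\<And>a b. \<exists>C. \<forall>x\<in>{a..b}. norm (k x) \<le> C * norm (h x)"
  shows "locally_integrable k"
  unfolding locally_integrable_def
proof (intro conjI allI)
  fix a b :: real
  obtain C where C: "\<forall>x\<in>{a..b}. norm (k x) \<le> C * norm (h x)" using bound by blast
  have "set_integrable lborel {a..b} (\<lambda>x. C *\<^sub>R h x)"
    using assms(1) by (intro set_integrable_scaleR_right) (simp add: locally_integrable_def)
  then show "set_integrable lborel {a..b} k"
  proof (rule set_integrable_bound)
    show "set_borel_measurable lborel {a..b} k"
      unfolding set_borel_measurable_def by measurable
    have "norm (k x) \<le> norm (C *\<^sub>R h x)" if "x \<in> {a..b}" for x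
      using C that by (auto intro!: order_trans[OF bspec[OF C that]] mult_right_mono)
    then show "AE x in lborel. x \<in> {a..b} \<longrightarrow> norm (k x) \<le> norm (C *\<^sub>R h x)" by auto
  qed
qed fact

lemma locally_integrable_mult_continuous:
  fixes g h :: "real \<Rightarrow> complex"
  assumes h: "locally_integrable h" and g: "continuous_on UNIV g"
  shows "locally_integrable (\<lambda>x. g x * h x)"
proof (rule locally_integrable_bound[OF h])
  have [measurable]: "g \<in> borel_measurable borel" "h \<in> borel_measurable borel"
    using g h by (auto intro: borel_measurable_continuous_onI simp: locally_integrable_def)
  show "(\<lambda>x. g x * h x) \<in> borel_measurable borel" by measurable
  fix a b :: real
  have "compact (g ` {a..b})"
    by (intro compact_continuous_image continuous_on_subset[OF g]) auto
  then obtain C where "\<forall>y\<in>g ` {a..b}. norm y \<le> C"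
    using compact_imp_bounded bounded_iff by blast
  then show "\<exists>C. \<forall>x\<in>{a..b}. norm (g x * h x) \<le> C * norm (h x)"
    by (auto simp: norm_mult intro!: exI[of _ C] mult_right_mono)
qed

lemma locally_integrable_mult_bounded:
  fixes g h :: "real \<Rightarrow> complex"
  assumes h: "locally_integrable h" and [measurable]: "g \<in> borel_measurable borel"
    and "\<And>x. norm (g x) \<le> C"
  shows "locally_integrable (\<lambda>x. g x * h x)"
proof (rule locally_integrable_bound[OF h])
  have [measurable]: "h \<in> borel_measurable borel"
    using h by (simp add: locally_integrable_def)
  show "(\<lambda>x. g x * h x) \<in> borel_measurable borel" by measurable
  show "\<exists>C. \<forall>x\<in>{a..b}. norm (g x * h x) \<le> C * norm (h x)" for a b
    using assms(3) by (auto simp: norm_mult intro!: exI[of _ C] mult_right_mono)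
qed

lemma locally_integrable_continuous:
  fixes g :: "real \<Rightarrow> 'a::{banach, second_countable_topology}"
  assumes "continuous_on UNIV g"
  shows "locally_integrable g"
  unfolding locally_integrable_def
  using assms by (auto intro: borel_measurable_continuous_onI continuous_on_subset
      borel_integrable_atLeastAtMost')

lemma locally_integrable_add:
  "locally_integrable f \<Longrightarrow> locally_integrable g \<Longrightarrow> locally_integrable (\<lambda>x. f x + g x)"
  unfolding locally_integrable_def by (auto intro!: set_integral_add)

lemma locally_integrable_diff:
  "locally_integrable f \<Longrightarrow> locally_integrable g \<Longrightarrow> locally_integrable (\<lambda>x. f x - g x)"
  unfolding locally_integrable_def by (auto intro!: set_integral_diff)

text \<open>
  The function \<open>g\<close> is locally absolutely continuous with derivative \<open>h\<close>. Only increments over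
  \<open>a \<le> b\<close> are recorded, so that no oriented integrals are needed.
\<close>

definition ac_deriv :: "(real \<Rightarrow> complex) \<Rightarrow> (real \<Rightarrow> complex) \<Rightarrow> bool" where
  "ac_deriv g h \<longleftrightarrow> locally_integrable h \<and>
     (\<forall>a b. a \<le> b \<longrightarrow> g b - g a = (LINT x:{a..b}|lborel. h x))"

lemma ac_derivI:
  "locally_integrable h \<Longrightarrow> (\<And>a b. a \<le> b \<Longrightarrow> g b - g a = (LINT x:{a..b}|lborel. h x))
    \<Longrightarrow> ac_deriv g h"
  by (simp add: ac_deriv_def)

lemma ac_deriv_integrable: "ac_deriv g h \<Longrightarrow> set_integrable lborel {a..b} h"
  by (simp add: ac_deriv_def locally_integrable_def)

lemma ac_deriv_increment:
  "ac_deriv g h \<Longrightarrow> a \<le> b \<Longrightarrow> g b - g a = (LINT x:{a..b}|lborel. h x)"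
  by (simp add: ac_deriv_def)

lemma ac_deriv_continuous:
  assumes "ac_deriv g h"
  shows "continuous_on UNIV g"
  unfolding continuous_on_eq_continuous_at[OF open_UNIV]
proof
  fix x :: real
  have "set_integrable lborel {x-1..t} h" for t
    using assms by (rule ac_deriv_integrable)
  note si = this and eq = set_borel_integral_eq_integral[OF this]
  have "continuous_on {x-1..x+1} (\<lambda>t. g (x-1) + integral {x-1..t} h)"
    by (intro continuous_intros indefinite_integral_continuous_1 eq)
  moreover have "g (x-1) + integral {x-1..t} h = g t" if "t \<in> {x-1..x+1}" for t
    using ac_deriv_increment[OF assms, of "x-1" t] that by (simp add: eq algebra_simps)
  ultimately have "continuous_on {x-1..x+1} g"
    by (rule continuous_on_eq)
  then show "isCont g x"
    by (rule continuous_on_interior) (simp add: interior_atLeastAtMost_real)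
qed

lemma ac_deriv_measurable: "ac_deriv g h \<Longrightarrow> g \<in> borel_measurable borel"
  by (intro borel_measurable_continuous_onI ac_deriv_continuous)

lemma ac_deriv_cong:
  assumes g: "ac_deriv g h" and [measurable]: "h' \<in> borel_measurable borel"
    and ae: "AE x in lborel. h x = h' x"
  shows "ac_deriv g h'"
proof -
  have [measurable]: "h \<in> borel_measurable borel"
    using g by (simp add: ac_deriv_def locally_integrable_def)
  have *: "(LINT x:A|lborel. h x) = (LINT x:A|lborel. h' x)" if "A \<in> sets lborel" for A
    unfolding set_lebesgue_integral_def
    by (rule integral_cong_AE) (use ae that in auto)
  have "set_integrable lborel {a..b} h'" for a b
    using ac_deriv_integrable[OF g, of a b] unfolding set_integrable_def
    by (rule integrable_cong_AE_imp) (use ae in auto)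
  then show ?thesis
    using g by (simp add: ac_deriv_def locally_integrable_def *)
qed

lemma ac_deriv_add:
  "ac_deriv g h \<Longrightarrow> ac_deriv k l \<Longrightarrow> ac_deriv (\<lambda>x. g x + k x) (\<lambda>x. h x + l x)"
  unfolding ac_deriv_def
  by (auto simp: locally_integrable_add locally_integrable_interval set_integral_add
      add_diff_add)

lemma ac_deriv_cmult:
  assumes "ac_deriv g h"
  shows "ac_deriv (\<lambda>x. c * g x) (\<lambda>x. c * h x)"
  using assms unfolding ac_deriv_def locally_integrable_def
  by (auto simp flip: right_diff_distrib)

lemma ac_deriv_diff:
  "ac_deriv g h \<Longrightarrow> ac_deriv k l \<Longrightarrow> ac_deriv (\<lambda>x. g x - k x) (\<lambda>x. h x - l x)"
  using ac_deriv_add[of g h "\<lambda>x. -1 * k x" "\<lambda>x. -1 * l x"] ac_deriv_cmult[of k l "-1"] by simp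

lemma ac_deriv_zero_imp_const:
  assumes "ac_deriv g (\<lambda>x. 0)"
  shows "g x = g y"
  using ac_deriv_increment[OF assms, of x y] ac_deriv_increment[OF assms, of y x]
  by (cases "x \<le> y") auto

text \<open>
  Finitely many corners of a continuous function do not affect the fundamental theorem of calculus. The solutions of the Dirac system are of this kind, with a corner at the origin.
\<close>

lemma ac_deriv_piecewise:
  assumes "continuous_on UNIV g" "finite S" "locally_integrable h"
    and "\<And>x. x \<notin> S \<Longrightarrow> (g has_vector_derivative h x) (at x)"
  shows "ac_deriv g h"
proof (rule ac_derivI)
  fix a b :: real assume "a \<le> b"
  have "(h has_integral (g b - g a)) {a..b}"
    by (rule fundamental_theorem_of_calculus_interior_strong[of S])
      (use assms \<open>a \<le> b\<close> in \<open>auto intro: continuous_on_subset\<close>)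
  then show "g b - g a = (LINT x:{a..b}|lborel. h x)"
    using set_borel_integral_eq_integral(2)[OF locally_integrable_interval[OF assms(3)]]
    by (metis integral_unique)
qed fact

lemma integrable_lborel_tensor:
  fixes H L :: "real \<Rightarrow> complex"
  assumes H: "integrable lborel H" and L: "integrable lborel L"
  shows "integrable (lborel \<Otimes>\<^sub>M lborel) (\<lambda>(s, t). H s * L t)"
proof (rule lborel_pair.Fubini_integrable)
  note [measurable] = borel_measurable_integrable[OF H] borel_measurable_integrable[OF L]
  show "(\<lambda>(s, t). H s * L t) \<in> borel_measurable (lborel \<Otimes>\<^sub>M lborel)" by measurable
  show "integrable lborel (\<lambda>s. LINT t|lborel. norm (case (s, t) of (s, t) \<Rightarrow> H s * L t))"
    using H L by (simp add: norm_mult)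
  show "AE s in lborel. integrable lborel (\<lambda>t. case (s, t) of (s, t) \<Rightarrow> H s * L t)"
    using L by simp
qed

text \<open>
  With \<open>g(t) - g(a) = \<integral>\<^bsub>a\<^esub>\<^bsup>t\<^esup> h\<close> and \<open>k(s) - k(a) = \<integral>\<^bsub>a\<^esub>\<^bsup>s\<^esup> l\<close>, the product of the two increments over
  \<open>[a, b]\<close> is the integral of \<open>h(s) l(t)\<close> over a square. Its parts over the triangles \<open>s \<le> t\<close> and
  \<open>t < s\<close> are, by Fubini's theorem, \<open>\<integral> (g - g(a)) l\<close> and \<open>\<integral> (k - k(a)) h\<close>.
\<close>

lemma ac_deriv_mult:
  assumes g: "ac_deriv g h" and k: "ac_deriv k l"
  shows "ac_deriv (\<lambda>x. g x * k x) (\<lambda>x. k x * h x + g x * l x)"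
proof (rule ac_derivI)
  have lh: "locally_integrable (\<lambda>x. k x * h x)" and ll: "locally_integrable (\<lambda>x. g x * l x)"
    using g k ac_deriv_continuous[OF g] ac_deriv_continuous[OF k]
    by (auto intro!: locally_integrable_mult_continuous simp: ac_deriv_def)
  then show "locally_integrable (\<lambda>x. k x * h x + g x * l x)" by (rule locally_integrable_add)
  fix a b :: real assume ab: "a \<le> b"
  define H where "H s = indicator {a..b} s *\<^sub>R h s" for s
  define L where "L s = indicator {a..b} s *\<^sub>R l s" for s
  have H: "integrable lborel H" and L: "integrable lborel L"
    using ac_deriv_integrable[OF g, of a b] ac_deriv_integrable[OF k, of a b]
    unfolding H_def L_def set_integrable_def by auto
  note [measurable] = borel_measurable_integrable[OF H] borel_measurable_integrable[OF L]
  have iH: "(LINT s|lborel. H s) = g b - g a" and iL: "(LINT s|lborel. L s) = k b - k a"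
    using ac_deriv_increment[OF g ab] ac_deriv_increment[OF k ab]
    by (auto simp: H_def L_def set_lebesgue_integral_def)
  have HL: "integrable (lborel \<Otimes>\<^sub>M lborel) (\<lambda>(s, t). H s * L t)"
    using H L by (rule integrable_lborel_tensor)
  have H1: "integrable (lborel \<Otimes>\<^sub>M lborel) (\<lambda>(s, t). indicator {..t} s *\<^sub>R (H s * L t))"
    by (rule Bochner_Integration.integrable_bound[OF HL])
      (auto simp: indicator_def split: prod.splits)
  have H2: "integrable (lborel \<Otimes>\<^sub>M lborel) (\<lambda>(s, t). indicator {..<s} t *\<^sub>R (H s * L t))"
    by (rule Bochner_Integration.integrable_bound[OF HL])
      (auto simp: indicator_def split: prod.splits)
  have inner1: "(LINT s|lborel. indicator {..t} s *\<^sub>R (H s * L t)) = (g t - g a) * L t" for t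
  proof (cases "t \<in> {a..b}")
    case True
    have "(LINT s|lborel. indicator {..t} s *\<^sub>R (H s * L t))
        = (LINT s|lborel. (indicator {a..t} s *\<^sub>R h s) * L t)"
      using True by (intro Bochner_Integration.integral_cong) (auto simp: H_def indicator_def)
    also have "\<dots> = (LINT s:{a..t}|lborel. h s) * L t"
      by (simp add: set_lebesgue_integral_def flip: mult_scaleR_left)
    finally show ?thesis using ac_deriv_increment[OF g, of a t] True by simp
  qed (simp add: L_def)
  have inner2: "(LINT t|lborel. indicator {..<s} t *\<^sub>R (H s * L t)) = H s * (k s - k a)" for s
  proof (cases "s \<in> {a..b}")
    case True
    have "(LINT t|lborel. indicator {..<s} t *\<^sub>R (H s * L t))
        = (LINT t|lborel. H s * (indicator {a..s} t *\<^sub>R l t))"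
    proof (rule integral_cong_AE)
      have [measurable]: "l \<in> borel_measurable borel"
        using k by (simp add: ac_deriv_def locally_integrable_def)
      show "(\<lambda>t. H s * (indicator {a..s} t *\<^sub>R l t)) \<in> borel_measurable lborel" by measurable
      show "AE t in lborel. indicator {..<s} t *\<^sub>R (H s * L t) = H s * (indicator {a..s} t *\<^sub>R l t)"
        using AE_lborel_singleton[of s]
        by eventually_elim (use True in \<open>auto simp: L_def indicator_def\<close>)
    qed measurable
    also have "\<dots> = H s * (LINT t:{a..s}|lborel. l t)"
      unfolding set_lebesgue_integral_def by (rule integral_mult_right_zero)
    finally show ?thesis using ac_deriv_increment[OF k, of a s] True by simp
  qed (simp add: H_def)
  have "(g b - g a) * (k b - k a) = (\<integral>p. (case p of (s, t) \<Rightarrow> H s * L t) \<partial>(lborel \<Otimes>\<^sub>M lborel))"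
    using lborel_pair.integral_fst'[OF HL] by (simp add: iH iL)
  also have "\<dots> = (\<integral>p. (case p of (s, t) \<Rightarrow> indicator {..t} s *\<^sub>R (H s * L t))
       + (case p of (s, t) \<Rightarrow> indicator {..<s} t *\<^sub>R (H s * L t)) \<partial>(lborel \<Otimes>\<^sub>M lborel))"
    by (intro Bochner_Integration.integral_cong) (auto simp: indicator_def)
  also have "\<dots> = (\<integral>p. (case p of (s, t) \<Rightarrow> indicator {..t} s *\<^sub>R (H s * L t)) \<partial>(lborel \<Otimes>\<^sub>M lborel))
       + (\<integral>p. (case p of (s, t) \<Rightarrow> indicator {..<s} t *\<^sub>R (H s * L t)) \<partial>(lborel \<Otimes>\<^sub>M lborel))"
    by (rule Bochner_Integration.integral_add[OF H1 H2])
  also have "(\<integral>p. (case p of (s, t) \<Rightarrow> indicator {..t} s *\<^sub>R (H s * L t)) \<partial>(lborel \<Otimes>\<^sub>M lborel))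
      = (LINT t|lborel. (g t - g a) * L t)"
    using lborel_pair.integral_snd[OF H1] by (simp add: inner1)
  also have "(\<integral>p. (case p of (s, t) \<Rightarrow> indicator {..<s} t *\<^sub>R (H s * L t)) \<partial>(lborel \<Otimes>\<^sub>M lborel))
      = (LINT s|lborel. H s * (k s - k a))"
    using lborel_pair.integral_fst'[OF H2] by (simp add: inner2)
  also have "(LINT t|lborel. (g t - g a) * L t) = (LINT t:{a..b}|lborel. g t * l t) - g a * (k b - k a)"
  proof -
    have "integrable lborel (\<lambda>t. g t * L t)"
      using locally_integrable_interval[OF ll, of a b]
      by (simp add: set_integrable_def L_def mult_ac)
    then have "(LINT t|lborel. (g t - g a) * L t) = (LINT t|lborel. g t * L t) - g a * (LINT t|lborel. L t)"
      using L by (simp add: left_diff_distrib)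
    then show ?thesis by (simp add: iL) (simp add: L_def set_lebesgue_integral_def mult_ac)
  qed
  also have "(LINT s|lborel. H s * (k s - k a)) = (LINT t:{a..b}|lborel. k t * h t) - k a * (g b - g a)"
  proof -
    have "integrable lborel (\<lambda>t. k t * H t)"
      using locally_integrable_interval[OF lh, of a b]
      by (simp add: set_integrable_def H_def mult_ac)
    then have "(LINT s|lborel. H s * (k s - k a)) = (LINT t|lborel. k t * H t) - k a * (LINT t|lborel. H t)"
      using H by (simp add: right_diff_distrib mult.commute[of "H _"])
    then show ?thesis by (simp add: iH) (simp add: H_def set_lebesgue_integral_def mult_ac)
  qed
  finally have "g b * k b - g a * k a
      = (LINT t:{a..b}|lborel. k t * h t) + (LINT t:{a..b}|lborel. g t * l t)"
    by (simp add: algebra_simps)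
  also have "\<dots> = (LINT t:{a..b}|lborel. k t * h t + g t * l t)"
    by (rule set_integral_add(2)[symmetric]) (intro locally_integrable_interval lh ll)+
  finally show "g b * k b - g a * k a = (LINT t:{a..b}|lborel. k t * h t + g t * l t)" .
qed

lemma set_integral_interval_split:
  fixes v :: "real \<Rightarrow> 'a::{banach, second_countable_topology}"
  assumes v: "locally_integrable v" and "a \<le> b" "b \<le> c"
  shows "(LINT x:{a..c}|lborel. v x) = (LINT x:{a..b}|lborel. v x) + (LINT x:{b..c}|lborel. v x)"
proof -
  have "{a..c} = {a..b} \<union> {b..c}" using assms by auto
  moreover have "(LINT x:{a..b} \<union> {b..c}|lborel. v x)
      = (LINT x:{a..b}|lborel. v x) + (LINT x:{b..c}|lborel. v x)"
  proof (rule set_integral_Un_AE)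
    show "AE x in lborel. \<not> (x \<in> {a..b} \<and> x \<in> {b..c})"
      using AE_lborel_singleton[of b] by eventually_elim auto
  qed (auto intro: locally_integrable_interval[OF v])
  ultimately show ?thesis by simp
qed

lemma ac_primitive_exists:
  assumes v: "locally_integrable v"
  shows "\<exists>V. ac_deriv V v"
proof
  let ?I = "\<lambda>a b. LINT x:{a..b}|lborel. v x"
  show "ac_deriv (\<lambda>x. if 0 \<le> x then ?I 0 x else - ?I x 0) v"
  proof (rule ac_derivI[OF v])
    fix a b :: real assume "a \<le> b"
    then show "(if 0 \<le> b then ?I 0 b else - ?I b 0) - (if 0 \<le> a then ?I 0 a else - ?I a 0) = ?I a b"
      using set_integral_interval_split[OF v, of 0 a b] set_integral_interval_split[OF v, of a 0 b]
        set_integral_interval_split[OF v, of a b 0]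
      by (auto simp: algebra_simps)
  qed
qed

lemma ac_deriv_integral_atMost:
  fixes h :: "real \<Rightarrow> complex"
  assumes h: "locally_integrable h" and int: "\<And>x. set_integrable lborel {..x} h"
  shows "ac_deriv (\<lambda>x. LINT y:{..x}|lborel. h y) h"
proof (rule ac_derivI[OF h])
  fix a b :: real assume "a \<le> b"
  then have eq: "{..b} = {..a} \<union> {a..b}" by auto
  have "(LINT y:{..a} \<union> {a..b}|lborel. h y) = (LINT y:{..a}|lborel. h y) + (LINT y:{a..b}|lborel. h y)"
  proof (rule set_integral_Un_AE)
    show "AE y in lborel. \<not> (y \<in> {..a} \<and> y \<in> {a..b})"
      using AE_lborel_singleton[of a] by eventually_elim auto
  qed (auto intro: locally_integrable_interval[OF h] int)
  then show "(LINT y:{..b}|lborel. h y) - (LINT y:{..a}|lborel. h y) = (LINT y:{a..b}|lborel. h y)"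
    unfolding eq by simp
qed

lemma ac_deriv_integral_atLeast:
  fixes h :: "real \<Rightarrow> complex"
  assumes h: "locally_integrable h" and int: "\<And>x. set_integrable lborel {x..} h"
  shows "ac_deriv (\<lambda>x. LINT y:{x..}|lborel. h y) (\<lambda>x. - h x)"
proof (rule ac_derivI)
  show "locally_integrable (\<lambda>x. - h x)"
    using locally_integrable_diff[OF locally_integrable_continuous h, of "\<lambda>_. 0"] by simp
  fix a b :: real assume "a \<le> b"
  then have eq: "{a..} = {a..b} \<union> {b..}" by auto
  have "(LINT y:{a..b} \<union> {b..}|lborel. h y) = (LINT y:{a..b}|lborel. h y) + (LINT y:{b..}|lborel. h y)"
  proof (rule set_integral_Un_AE)
    show "AE y in lborel. \<not> (y \<in> {a..b} \<and> y \<in> {b..})"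
      using AE_lborel_singleton[of b] by eventually_elim auto
  qed (auto intro: locally_integrable_interval[OF h] int)
  then show "(LINT y:{b..}|lborel. h y) - (LINT y:{a..}|lborel. h y) = (LINT y:{a..b}|lborel. - h y)"
    unfolding eq using locally_integrable_interval[OF h] by (simp add: set_integral_uminus)
qed

section \<open>Smooth functions of compact support\<close>

definition smooth :: "(real \<Rightarrow> real) \<Rightarrow> bool" where
  "smooth f \<longleftrightarrow> (\<forall>n. (deriv ^^ n) f differentiable_on UNIV)"

text \<open>
  Smoothness is coinductive: any class of differentiable functions closed under \<open>deriv\<close> consists of
  smooth functions. This avoids formulas for higher derivatives.
\<close>

lemma smooth_coinduct:
  assumes "X f" and step: "\<And>g. X g \<Longrightarrow> g differentiable_on UNIV \<and> X (deriv g)"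
  shows "smooth f"
proof -
  have "X ((deriv ^^ n) f)" for n
    by (induction n) (use assms in auto)
  then show ?thesis using step by (auto simp: smooth_def)
qed

lemma smooth_has_deriv:
  "smooth f \<Longrightarrow> (f has_real_derivative deriv f x) (at x)"
  unfolding smooth_def
  by (drule spec[of _ 0])
    (auto simp: differentiable_on_def DERIV_deriv_iff_real_differentiable)

lemma smooth_differentiable: "smooth f \<Longrightarrow> f differentiable_on UNIV"
  unfolding smooth_def by (drule spec[of _ 0]) auto

lemma smooth_deriv: "smooth f \<Longrightarrow> smooth (deriv f)"
  unfolding smooth_def by (metis funpow_Suc_right o_apply)

lemma smooth_continuous: "smooth f \<Longrightarrow> continuous_on UNIV f"
  by (intro differentiable_imp_continuous_on smooth_differentiable)

lemma smoothI:
  assumes "\<And>x. (f has_real_derivative g x) (at x)" and "smooth g"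
  shows "smooth f"
proof -
  have *: "deriv f = g" using assms(1) by (auto intro: DERIV_imp_deriv)
  have "(deriv ^^ n) f differentiable_on UNIV" for n
  proof (cases n)
    case 0
    then show ?thesis using assms(1)
      by (auto simp: differentiable_on_def real_differentiable_def)
  next
    case (Suc k)
    then show ?thesis using assms(2)
      by (simp add: smooth_def funpow_Suc_right * del: funpow.simps)
  qed
  then show ?thesis by (simp add: smooth_def)
qed

text \<open>
  The finite sums of products of smooth functions form a class closed under differentiation, whereas
  the products alone do not.
\<close>

inductive smooth_products :: "(real \<Rightarrow> real) \<Rightarrow> bool" where
  mult: "smooth f \<Longrightarrow> smooth g \<Longrightarrow> smooth_products (\<lambda>x. f x * g x)"
| add: "smooth_products f \<Longrightarrow> smooth_products g \<Longrightarrow> smooth_products (\<lambda>x. f x + g x)"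

lemma smooth_products_step:
  assumes "smooth_products h"
  shows "\<exists>h'. (\<forall>x. (h has_real_derivative h' x) (at x)) \<and> smooth_products h'"
  using assms
proof induction
  case (mult f g)
  have "((\<lambda>x. f x * g x) has_real_derivative deriv f x * g x + f x * deriv g x) (at x)" for x
    by (rule derivative_eq_intros smooth_has_deriv mult)+ (simp add: algebra_simps)
  moreover have "smooth_products (\<lambda>x. deriv f x * g x + f x * deriv g x)"
    using mult by (intro smooth_products.intros smooth_deriv)
  ultimately show ?case by (intro exI[of _ "\<lambda>x. deriv f x * g x + f x * deriv g x"]) simp
next
  case (add f g)
  then obtain f' g' where "\<forall>x. (f has_real_derivative f' x) (at x)" "smooth_products f'"
    "\<forall>x. (g has_real_derivative g' x) (at x)" "smooth_products g'" by blast
  then show ?case by (intro exI[of _ "\<lambda>x. f' x + g' x"]) (auto intro: smooth_products.add DERIV_add)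
qed

lemma smooth_products_imp_smooth: "smooth_products h \<Longrightarrow> smooth h"
proof (rule smooth_coinduct[of smooth_products])
  fix h assume "smooth_products h"
  then obtain h' where h': "\<forall>x. (h has_real_derivative h' x) (at x)" "smooth_products h'"
    using smooth_products_step by blast
  then have "deriv h = h'" by (auto intro: DERIV_imp_deriv)
  with h' show "h differentiable_on UNIV \<and> smooth_products (deriv h)"
    by (auto simp: differentiable_on_def real_differentiable_def)
qed

lemma smooth_mult: "smooth f \<Longrightarrow> smooth g \<Longrightarrow> smooth (\<lambda>x. f x * g x)"
  by (rule smooth_products_imp_smooth, rule smooth_products.mult)

lemma smooth_affine:
  assumes "smooth f"
  shows "smooth (\<lambda>x. c * f (d * x + e))"
proof (rule smooth_coinduct[of "\<lambda>h. \<exists>f c. smooth f \<and> h = (\<lambda>x. c * f (d * x + e))"])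
  fix h assume "\<exists>f c. smooth f \<and> h = (\<lambda>x. c * f (d * x + e))"
  then obtain f c where f: "smooth f" and h: "h = (\<lambda>x. c * f (d * x + e))" by blast
  have D: "(h has_real_derivative (c * d) * deriv f (d * x + e)) (at x)" for x
  proof -
    have "((\<lambda>x. d * x + e) has_real_derivative d) (at x)"
      by (auto intro!: derivative_eq_intros)
    from DERIV_cmult[OF DERIV_chain2[OF smooth_has_deriv[OF f] this], of c]
    show ?thesis unfolding h by (simp only: mult.assoc mult.commute[of d])
  qed
  then have "deriv h = (\<lambda>x. (c * d) * deriv f (d * x + e))" by (auto intro: DERIV_imp_deriv)
  with D f show "h differentiable_on UNIV \<and>
      (\<exists>f c. smooth f \<and> deriv h = (\<lambda>x. c * f (d * x + e)))"
    by (auto simp: differentiable_on_def real_differentiable_def intro: smooth_deriv)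
qed (use assms in blast)

lemma smooth_const: "smooth (\<lambda>x. c)"
proof (rule smooth_coinduct[of "\<lambda>h. \<exists>c. h = (\<lambda>x. c)"])
  fix h :: "real \<Rightarrow> real" assume "\<exists>c. h = (\<lambda>x. c)"
  then obtain c where h: "h = (\<lambda>x. c)" by blast
  show "h differentiable_on UNIV \<and> (\<exists>c. deriv h = (\<lambda>x. c))"
    unfolding h by (auto intro!: exI[of _ 0] DERIV_imp_deriv)
qed blast

lemma smooth_add_cmult:
  assumes f: "smooth f" and g: "smooth g"
  shows "smooth (\<lambda>x. f x + c * g x)"
proof -
  have "smooth_products (\<lambda>x. f x * 1 + c * g x)"
    by (intro smooth_products.intros f g smooth_const)
  then show ?thesis using smooth_products_imp_smooth by simp
qed

text \<open>
  The standard smooth function \<open>exp (- 1/x)\<close> for \<open>x > 0\<close>, extended by zero. The polynomial factor in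
  \<open>1/x\<close> makes the family closed under differentiation.
\<close>

definition flat_exp :: "real poly \<Rightarrow> real \<Rightarrow> real" where
  "flat_exp p x = (if x \<le> 0 then 0 else poly p (1 / x) * exp (- (1 / x)))"

lemma poly_times_exp_decay: "((\<lambda>t. poly p t * exp (- t)) \<longlongrightarrow> (0 :: real)) at_top"
proof -
  have "((\<lambda>t. \<Sum>i\<le>degree p. coeff p i * (t ^ i / exp t)) \<longlongrightarrow> (\<Sum>i\<le>degree p. coeff p i * 0)) at_top"
    by (intro tendsto_intros tendsto_power_div_exp_0)
  then show ?thesis
    by (simp add: poly_altdef exp_minus field_simps sum_distrib_right sum_divide_distrib)
qed

lemma flat_exp_derivative:
  "(flat_exp p has_real_derivative flat_exp (monom 1 2 * (p - pderiv p)) x) (at x)"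
proof -
  consider "x < 0" | "x > 0" | "x = 0" by linarith
  then show ?thesis
  proof cases
    case 1
    have "((\<lambda>_. 0) has_real_derivative 0) (at x)" by simp
    then have "(flat_exp p has_real_derivative 0) (at x)"
      by (rule has_field_derivative_transform_within_open[where S = "{..<0}"])
        (use 1 in \<open>auto simp: flat_exp_def\<close>)
    then show ?thesis using 1 by (simp add: flat_exp_def)
  next
    case 2
    have "((\<lambda>x. poly p (1 / x) * exp (- (1 / x))) has_real_derivative
        flat_exp (monom 1 2 * (p - pderiv p)) x) (at x)"
      using 2 unfolding flat_exp_def
      by (auto intro!: derivative_eq_intros DERIV_chain2[OF poly_DERIV]
          simp: poly_monom field_simps power2_eq_square)
    then show ?thesis
      by (rule has_field_derivative_transform_within_open[where S = "{0<..}"])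
        (use 2 in \<open>auto simp: flat_exp_def\<close>)
  next
    case 3
    have "((\<lambda>t. poly (pCons 0 p) t * exp (- t)) \<longlongrightarrow> 0) at_top"
      by (rule poly_times_exp_decay)
    then have "((\<lambda>y. poly (pCons 0 p) (inverse y) * exp (- inverse y)) \<longlongrightarrow> 0) (at_right 0)"
      by (rule filterlim_compose[OF _ filterlim_inverse_at_top_right])
    then have "((\<lambda>y. flat_exp p y / y) \<longlongrightarrow> 0) (at_right 0)"
      by (rule Lim_transform_eventually)
        (auto simp: flat_exp_def eventually_at_filter field_simps)
    moreover have "((\<lambda>y. flat_exp p y / y) \<longlongrightarrow> 0) (at_left 0)"
      by (rule Lim_transform_eventually[OF tendsto_const])
        (auto simp: flat_exp_def eventually_at_filter)
    ultimately have "((\<lambda>y. flat_exp p y / y) \<longlongrightarrow> 0) (at 0)"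
      by (simp add: filterlim_at_split)
    then show ?thesis
      using 3 by (simp add: has_field_derivative_iff flat_exp_def)
  qed
qed

lemma smooth_flat_exp: "smooth (flat_exp p)"
proof (rule smooth_coinduct[of "\<lambda>h. \<exists>p. h = flat_exp p"])
  fix h assume "\<exists>p. h = flat_exp p"
  then obtain p where p: "h = flat_exp p" by blast
  have "deriv h = flat_exp (monom 1 2 * (p - pderiv p))"
    unfolding p using flat_exp_derivative by (auto intro: DERIV_imp_deriv)
  then show "h differentiable_on UNIV \<and> (\<exists>p. deriv h = flat_exp p)"
    using flat_exp_derivative[of p] p
    by (auto simp: differentiable_on_def real_differentiable_def)
qed blast

lemma test_function_support:
  assumes "test_function \<phi>"
  obtains M where "M > 0" "\<And>x. \<bar>x\<bar> \<ge> M \<Longrightarrow> \<phi> x = 0"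
proof -
  have "bounded {x. \<phi> x \<noteq> 0}"
    using assms compact_imp_bounded bounded_subset[OF _ closure_subset]
    unfolding test_function_def by blast
  then obtain B where B: "\<forall>x\<in>{x. \<phi> x \<noteq> 0}. norm x \<le> B" using bounded_iff by blast
  show ?thesis
  proof (rule that[of "\<bar>B\<bar> + 1"])
    show "\<phi> x = 0" if "\<bar>x\<bar> \<ge> \<bar>B\<bar> + 1" for x
      using B that by (force simp: not_le[symmetric])
  qed simp
qed

lemma test_function_smooth: "test_function \<phi> \<Longrightarrow> smooth \<phi>"
  by (simp add: test_function_def smooth_def)

lemma test_functionI:
  assumes "smooth \<phi>" and "\<And>x. \<bar>x\<bar> \<ge> M \<Longrightarrow> \<phi> x = 0"
  shows "test_function \<phi>"
proof -
  have "\<bar>x\<bar> \<le> M" if "\<phi> x \<noteq> 0" for x using assms(2)[of x] that by linarith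
  then have "bounded {x. \<phi> x \<noteq> 0}" by (auto simp: bounded_iff)
  then show ?thesis using assms(1)
    by (simp add: test_function_def smooth_def bounded_closure compact_eq_bounded_closed)
qed

lemma test_function_add_cmult:
  assumes f: "test_function f" and g: "test_function g"
  shows "test_function (\<lambda>x. f x + c * g x)"
proof -
  obtain M where M: "\<And>x. \<bar>x\<bar> \<ge> M \<Longrightarrow> f x = 0" using test_function_support[OF f] by blast
  obtain N where N: "\<And>x. \<bar>x\<bar> \<ge> N \<Longrightarrow> g x = 0" using test_function_support[OF g] by blast
  show ?thesis
  proof (rule test_functionI)
    show "smooth (\<lambda>x. f x + c * g x)"
      using f g by (simp add: smooth_add_cmult test_function_smooth)
    show "f x + c * g x = 0" if "\<bar>x\<bar> \<ge> max M N" for x using that by (simp add: M N)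
  qed
qed

lemma test_function_deriv:
  assumes f: "test_function f"
  shows "test_function (deriv f)"
proof -
  obtain M where M: "\<And>x. \<bar>x\<bar> \<ge> M \<Longrightarrow> f x = 0" using test_function_support[OF f] by blast
  have "(f has_real_derivative 0) (at x)" if "\<bar>x\<bar> \<ge> M + 1" for x
  proof -
    have "((\<lambda>_. 0) has_real_derivative 0) (at x)" by simp
    then show ?thesis
    proof (rule has_field_derivative_transform_within_open)
      show "open {y. \<bar>y\<bar> > M}" by (intro open_Collect_less continuous_intros)
    qed (use that M in auto)
  qed
  then show ?thesis
    by (intro test_functionI[of "deriv f" "M + 1"] smooth_deriv[OF test_function_smooth[OF f]]
        DERIV_imp_deriv)
qed

lemma integrable_test_function_mult:
  fixes w :: "real \<Rightarrow> 'a::{banach, second_countable_topology}"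
  assumes f: "test_function f" and w: "locally_integrable w"
  shows "integrable lborel (\<lambda>x. f x *\<^sub>R w x)"
proof -
  obtain M where M: "\<And>x. \<bar>x\<bar> \<ge> M \<Longrightarrow> f x = 0" using test_function_support[OF f] by blast
  have cf: "continuous_on UNIV f" using f by (intro smooth_continuous test_function_smooth)
  have [measurable]: "f \<in> borel_measurable borel" "w \<in> borel_measurable borel"
    using cf w by (auto intro: borel_measurable_continuous_onI locally_integrable_measurable)
  have "compact (f ` {-M..M})"
    by (intro compact_continuous_image continuous_on_subset[OF cf]) auto
  then obtain C where C: "\<forall>y\<in>f ` {-M..M}. norm y \<le> C"
    using compact_imp_bounded bounded_iff by blast
  have "integrable lborel (\<lambda>x. C *\<^sub>R (indicator {-M..M} x *\<^sub>R w x))"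
    using locally_integrable_interval[OF w, of "-M" M]
    unfolding set_integrable_def by (rule integrable_scaleR_right)
  then show ?thesis
  proof (rule Bochner_Integration.integrable_bound)
    have "norm (f x *\<^sub>R w x) \<le> norm (C *\<^sub>R (indicator {-M..M} x *\<^sub>R w x))" for x
    proof (cases "x \<in> {-M..M}")
      case True
      then have "\<bar>f x\<bar> \<le> \<bar>C\<bar>" using C by force
      then show ?thesis using True by (simp add: mult_right_mono)
    next
      case False
      then have "\<bar>x\<bar> \<ge> M" by auto
      then show ?thesis by (simp add: M)
    qed
    then show "AE x in lborel. norm (f x *\<^sub>R w x) \<le> norm (C *\<^sub>R (indicator {-M..M} x *\<^sub>R w x))"
      by simp
  qed measurable
qed

definition bump :: "real \<Rightarrow> real \<Rightarrow> nat \<Rightarrow> real \<Rightarrow> real" where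
  "bump a b n x = flat_exp 1 (real (Suc n) * (x - a)) * flat_exp 1 (real (Suc n) * (b - x))"

lemma bump_outside: "x \<notin> {a<..<b} \<Longrightarrow> bump a b n x = 0"
  by (auto simp: bump_def flat_exp_def mult_le_0_iff)

text \<open>
  Written so that \<open>n\<close> enters only through a null sequence in the exponent.
\<close>

lemma bump_inside:
  assumes "x \<in> {a<..<b}"
  shows "bump a b n x = exp (- (inverse (real (Suc n)) / (x - a)) - (inverse (real (Suc n)) / (b - x)))"
proof -
  define N where "N = real (Suc n)"
  have pos: "N > 0" "x - a > 0" "b - x > 0" using assms by (auto simp: N_def)
  have "bump a b n x = exp (- (1 / (N * (x - a))) + - (1 / (N * (b - x))))"
    using pos unfolding bump_def flat_exp_def N_def[symmetric] exp_add
    by (simp add: zero_less_mult_iff not_le)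
  also have "- (1 / (N * (x - a))) + - (1 / (N * (b - x)))
      = - (inverse N / (x - a)) - (inverse N / (b - x))"
    by (simp add: divide_inverse)
  finally show ?thesis by (simp add: N_def)
qed

lemma bump_bounds: "0 \<le> bump a b n x" "bump a b n x \<le> indicator {a<..<b} x"
proof -
  show "0 \<le> bump a b n x" by (cases "x \<in> {a<..<b}") (simp_all add: bump_inside bump_outside)
  show "bump a b n x \<le> indicator {a<..<b} x"
  proof (cases "x \<in> {a<..<b}")
    case True
    then have "0 \<le> inverse (real (Suc n)) / (x - a)" "0 \<le> inverse (real (Suc n)) / (b - x)" by auto
    then have "- (inverse (real (Suc n)) / (x - a)) - (inverse (real (Suc n)) / (b - x)) \<le> 0" by linarith
    then show ?thesis unfolding bump_inside[OF True] using True by (simp del: of_nat_Suc)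
  qed (simp add: bump_outside)
qed

lemma bump_tendsto: "(\<lambda>n. bump a b n x) \<longlonglongrightarrow> indicator {a<..<b} x"
proof (cases "x \<in> {a<..<b}")
  case True
  have "(\<lambda>n. exp (- (inverse (real (Suc n)) / (x - a)) - (inverse (real (Suc n)) / (b - x))))
      \<longlonglongrightarrow> exp (- (0 / (x - a)) - (0 / (b - x)))"
    by (intro tendsto_intros LIMSEQ_inverse_real_of_nat) (use True in auto)
  then show ?thesis using True by (simp add: bump_inside del: of_nat_Suc)
qed (simp add: bump_outside)

text \<open>
  The bumps are smooth and increase to the indicator of an open interval as the slope \<open>Suc n\<close> grows, so
  no mollification is needed to pass from test functions to intervals.
\<close>

lemma test_function_bump: "test_function (bump a b n)"
proof (rule test_functionI[of _ "max \<bar>a\<bar> \<bar>b\<bar>"])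
  let ?N = "real (Suc n)"
  have "smooth (\<lambda>x. (1 * flat_exp 1 (?N * x + (- ?N * a))) * (1 * flat_exp 1 (- ?N * x + ?N * b)))"
    by (intro smooth_mult smooth_affine smooth_flat_exp)
  then show "smooth (bump a b n)"
    by (simp add: bump_def[abs_def] algebra_simps del: of_nat_Suc)
  show "bump a b n x = 0" if "\<bar>x\<bar> \<ge> max \<bar>a\<bar> \<bar>b\<bar>" for x
  proof (rule bump_outside)
    show "x \<notin> {a<..<b}" using that unfolding greaterThanLessThan_iff by linarith
  qed
qed

text \<open>
  A primitive of a test function is constant to the left and to the right of the support; the two
  constants agree because the integral vanishes.
\<close>

lemma test_function_antiderivative:
  assumes f: "test_function f" and int0: "(LINT x|lborel. f x) = 0"
  obtains F where "test_function F" "deriv F = f"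
proof -
  obtain M where "M > 0" and M: "\<And>x. \<bar>x\<bar> \<ge> M \<Longrightarrow> f x = 0" using test_function_support[OF f] by blast
  have cf: "continuous_on UNIV f" using f by (intro smooth_continuous test_function_smooth)
  \<comment> \<open>A primitive on the whole line, regarded as the interval from \<open>-\<infinity>\<close> to \<open>\<infinity>\<close>.\<close>
  have "\<exists>F. \<forall>x :: real. -\<infinity> < ereal x \<longrightarrow> ereal x < \<infinity> \<longrightarrow> (F has_vector_derivative f x) (at x)"
    by (rule einterval_antiderivative) (use cf in \<open>auto simp: continuous_on_eq_continuous_at\<close>)
  then obtain F0 where F0: "\<And>x. (F0 has_vector_derivative f x) (at x)" by auto
  define F where "F x = F0 x - F0 (-M)" for x
  have DF: "(F has_vector_derivative f x) (at x)" for x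
    unfolding F_def by (auto intro!: derivative_eq_intros F0)
  have FTC: "(f has_integral F b - F a) {a..b}" if "a \<le> b" for a b
    by (rule fundamental_theorem_of_calculus[OF that has_vector_derivative_at_within[OF DF]])
  have lower: "F x = 0" if "x \<le> -M" for x
  proof -
    have "(f has_integral 0) {x..-M}"
      by (rule has_integral_is_0) (use that \<open>M > 0\<close> in \<open>auto intro!: M\<close>)
    then have "F (-M) - F x = 0" using FTC[OF that] has_integral_unique by blast
    then show ?thesis by (simp add: F_def)
  qed
  have "F M = (LINT x|lborel. indicator {-M..M} x *\<^sub>R f x)"
    using integral_FTC_atLeastAtMost[of "-M" M F f, OF _ has_vector_derivative_at_within[OF DF]]
      \<open>M > 0\<close> continuous_on_subset[OF cf] lower[of "-M"] by simp
  also have "\<dots> = (LINT x|lborel. f x)"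
  proof (rule Bochner_Integration.integral_cong)
    show "indicator {-M..M} x *\<^sub>R f x = f x" for x
      by (cases "\<bar>x\<bar> \<ge> M") (auto simp: M indicator_def)
  qed simp
  finally have "F M = 0" using int0 by simp
  have upper: "F x = 0" if "x \<ge> M" for x
  proof -
    have "(f has_integral 0) {M..x}"
      by (rule has_integral_is_0) (use that \<open>M > 0\<close> in \<open>auto intro!: M\<close>)
    then have "F x - F M = 0" using FTC[OF that] has_integral_unique by blast
    then show ?thesis using \<open>F M = 0\<close> by simp
  qed
  have D: "(F has_real_derivative f x) (at x)" for x
    using DF by (simp add: has_real_derivative_iff_has_vector_derivative)
  show ?thesis
  proof (rule that)
    show "test_function F"
    proof (rule test_functionI)
      show "smooth F" by (rule smoothI[OF D test_function_smooth[OF f]])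
      show "F x = 0" if "\<bar>x\<bar> \<ge> M" for x using that lower[of x] upper[of x] by linarith
    qed
    show "deriv F = f" using D by (auto intro: DERIV_imp_deriv)
  qed
qed

section \<open>The fundamental lemma of the calculus of variations\<close>

text \<open>
  Half open intervals are stable under intersection and generate the Borel sets, so the integral over
  every Borel subset of a bounded interval vanishes by Dynkin's argument.
\<close>

lemma integrable_zero_on_intervals_AE_zero:
  fixes w :: "real \<Rightarrow> 'a::{banach, second_countable_topology}"
  assumes w: "locally_integrable w" and zero: "\<And>a b. (LINT x:{a<..b}|lborel. w x) = 0"
  shows "AE x in lborel. w x = 0"
proof -
  have "AE x in lborel. indicator {-real n<..real n} x *\<^sub>R w x = 0" for n
  proof (rule sigma_finite_measure.density_zero[OF sigma_finite_lborel])
    let ?w = "\<lambda>x. indicator {-real n<..real n} x *\<^sub>R w x"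
    have "set_integrable lborel {-real n<..real n} w"
      by (rule set_integrable_subset[OF locally_integrable_interval[OF w, of "-real n" "real n"]]) auto
    then show int: "integrable lborel ?w" by (simp add: set_integrable_def)
    have int_A: "set_integrable lborel A ?w" if "A \<in> sets borel" for A
      unfolding set_integrable_def by (rule integrable_mult_indicator[OF _ int]) (use that in simp)
    have Ioc: "(LINT x:{a<..b}|lborel. ?w x) = 0" for a b
    proof -
      have "(LINT x:{a<..b}|lborel. ?w x) = (LINT x:{max a (-n)<..min b n}|lborel. w x)"
        unfolding set_lebesgue_integral_def
        by (intro Bochner_Integration.integral_cong) (auto simp: indicator_def)
      then show ?thesis using zero by simp
    qed
    have all: "(LINT x:UNIV|lborel. ?w x) = 0"
      using zero[of "-real n" "real n"] by (simp add: set_lebesgue_integral_def)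
    let ?G = "range (\<lambda>(a, b). {a<..b::real})"
    show "(LINT x:A|lborel. ?w x) = 0" if "A \<in> sets lborel" for A
    proof -
      have G: "sigma_sets UNIV ?G = sets borel"
        by (simp add: borel_sigma_sets_Ioc)
      have "Int_stable ?G"
        by (auto simp: Int_stable_def image_iff)
      moreover have "?G \<subseteq> Pow UNIV" by simp
      moreover have "A \<in> sigma_sets UNIV ?G" using that by (simp add: G)
      ultimately show ?thesis
      proof (induction rule: sigma_sets_induct_disjoint)
        case (compl A)
        then have "A \<in> sets borel" using G by simp
        then have "(LINT x:A \<union> (UNIV - A)|lborel. ?w x)
            = (LINT x:A|lborel. ?w x) + (LINT x:UNIV - A|lborel. ?w x)"
          by (intro set_integral_Un int_A) auto
        then show ?case using compl all by simp
      next
        case (union A)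
        then have A: "A i \<in> sets borel" for i using G by (auto simp: image_subset_iff)
        have "(LINT x:(\<Union>i. A i)|lborel. ?w x) = (\<Sum>i. (LINT x:A i|lborel. ?w x))"
          by (rule lebesgue_integral_countable_add)
            (use A union in \<open>auto simp: disjoint_family_on_def intro!: int_A\<close>)
        then show ?case using union by simp
      next
        case (basic A)
        then show ?case using Ioc by auto
      qed (simp add: set_lebesgue_integral_def)
    qed
  qed
  then have "AE x in lborel. \<forall>n. indicator {-real n<..real n} x *\<^sub>R w x = 0"
    unfolding AE_all_countable by blast
  then show ?thesis
  proof eventually_elim
    case (elim x)
    obtain n where n: "\<bar>x\<bar> < real n" using reals_Archimedean2 by blast
    then have "x \<in> {-real n<..real n}" by auto
    then show ?case using elim[rule_format, of n] by simp
  qed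
qed

text \<open>
  Bumps converge boundedly to indicators of open intervals, so the integral over every interval
  vanishes.
\<close>

lemma fundamental_lemma_calculus_of_variations:
  fixes w :: "real \<Rightarrow> 'a::{banach, second_countable_topology}"
  assumes w: "locally_integrable w"
    and zero: "\<And>f. test_function f \<Longrightarrow> (LINT x|lborel. f x *\<^sub>R w x) = 0"
  shows "AE x in lborel. w x = 0"
proof (rule integrable_zero_on_intervals_AE_zero[OF w])
  fix a b :: real
  have [measurable]: "w \<in> borel_measurable borel" by (rule locally_integrable_measurable[OF w])
  have [measurable]: "bump a b n \<in> borel_measurable borel" for n
    by (intro borel_measurable_continuous_onI smooth_continuous test_function_smooth test_function_bump)
  have "(\<lambda>n. LINT x|lborel. bump a b n x *\<^sub>R w x) \<longlonglongrightarrow> (LINT x|lborel. indicator {a<..<b} x *\<^sub>R w x)"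
  proof (rule integral_dominated_convergence[where w = "\<lambda>x. norm (indicator {a..b} x *\<^sub>R w x)"])
    show "integrable lborel (\<lambda>x. norm (indicator {a..b} x *\<^sub>R w x))"
      using locally_integrable_interval[OF w, of a b]
      unfolding set_integrable_def by (rule integrable_norm)
    show "AE x in lborel. (\<lambda>n. bump a b n x *\<^sub>R w x) \<longlonglongrightarrow> indicator {a<..<b} x *\<^sub>R w x"
      by (auto intro!: tendsto_intros bump_tendsto)
    have "\<bar>bump a b n x\<bar> \<le> indicator {a..b} x" for n x
      using bump_bounds[of a b n x] by (auto simp: indicator_def of_bool_def split: if_splits)
    then show "AE x in lborel. norm (bump a b n x *\<^sub>R w x) \<le> norm (indicator {a..b} x *\<^sub>R w x)" for n
      by (auto intro!: mult_right_mono)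
  qed measurable
  then have "(LINT x:{a<..<b}|lborel. w x) = 0"
    by (simp add: zero test_function_bump set_lebesgue_integral_def LIMSEQ_const_iff)
  moreover have "(LINT x:{a<..b}|lborel. w x) = (LINT x:{a<..<b}|lborel. w x)"
    unfolding set_lebesgue_integral_def
  proof (rule integral_cong_AE)
    show "AE x in lborel. indicator {a<..b} x *\<^sub>R w x = indicator {a<..<b} x *\<^sub>R w x"
      using AE_lborel_singleton[of b] by eventually_elim (auto simp: indicator_def)
  qed measurable
  ultimately show "(LINT x:{a<..b}|lborel. w x) = 0" by simp
qed

text \<open>
  Subtracting from a test function \<open>f\<close> the multiple of a fixed bump with the same integral leaves a
  function of integral zero, hence the derivative of a test function. So \<open>\<integral> f w\<close> is a constant multiple
  \<open>c\<close> of \<open>\<integral> f\<close>, and the fundamental lemma applies to \<open>w - c\<close>.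
\<close>

lemma du_Bois_Reymond:
  fixes w :: "real \<Rightarrow> 'a::{banach, second_countable_topology}"
  assumes w: "locally_integrable w"
    and zero: "\<And>f. test_function f \<Longrightarrow> (LINT x|lborel. deriv f x *\<^sub>R w x) = 0"
  shows "\<exists>c. AE x in lborel. w x = c"
proof -
  let ?b = "bump 0 1 0"
  define I where "I = (LINT x|lborel. ?b x)"
  have lone: "locally_integrable (\<lambda>x. 1 :: real)" by (rule locally_integrable_continuous) simp
  have int1: "integrable lborel f" if "test_function f" for f
    using integrable_test_function_mult[OF that lone] by simp
  have "I > 0"
  proof -
    have "I \<noteq> 0"
    proof
      assume "I = 0"
      then have "AE x in lborel. ?b x = 0"
        unfolding I_def using bump_bounds(1)
        by (subst (asm) integral_nonneg_eq_0_iff_AE) (auto intro: int1 test_function_bump)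
      then have "AE x in lborel. x \<notin> {0<..<1::real}"
        by eventually_elim (auto simp: bump_inside)
      then have "emeasure lborel {0<..<1::real} = 0"
        by (subst (asm) AE_iff_measurable[of "{0<..<1}"]) auto
      then show False by simp
    qed
    moreover have "I \<ge> 0" unfolding I_def by (intro Bochner_Integration.integral_nonneg bump_bounds)
    ultimately show ?thesis by simp
  qed
  define c where "c = (1 / I) *\<^sub>R (LINT x|lborel. ?b x *\<^sub>R w x)"
  have lc: "locally_integrable (\<lambda>x. c)" by (rule locally_integrable_continuous) simp
  have "AE x in lborel. w x - c = 0"
  proof (rule fundamental_lemma_calculus_of_variations)
    show "locally_integrable (\<lambda>x. w x - c)" by (intro locally_integrable_diff w lc)
    fix f assume f: "test_function f"
    define J where "J = (LINT x|lborel. f x)"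
    let ?g = "\<lambda>x. f x + (- J / I) * ?b x"
    have tg: "test_function ?g" by (intro test_function_add_cmult f test_function_bump)
    have "(LINT x|lborel. ?g x) = J + (- J / I) * I"
      using int1[OF f] int1[OF test_function_bump[of 0 1 0]] unfolding J_def I_def
      by (subst Bochner_Integration.integral_add) auto
    then have "(LINT x|lborel. ?g x) = 0" using \<open>I > 0\<close> by simp
    then obtain F where F: "test_function F" "deriv F = ?g"
      using test_function_antiderivative[OF tg] by blast
    note ifw = integrable_test_function_mult[OF f w]
    note ibw = integrable_test_function_mult[OF test_function_bump[of 0 1 0] w]
    have "0 = (LINT x|lborel. ?g x *\<^sub>R w x)" using zero[OF F(1)] F(2) by simp
    also have "\<dots> = (LINT x|lborel. f x *\<^sub>R w x + (- J / I) *\<^sub>R (?b x *\<^sub>R w x))"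
      by (simp only: scaleR_add_left scaleR_scaleR)
    also have "\<dots> = (LINT x|lborel. f x *\<^sub>R w x) + (LINT x|lborel. (- J / I) *\<^sub>R (?b x *\<^sub>R w x))"
      by (rule Bochner_Integration.integral_add[OF ifw integrable_scaleR_right[OF ibw]])
    also have "(LINT x|lborel. (- J / I) *\<^sub>R (?b x *\<^sub>R w x)) = - (J *\<^sub>R c)"
      unfolding integral_scaleR_right by (simp add: c_def)
    also have "(LINT x|lborel. f x *\<^sub>R w x) + - (J *\<^sub>R c) = (LINT x|lborel. f x *\<^sub>R w x) - J *\<^sub>R c"
      by simp
    also have "J *\<^sub>R c = (LINT x|lborel. f x *\<^sub>R c)"
      using int1[OF f] by (simp add: J_def)
    also have "(LINT x|lborel. f x *\<^sub>R w x) - (LINT x|lborel. f x *\<^sub>R c) = (LINT x|lborel. f x *\<^sub>R (w x - c))"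
      using ifw integrable_test_function_mult[OF f lc]
      by (subst Bochner_Integration.integral_diff[symmetric]) (auto simp: scaleR_diff_right)
    finally show "(LINT x|lborel. f x *\<^sub>R (w x - c)) = 0" by simp
  qed
  then show ?thesis by auto
qed

section \<open>Weak derivatives of locally integrable functions\<close>

lemma ac_deriv_of_real_smooth:
  assumes "smooth f"
  shows "ac_deriv (\<lambda>x. of_real (f x)) (\<lambda>x. of_real (deriv f x))"
proof (rule ac_deriv_piecewise[of _ "{}"])
  show "((\<lambda>x. complex_of_real (f x)) has_vector_derivative of_real (deriv f x)) (at x)" for x
    using smooth_has_deriv[OF assms, of x]
    by (intro has_vector_derivative_of_real) (simp add: has_real_derivative_iff_has_vector_derivative)
  show "locally_integrable (\<lambda>x. complex_of_real (deriv f x))"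
    by (intro locally_integrable_continuous continuous_on_of_real smooth_continuous smooth_deriv assms)
qed (auto intro!: continuous_on_of_real smooth_continuous assms)

text \<open>
  The product of a test function and \<open>g\<close> is absolutely continuous and vanishes at both ends of a large
  interval.
\<close>

lemma ac_deriv_integration_by_parts:
  assumes g: "ac_deriv g h" and f: "test_function f"
  shows "(LINT x|lborel. deriv f x *\<^sub>R g x) = - (LINT x|lborel. f x *\<^sub>R h x)"
proof -
  have f': "test_function (deriv f)" using f by (rule test_function_deriv)
  obtain M where M: "\<And>x. \<bar>x\<bar> \<ge> M \<Longrightarrow> f x = 0" using test_function_support[OF f] by blast
  obtain N where N: "\<And>x. \<bar>x\<bar> \<ge> N \<Longrightarrow> deriv f x = 0" using test_function_support[OF f'] by blast
  define R where "R = max (max M N) 0"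
  have R: "f x = 0" "deriv f x = 0" if "\<bar>x\<bar> \<ge> R" for x
    using that M[of x] N[of x] by (auto simp: R_def)
  have "R \<ge> 0" by (simp add: R_def)
  have h: "locally_integrable h" using g by (simp add: ac_deriv_def)
  have lg: "locally_integrable g" by (intro locally_integrable_continuous ac_deriv_continuous[OF g])
  note P = ac_deriv_mult[OF ac_deriv_of_real_smooth[OF test_function_smooth[OF f]] g]
  have "0 = of_real (f R) * g R - of_real (f (-R)) * g (-R)"
    using R[of R] R[of "-R"] \<open>R \<ge> 0\<close> by simp
  also have "\<dots> = (LINT x:{-R..R}|lborel. g x * of_real (deriv f x) + of_real (f x) * h x)"
    using ac_deriv_increment[OF P, of "-R" R] \<open>R \<ge> 0\<close> by simp
  also have "\<dots> = (LINT x|lborel. deriv f x *\<^sub>R g x + f x *\<^sub>R h x)"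
    unfolding set_lebesgue_integral_def
  proof (rule Bochner_Integration.integral_cong)
    show "indicator {-R..R} x *\<^sub>R (g x * of_real (deriv f x) + of_real (f x) * h x)
        = deriv f x *\<^sub>R g x + f x *\<^sub>R h x" for x
      by (cases "\<bar>x\<bar> \<ge> R") (auto simp: R indicator_def scaleR_conv_of_real)
  qed simp
  also have "\<dots> = (LINT x|lborel. deriv f x *\<^sub>R g x) + (LINT x|lborel. f x *\<^sub>R h x)"
    by (intro Bochner_Integration.integral_add integrable_test_function_mult f f' h lg)
  finally show ?thesis by (simp add: eq_neg_iff_add_eq_0)
qed

text \<open>
  If \<open>V\<close> is a primitive of the weak derivative, then \<open>u - V\<close> has weak derivative zero and is constant
  almost everywhere.
\<close>

lemma weak_derivative_imp_ac_representative:
  fixes u v :: "real \<Rightarrow> complex"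
  assumes u: "locally_integrable u" and v: "locally_integrable v"
    and weak: "\<And>f. test_function f \<Longrightarrow>
      (LINT x|lborel. deriv f x *\<^sub>R u x) = - (LINT x|lborel. f x *\<^sub>R v x)"
  shows "\<exists>U. ac_deriv U v \<and> (AE x in lborel. u x = U x)"
proof -
  obtain V where V: "ac_deriv V v" using ac_primitive_exists[OF v] by blast
  have lV: "locally_integrable V" by (intro locally_integrable_continuous ac_deriv_continuous[OF V])
  have "\<exists>c. AE x in lborel. u x - V x = c"
  proof (rule du_Bois_Reymond)
    fix f assume f: "test_function f"
    note f' = test_function_deriv[OF f]
    have "(LINT x|lborel. deriv f x *\<^sub>R (u x - V x))
        = (LINT x|lborel. deriv f x *\<^sub>R u x) - (LINT x|lborel. deriv f x *\<^sub>R V x)"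
      unfolding scaleR_diff_right
      by (intro Bochner_Integration.integral_diff integrable_test_function_mult f' u lV)
    then show "(LINT x|lborel. deriv f x *\<^sub>R (u x - V x)) = 0"
      using weak[OF f] ac_deriv_integration_by_parts[OF V f] by simp
  qed (intro locally_integrable_diff u lV)
  then obtain c where c: "AE x in lborel. u x - V x = c" by blast
  have "ac_deriv (\<lambda>x. V x + c) v" using V by (simp add: ac_deriv_def)
  moreover have "AE x in lborel. u x = V x + c" using c by eventually_elim (simp add: algebra_simps)
  ultimately show ?thesis by blast
qed

section \<open>Representatives of square integrable classes\<close>

lemma square_integrable_locally_integrable:
  assumes u: "square_integrable u"
  shows "locally_integrable u"
proof (rule locally_integrable_bound)
  have i: "integrable lborel (\<lambda>x. (norm (u x))\<^sup>2)" using u by (simp add: square_integrable_def)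
  then have "set_integrable lborel {a..b} (\<lambda>x. (norm (u x))\<^sup>2)" for a b
    unfolding set_integrable_def by (rule integrable_mult_indicator[rotated]) simp
  then have "locally_integrable (\<lambda>x. (norm (u x))\<^sup>2)"
    using borel_measurable_integrable[OF i] by (simp add: locally_integrable_def)
  then show "locally_integrable (\<lambda>x. 1 + (norm (u x))\<^sup>2)"
    by (intro locally_integrable_add) (simp_all add: locally_integrable_continuous)
  show "u \<in> borel_measurable borel" using square_integrable_measurable[OF u] by simp
  have "norm (u x) \<le> 1 * norm (1 + (norm (u x))\<^sup>2)" for x
    using zero_le_power2[of "norm (u x) - 1"] norm_ge_zero[of "u x"]
    by (simp add: power2_diff del: norm_ge_zero) 
  then show "\<exists>C. \<forall>x\<in>{a..b}. norm (u x) \<le> C * norm (1 + (norm (u x))\<^sup>2)" for a b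
    by blast
qed

lemma borel_measurable_vec_nth [measurable]:
  "(\<lambda>v :: complex^2. v $ i) \<in> borel_measurable borel"
  by (intro borel_measurable_continuous_onI continuous_intros)

lemma locally_integrable_component:
  fixes u :: "real \<Rightarrow> complex^2"
  assumes u: "locally_integrable u"
  shows "locally_integrable (\<lambda>x. u x $ i)"
proof (rule locally_integrable_bound[OF u])
  have [measurable]: "u \<in> borel_measurable borel" by (rule locally_integrable_measurable[OF u])
  show "(\<lambda>x. u x $ i) \<in> borel_measurable borel" by measurable
  have "norm (u x $ i) \<le> 1 * norm (u x)" for x using Finite_Cartesian_Product.norm_nth_le by simp
  then show "\<exists>C. \<forall>x\<in>{a..b}. norm (u x $ i) \<le> C * norm (u x)" for a b by blast
qed

lemma vector_2_measurable:
  fixes g h :: "'a \<Rightarrow> complex"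
  assumes [measurable]: "g \<in> borel_measurable M" "h \<in> borel_measurable M"
  shows "(\<lambda>x. vector [g x, h x] :: complex^2) \<in> borel_measurable M"
proof -
  have "continuous_on UNIV (\<lambda>p :: complex \<times> complex. \<chi> i :: 2. if i = 1 then fst p else snd p)"
  proof (rule continuous_on_vec_lambda)
    show "continuous_on UNIV (\<lambda>p :: complex \<times> complex. if i = 1 then fst p else snd p)" for i :: 2
      by (cases "i = 1") (auto intro!: continuous_intros)
  qed
  also have "(\<lambda>p :: complex \<times> complex. \<chi> i :: 2. if i = 1 then fst p else snd p)
      = (\<lambda>p. vector [fst p, snd p])"
    by (simp add: fun_eq_iff vec_eq_iff forall_2)
  finally have [measurable]: "(\<lambda>p :: complex \<times> complex. vector [fst p, snd p] :: complex^2) \<in> borel_measurable borel"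
    by (rule borel_measurable_continuous_onI)
  have "(\<lambda>x. (\<lambda>p. vector [fst p, snd p] :: complex^2) (g x, h x)) \<in> borel_measurable M"
    by measurable
  then show ?thesis by simp
qed

lemma norm_vector_2_le: "norm (v :: complex^2) \<le> norm (v $ 1) + norm (v $ 2)"
  unfolding norm_vec_def by (rule order_trans[OF L2_set_le_sum]) (simp_all add: sum_2)

lemma square_integrable_bound:
  assumes u: "square_integrable u" and v: "square_integrable v"
    and [measurable]: "w \<in> borel_measurable borel"
    and bound: "AE x in lborel. norm (w x) \<le> C * (norm (u x) + norm (v x))"
  shows "square_integrable w"
  unfolding square_integrable_def
proof
  show "w \<in> borel_measurable lborel" by measurable
  have "integrable lborel (\<lambda>x. 2 * C\<^sup>2 * ((norm (u x))\<^sup>2 + (norm (v x))\<^sup>2))"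
    using u v by (simp add: square_integrable_def)
  then show "integrable lborel (\<lambda>x. (norm (w x))\<^sup>2)"
  proof (rule Bochner_Integration.integrable_bound)
    show "AE x in lborel. norm ((norm (w x))\<^sup>2) \<le> norm (2 * C\<^sup>2 * ((norm (u x))\<^sup>2 + (norm (v x))\<^sup>2))"
      using bound
    proof eventually_elim
      case (elim x)
      have "(norm (w x))\<^sup>2 \<le> (C * (norm (u x) + norm (v x)))\<^sup>2"
        by (rule power_mono[OF elim]) simp
      also have "\<dots> = C\<^sup>2 * (norm (u x) + norm (v x))\<^sup>2" by (simp add: power_mult_distrib)
      also have "\<dots> \<le> C\<^sup>2 * (2 * ((norm (u x))\<^sup>2 + (norm (v x))\<^sup>2))"
        using zero_le_power2[of "norm (u x) - norm (v x)"]
        by (intro mult_left_mono) (simp_all add: power2_sum power2_diff)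
      finally show ?case by (simp add: algebra_simps)
    qed
  qed measurable
qed

text \<open>
  Both the values of the operator and the derivatives of its solutions are of this form, with
  bounded coefficients that jump at the origin.
\<close>

lemma square_integrable_coefficient_combination:
  fixes c1 c2 :: "real \<Rightarrow> complex" and d1 d2 :: complex
  assumes u: "square_integrable u" and v: "square_integrable v"
    and [measurable]: "c1 \<in> borel_measurable borel" "c2 \<in> borel_measurable borel"
    and c: "\<And>x. norm (c1 x) \<le> K" "\<And>x. norm (c2 x) \<le> K"
  shows "square_integrable (\<lambda>x. vector [c1 x * u x $ i1 + d1 * v x $ j1, c2 x * u x $ i2 + d2 * v x $ j2])"
proof (rule square_integrable_bound[OF u v])
  let ?w = "\<lambda>x. vector [c1 x * u x $ i1 + d1 * v x $ j1, c2 x * u x $ i2 + d2 * v x $ j2] :: complex^2"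
  have [measurable]: "u \<in> borel_measurable borel" "v \<in> borel_measurable borel"
    using square_integrable_measurable u v by auto
  show "?w \<in> borel_measurable borel" by (intro vector_2_measurable) measurable
  let ?C = "K + norm d1 + norm d2"
  have K: "K \<ge> 0" by (rule order_trans[OF norm_ge_zero c(1)])
  have component: "norm (a * u x $ i + d * v x $ j) \<le> ?C * (norm (u x) + norm (v x))"
    if "norm a \<le> ?C" "norm d \<le> ?C" for a d i j x
  proof -
    have "norm (a * u x $ i + d * v x $ j) \<le> norm a * norm (u x $ i) + norm d * norm (v x $ j)"
      by (rule order_trans[OF norm_triangle_ineq]) (simp add: norm_mult)
    also have "\<dots> \<le> ?C * norm (u x) + ?C * norm (v x)"
      using that K by (intro add_mono mult_mono Finite_Cartesian_Product.norm_nth_le) auto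
    finally show ?thesis by (simp add: distrib_left)
  qed
  have C: "norm (c1 x) \<le> ?C" "norm (c2 x) \<le> ?C" "norm d1 \<le> ?C" "norm d2 \<le> ?C" for x
    using c[of x] K norm_ge_zero[of d1] norm_ge_zero[of d2] by linarith+
  have "norm (?w x) \<le> (2 * ?C) * (norm (u x) + norm (v x))" for x
    unfolding mult_2 distrib_right[of ?C ?C]
    using order_trans[OF norm_vector_2_le[of "?w x", unfolded vector_2]
        add_mono[OF component[OF C(1,3)] component[OF C(2,4)]]] .
  then show "AE x in lborel. norm (?w x) \<le> (2 * ?C) * (norm (u x) + norm (v x))" by simp
qed

lemma square_integrable_rep_l2: "square_integrable (rep_l2 f)"
proof -
  have "l2_rel (rep_l2 f) (rep_l2 f)" using Quotient_rep_reflp[OF Quotient_l2] .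
  then show ?thesis by (simp add: l2_rel_def)
qed

lemma rep_abs_l2_AE:
  assumes "square_integrable u"
  shows "AE x in lborel. rep_l2 (abs_l2 u) x = u x"
proof -
  have "l2_rel u u" using assms by (simp add: l2_rel_def)
  then have "l2_rel (rep_l2 (abs_l2 u)) u" using Quotient_rep_abs[OF Quotient_l2] by blast
  then show ?thesis by (simp add: l2_rel_def)
qed

lemma l2_eqI:
  assumes "AE x in lborel. rep_l2 f x = rep_l2 g x"
  shows "f = g"
  using assms Quotient_rel_rep[OF Quotient_l2, of f g]
  by (simp add: l2_rel_def square_integrable_rep_l2)

lemma abs_rep_l2: "abs_l2 (rep_l2 f) = f"
  by (rule Quotient_abs_rep[OF Quotient_l2])

lemma rep_l2_add_AE: "AE x in lborel. rep_l2 (f + g) x = rep_l2 f x + rep_l2 g x"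
proof -
  have "f + g = abs_l2 (\<lambda>x. rep_l2 f x + rep_l2 g x)"
    using plus_l2.abs_eq[of "rep_l2 f" "rep_l2 g"]
    by (simp add: abs_rep_l2 l2_rel_def square_integrable_rep_l2)
  then show ?thesis by (simp add: rep_abs_l2_AE square_integrable_add square_integrable_rep_l2)
qed

lemma rep_l2_diff_AE: "AE x in lborel. rep_l2 (f - g) x = rep_l2 f x - rep_l2 g x"
proof -
  have "f - g = abs_l2 (\<lambda>x. rep_l2 f x - rep_l2 g x)"
    using minus_l2.abs_eq[of "rep_l2 f" "rep_l2 g"]
    by (simp add: abs_rep_l2 l2_rel_def square_integrable_rep_l2)
  then show ?thesis by (simp add: rep_abs_l2_AE square_integrable_diff square_integrable_rep_l2)
qed

lemma rep_l2_scaleR_AE: "AE x in lborel. rep_l2 (r *\<^sub>R f) x = r *\<^sub>R rep_l2 f x"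
proof -
  have "r *\<^sub>R f = abs_l2 (\<lambda>x. r *\<^sub>R rep_l2 f x)"
    using scaleR_l2.abs_eq[of "rep_l2 f" r]
    by (simp add: abs_rep_l2 l2_rel_def square_integrable_rep_l2)
  then show ?thesis by (simp add: rep_abs_l2_AE square_integrable_scaleR square_integrable_rep_l2)
qed

lemma rep_l2_scaleC_AE: "AE x in lborel. rep_l2 (c *\<^sub>C f) x = c *s rep_l2 f x"
proof -
  have "c *\<^sub>C f = abs_l2 (\<lambda>x. c *s rep_l2 f x)"
    using scaleC_l2.abs_eq[of "rep_l2 f" c]
    by (simp add: abs_rep_l2 l2_rel_def square_integrable_rep_l2)
  then show ?thesis by (simp add: rep_abs_l2_AE square_integrable_cscale square_integrable_rep_l2)
qed

lemma norm_l2_eq: "norm f = sqrt (LINT x|lborel. (norm (rep_l2 f x))\<^sup>2)"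
proof -
  have "f \<bullet> f = (LINT x|lborel. rep_l2 f x \<bullet> rep_l2 f x)"
    using inner_l2.abs_eq[of "rep_l2 f" "rep_l2 f"]
    by (simp add: abs_rep_l2 l2_rel_def square_integrable_rep_l2)
  then show ?thesis by (simp add: norm_l2_def power2_norm_eq_inner)
qed

section \<open>Weak derivatives of square integrable classes\<close>

text \<open>
  This replaces the weak derivative, which is defined through test functions, by an ordinary one to which
  calculus applies.
\<close>

lemma has_weak_deriv_iff_ac:
  "has_weak_deriv u v \<longleftrightarrow> (\<forall>i. \<exists>U. ac_deriv U (\<lambda>x. rep_l2 v x $ i) \<and>
     (AE x in lborel. rep_l2 u x $ i = U x))"
proof
  have lu: "locally_integrable (rep_l2 u)" and lv: "locally_integrable (rep_l2 v)"
    by (intro square_integrable_locally_integrable square_integrable_rep_l2)+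
  note ci = integral_bounded_linear[OF bounded_linear_vec_nth integrable_test_function_mult]
  {
    assume weak: "has_weak_deriv u v"
    show "\<forall>i. \<exists>U. ac_deriv U (\<lambda>x. rep_l2 v x $ i) \<and> (AE x in lborel. rep_l2 u x $ i = U x)"
    proof
      fix i
      show "\<exists>U. ac_deriv U (\<lambda>x. rep_l2 v x $ i) \<and> (AE x in lborel. rep_l2 u x $ i = U x)"
      proof (rule weak_derivative_imp_ac_representative)
        fix f assume f: "test_function f"
        have "(LINT x|lborel. deriv f x *\<^sub>R rep_l2 u x) $ i = - (LINT x|lborel. f x *\<^sub>R rep_l2 v x) $ i"
          using weak f by (simp add: has_weak_deriv_def)
        then show "(LINT x|lborel. deriv f x *\<^sub>R rep_l2 u x $ i)
            = - (LINT x|lborel. f x *\<^sub>R rep_l2 v x $ i)"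
          using ci[OF test_function_deriv[OF f] lu, of i] ci[OF f lv, of i] by simp
      qed (intro locally_integrable_component lu lv)+
    qed
  }
  {
    assume *: "\<forall>i. \<exists>U. ac_deriv U (\<lambda>x. rep_l2 v x $ i) \<and> (AE x in lborel. rep_l2 u x $ i = U x)"
    show "has_weak_deriv u v"
      unfolding has_weak_deriv_def vec_eq_iff
    proof (intro allI impI)
      fix f and i :: 2 assume f: "test_function f"
      obtain U where U: "ac_deriv U (\<lambda>x. rep_l2 v x $ i)" "AE x in lborel. rep_l2 u x $ i = U x"
        using * by blast
      have [measurable]: "U \<in> borel_measurable borel" "deriv f \<in> borel_measurable borel"
          "rep_l2 u \<in> borel_measurable borel"
        using ac_deriv_measurable[OF U(1)] locally_integrable_measurable[OF lu]
          smooth_continuous[OF test_function_smooth[OF test_function_deriv[OF f]]]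
        by (auto intro: borel_measurable_continuous_onI)
      have "(LINT x|lborel. deriv f x *\<^sub>R rep_l2 u x $ i) = (LINT x|lborel. deriv f x *\<^sub>R U x)"
        by (rule integral_cong_AE) (use U(2) in auto)
      also have "\<dots> = - (LINT x|lborel. f x *\<^sub>R rep_l2 v x $ i)"
        by (rule ac_deriv_integration_by_parts[OF U(1) f])
      finally show "(LINT x|lborel. deriv f x *\<^sub>R rep_l2 u x) $ i
          = (- (LINT x|lborel. f x *\<^sub>R rep_l2 v x)) $ i"
        using ci[OF test_function_deriv[OF f] lu, of i] ci[OF f lv, of i] by simp
    qed
  }
qed

lemma has_weak_deriv_unique:
  assumes "has_weak_deriv u v" "has_weak_deriv u w"
  shows "v = w"
proof (rule l2_eqI)
  have lv: "locally_integrable (rep_l2 v)" and lw: "locally_integrable (rep_l2 w)"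
    by (intro square_integrable_locally_integrable square_integrable_rep_l2)+
  have "AE x in lborel. rep_l2 v x - rep_l2 w x = 0"
  proof (rule fundamental_lemma_calculus_of_variations)
    show "(LINT x|lborel. f x *\<^sub>R (rep_l2 v x - rep_l2 w x)) = 0" if f: "test_function f" for f
    proof -
      have "(LINT x|lborel. f x *\<^sub>R (rep_l2 v x - rep_l2 w x))
          = (LINT x|lborel. f x *\<^sub>R rep_l2 v x) - (LINT x|lborel. f x *\<^sub>R rep_l2 w x)"
        unfolding scaleR_diff_right
        by (intro Bochner_Integration.integral_diff integrable_test_function_mult f lv lw)
      also have "\<dots> = 0"
      proof -
        have "- (LINT x|lborel. f x *\<^sub>R rep_l2 v x) = - (LINT x|lborel. f x *\<^sub>R rep_l2 w x)"
          using assms f unfolding has_weak_deriv_def by simp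
        then show ?thesis by simp
      qed
      finally show ?thesis .
    qed
  qed (intro locally_integrable_diff lv lw)
  then show "AE x in lborel. rep_l2 v x = rep_l2 w x" by eventually_elim simp
qed

lemma weak_deriv_eqI: "has_weak_deriv u v \<Longrightarrow> weak_deriv u = v"
  unfolding weak_deriv_def using has_weak_deriv_unique by blast

section \<open>The Dirac equation as a first order system\<close>

text \<open>
  The coefficients \<open>a\<close> and \<open>b\<close> of the system \<open>u\<^sub>1' = a u\<^sub>2 + f\<^sub>2\<close>, \<open>u\<^sub>2' = b u\<^sub>1 - f\<^sub>1\<close> equivalent to
  \<open>(L\<^sub>m - z) u = f\<close>. At the origin they take an intermediate value, on a null set.
\<close>

definition coeff_up :: "real \<Rightarrow> complex \<Rightarrow> real \<Rightarrow> complex" where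
  "coeff_up m z x = of_real m - \<i> * of_real (sgn x) + z"

definition coeff_down :: "real \<Rightarrow> complex \<Rightarrow> real \<Rightarrow> complex" where
  "coeff_down m z x = of_real m + \<i> * of_real (sgn x) - z"

lemma coeff_measurable [measurable]:
  "coeff_up m z \<in> borel_measurable borel" "coeff_down m z \<in> borel_measurable borel"
  unfolding coeff_up_def[abs_def] coeff_down_def[abs_def] by measurable

lemma coeff_bounded:
  "norm (coeff_up m z x) \<le> norm (complex_of_real m) + 1 + norm z"
  "norm (coeff_down m z x) \<le> norm (complex_of_real m) + 1 + norm z"
proof -
  have s: "norm (\<i> * complex_of_real (sgn x)) \<le> 1" by (simp add: norm_mult sgn_if)
  show "norm (coeff_up m z x) \<le> norm (complex_of_real m) + 1 + norm z"
    unfolding coeff_up_def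
    using s norm_triangle_ineq[of "of_real m - \<i> * complex_of_real (sgn x)" z]
      norm_triangle_ineq4[of "of_real m" "\<i> * complex_of_real (sgn x)"] by linarith
  show "norm (coeff_down m z x) \<le> norm (complex_of_real m) + 1 + norm z"
    unfolding coeff_down_def
    using s norm_triangle_ineq4[of "of_real m + \<i> * complex_of_real (sgn x)" z]
      norm_triangle_ineq[of "of_real m" "\<i> * complex_of_real (sgn x)"] by linarith
qed

lemma dirac_op_eq_iff:
  assumes v: "has_weak_deriv u v"
  shows "dirac_op m u - z *\<^sub>C u = f \<longleftrightarrow>
    (AE x in lborel. rep_l2 v x $ 1 = coeff_up m z x * rep_l2 u x $ 2 + rep_l2 f x $ 2 \<and>
       rep_l2 v x $ 2 = coeff_down m z x * rep_l2 u x $ 1 - rep_l2 f x $ 1)"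
proof -
  let ?u = "rep_l2 u" and ?v = "rep_l2 v"
  define W where "W x = vector [of_real m * ?u x $ 1 - ?v x $ 2, ?v x $ 1 - of_real m * ?u x $ 2]
      + (\<i> * of_real (sgn x)) *s ?u x" for x
  have W1: "W x $ 1 = (of_real m + \<i> * of_real (sgn x)) * ?u x $ 1 - ?v x $ 2"
    and W2: "W x $ 2 = ?v x $ 1 - (of_real m - \<i> * of_real (sgn x)) * ?u x $ 2" for x
    by (simp_all add: W_def algebra_simps)
  have W_eq: "W = (\<lambda>x. vector [coeff_down m 0 x * ?u x $ 1 + (-1) * ?v x $ 2,
      - coeff_up m 0 x * ?u x $ 2 + 1 * ?v x $ 1])"
    by (simp add: fun_eq_iff vec_eq_iff forall_2 W1 W2 coeff_up_def coeff_down_def algebra_simps)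
  have W: "square_integrable W"
    unfolding W_eq using coeff_bounded[of m 0]
    by (intro square_integrable_coefficient_combination square_integrable_rep_l2) auto
  have op: "dirac_op m u = abs_l2 W"
    by (simp add: dirac_op_def weak_deriv_eqI[OF v] Let_def W_def[abs_def])
  have rep: "AE x in lborel. rep_l2 (dirac_op m u - z *\<^sub>C u) x = W x - z *s ?u x"
    using rep_l2_diff_AE[of "dirac_op m u" "z *\<^sub>C u"] rep_l2_scaleC_AE[of z u] rep_abs_l2_AE[OF W]
    by eventually_elim (simp add: op)
  have pw: "W x - z *s ?u x = rep_l2 f x \<longleftrightarrow>
      (?v x $ 1 = coeff_up m z x * ?u x $ 2 + rep_l2 f x $ 2 \<and>
       ?v x $ 2 = coeff_down m z x * ?u x $ 1 - rep_l2 f x $ 1)" for x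
    by (auto simp: vec_eq_iff forall_2 W1 W2 coeff_up_def coeff_down_def algebra_simps)
  have "dirac_op m u - z *\<^sub>C u = f \<longleftrightarrow> (AE x in lborel. W x - z *s ?u x = rep_l2 f x)"
  proof
    assume eq: "dirac_op m u - z *\<^sub>C u = f"
    show "AE x in lborel. W x - z *s ?u x = rep_l2 f x"
      using rep by eventually_elim (simp add: eq)
  next
    assume "AE x in lborel. W x - z *s ?u x = rep_l2 f x"
    with rep have "AE x in lborel. rep_l2 (dirac_op m u - z *\<^sub>C u) x = rep_l2 f x"
      by eventually_elim simp
    then show "dirac_op m u - z *\<^sub>C u = f" by (rule l2_eqI)
  qed
  then show ?thesis by (simp add: pw)
qed

text \<open>
  The resolvent equation as an inhomogeneous system of ordinary differential equations in the
  absolutely continuous sense. Both directions are used: one to verify that variation of constants gives a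
  solution, the other to compare two solutions.
\<close>

lemma dirac_equation_iff_ac:
  "u \<in> H1 \<and> dirac_op m u - z *\<^sub>C u = f \<longleftrightarrow>
    (\<exists>U1 U2. ac_deriv U1 (\<lambda>x. coeff_up m z x * U2 x + rep_l2 f x $ 2) \<and>
             ac_deriv U2 (\<lambda>x. coeff_down m z x * U1 x - rep_l2 f x $ 1) \<and>
             (AE x in lborel. rep_l2 u x = vector [U1 x, U2 x]))"
  (is "?L \<longleftrightarrow> ?R")
proof
  have mf [measurable]: "rep_l2 g \<in> borel_measurable borel" for g
    using square_integrable_measurable[OF square_integrable_rep_l2] by auto
  assume ?L
  then obtain v where v: "has_weak_deriv u v" by (auto simp: H1_def)
  have eq: "AE x in lborel. rep_l2 v x $ 1 = coeff_up m z x * rep_l2 u x $ 2 + rep_l2 f x $ 2 \<and>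
       rep_l2 v x $ 2 = coeff_down m z x * rep_l2 u x $ 1 - rep_l2 f x $ 1"
    using dirac_op_eq_iff[OF v] \<open>?L\<close> by blast
  obtain U1 where U1: "ac_deriv U1 (\<lambda>x. rep_l2 v x $ 1)" "AE x in lborel. rep_l2 u x $ 1 = U1 x"
    using v by (auto simp: has_weak_deriv_iff_ac)
  obtain U2 where U2: "ac_deriv U2 (\<lambda>x. rep_l2 v x $ 2)" "AE x in lborel. rep_l2 u x $ 2 = U2 x"
    using v by (auto simp: has_weak_deriv_iff_ac)
  have [measurable]: "U1 \<in> borel_measurable borel" "U2 \<in> borel_measurable borel"
    using ac_deriv_measurable U1 U2 by auto
  have "ac_deriv U1 (\<lambda>x. coeff_up m z x * U2 x + rep_l2 f x $ 2)"
  proof (rule ac_deriv_cong[OF U1(1)])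
    show "AE x in lborel. rep_l2 v x $ 1 = coeff_up m z x * U2 x + rep_l2 f x $ 2"
      using eq U2(2) by eventually_elim simp
  qed measurable
  moreover have "ac_deriv U2 (\<lambda>x. coeff_down m z x * U1 x - rep_l2 f x $ 1)"
  proof (rule ac_deriv_cong[OF U2(1)])
    show "AE x in lborel. rep_l2 v x $ 2 = coeff_down m z x * U1 x - rep_l2 f x $ 1"
      using eq U1(2) by eventually_elim simp
  qed measurable
  moreover have "AE x in lborel. rep_l2 u x = vector [U1 x, U2 x]"
    using U1(2) U2(2) by eventually_elim (simp add: vec_eq_iff forall_2)
  ultimately show ?R by blast
next
  have mf [measurable]: "rep_l2 g \<in> borel_measurable borel" for g
    using square_integrable_measurable[OF square_integrable_rep_l2] by auto
  assume ?R
  then obtain U1 U2 where U: "ac_deriv U1 (\<lambda>x. coeff_up m z x * U2 x + rep_l2 f x $ 2)"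
      "ac_deriv U2 (\<lambda>x. coeff_down m z x * U1 x - rep_l2 f x $ 1)"
      and rep: "AE x in lborel. rep_l2 u x = vector [U1 x, U2 x]" by blast
  define V where "V x = (vector [coeff_up m z x * rep_l2 u x $ 2 + rep_l2 f x $ 2,
      coeff_down m z x * rep_l2 u x $ 1 - rep_l2 f x $ 1] :: complex^2)" for x
  have V_eq: "V = (\<lambda>x. vector [coeff_up m z x * rep_l2 u x $ 2 + 1 * rep_l2 f x $ 2,
      coeff_down m z x * rep_l2 u x $ 1 + (-1) * rep_l2 f x $ 1])"
    by (simp add: V_def[abs_def])
  have V: "square_integrable V"
    unfolding V_eq using coeff_bounded[of m z]
    by (intro square_integrable_coefficient_combination square_integrable_rep_l2) auto
  note repV = rep_abs_l2_AE[OF V]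
  have weak: "has_weak_deriv u (abs_l2 V)"
    unfolding has_weak_deriv_iff_ac forall_2
  proof (intro conjI exI)
    show "ac_deriv U1 (\<lambda>x. rep_l2 (abs_l2 V) x $ 1)"
    proof (rule ac_deriv_cong[OF U(1)])
      show "AE x in lborel. coeff_up m z x * U2 x + rep_l2 f x $ 2 = rep_l2 (abs_l2 V) x $ 1"
        using repV rep by eventually_elim (simp add: V_def)
    qed measurable
    show "ac_deriv U2 (\<lambda>x. rep_l2 (abs_l2 V) x $ 2)"
    proof (rule ac_deriv_cong[OF U(2)])
      show "AE x in lborel. coeff_down m z x * U1 x - rep_l2 f x $ 1 = rep_l2 (abs_l2 V) x $ 2"
        using repV rep by eventually_elim (simp add: V_def)
    qed measurable
    show "AE x in lborel. rep_l2 u x $ 1 = U1 x" "AE x in lborel. rep_l2 u x $ 2 = U2 x"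
      using rep by (eventually_elim, simp)+
  qed
  have "AE x in lborel. rep_l2 (abs_l2 V) x $ 1 = coeff_up m z x * rep_l2 u x $ 2 + rep_l2 f x $ 2 \<and>
       rep_l2 (abs_l2 V) x $ 2 = coeff_down m z x * rep_l2 u x $ 1 - rep_l2 f x $ 1"
    using repV by eventually_elim (simp add: V_def)
  then have "dirac_op m u - z *\<^sub>C u = f" using dirac_op_eq_iff[OF weak] by blast
  then show ?L using weak by (auto simp: H1_def)
qed

section \<open>Convolution with an exponential\<close>

lemma nn_integral_exp_abs_le:
  fixes c :: real
  assumes c: "c > 0"
  shows "(\<integral>\<^sup>+y. ennreal (exp (- c * \<bar>x - y\<bar>)) \<partial>lborel) \<le> ennreal (2 / c)"
proof -
  \<comment> \<open>One half of the integrand; at \<open>0\<close> both halves count, hence an inequality below.\<close>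
  let ?h = "\<lambda>t. ennreal (exp (- c * t)) * indicator {0..} t"
  have "((\<lambda>t. - exp (- c * t) / c) \<longlongrightarrow> - 0 / c) at_top"
    by (intro tendsto_intros filterlim_compose[OF exp_at_bot]
      filterlim_tendsto_neg_mult_at_bot[OF tendsto_const] filterlim_ident) (use c in auto)
  then have half: "(\<integral>\<^sup>+t. ?h t \<partial>lborel) = ennreal (0 - (- exp (- c * 0) / c))"
    by (intro nn_integral_FTC_atLeast) (use c in \<open>auto intro!: derivative_eq_intros\<close>)
  have half': "(\<integral>\<^sup>+t. ?h (- t) \<partial>lborel) = (\<integral>\<^sup>+t. ?h t \<partial>lborel)"
    using nn_integral_real_affine[of ?h "-1" 0] by simp
  have "(\<integral>\<^sup>+y. ennreal (exp (- c * \<bar>x - y\<bar>)) \<partial>lborel) = (\<integral>\<^sup>+t. ennreal (exp (- c * \<bar>t\<bar>)) \<partial>lborel)"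
    using nn_integral_real_affine[of "\<lambda>t. ennreal (exp (- c * \<bar>t\<bar>))" "-1" x] by simp
  also have "\<dots> \<le> (\<integral>\<^sup>+t. ?h t + ?h (- t) \<partial>lborel)"
    by (intro nn_integral_mono) (auto simp: indicator_def abs_if)
  also have "\<dots> = (\<integral>\<^sup>+t. ?h t \<partial>lborel) + (\<integral>\<^sup>+t. ?h (- t) \<partial>lborel)"
    by (intro nn_integral_add) measurable
  also have "\<dots> = ennreal (2 / c)"
    unfolding half' half using c by (simp flip: ennreal_plus)
  finally show ?thesis .
qed

text \<open>
  The Cauchy-Schwarz inequality after splitting the exponential into two equal factors, one of which
  has square integral at most \<open>2 / c\<close>.
\<close>

lemma exp_convolution_Cauchy_Schwarz:
  fixes c :: real and g :: "real \<Rightarrow> ennreal"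
  assumes c: "c > 0" and [measurable]: "g \<in> borel_measurable borel"
  shows "(\<integral>\<^sup>+y. ennreal (exp (- c * \<bar>x - y\<bar>)) * g y \<partial>lborel)\<^sup>2
    \<le> ennreal (2 / c) * (\<integral>\<^sup>+y. ennreal (exp (- c * \<bar>x - y\<bar>)) * (g y)\<^sup>2 \<partial>lborel)"
proof -
  let ?r = "\<lambda>y. ennreal (exp (- (c / 2) * \<bar>x - y\<bar>))"
  have rr: "ennreal (exp (- c * \<bar>x - y\<bar>)) = ?r y * ?r y" for y
    by (simp add: ennreal_mult[symmetric] exp_add[symmetric])
  have "(\<integral>\<^sup>+y. ?r y * (?r y * g y) \<partial>lborel)\<^sup>2
      \<le> (\<integral>\<^sup>+y. (?r y)\<^sup>2 \<partial>lborel) * (\<integral>\<^sup>+y. (?r y * g y)\<^sup>2 \<partial>lborel)"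
    by (rule Cauchy_Schwarz_nn_integral) measurable
  also have "(\<integral>\<^sup>+y. (?r y)\<^sup>2 \<partial>lborel) \<le> ennreal (2 / c)"
    using nn_integral_exp_abs_le[OF c, of x] by (simp only: rr power2_eq_square)
  finally show ?thesis
    by (simp only: rr power2_eq_square mult_ac mult_right_mono zero_le)
qed

text \<open>
  Schur's test: after the Cauchy-Schwarz inequality, Tonelli's theorem allows to integrate the
  exponential in the other variable.
\<close>

lemma exp_convolution_Schur:
  fixes c :: real and g :: "real \<Rightarrow> ennreal"
  assumes c: "c > 0" and [measurable]: "g \<in> borel_measurable borel"
  shows "(\<integral>\<^sup>+x. (\<integral>\<^sup>+y. ennreal (exp (- c * \<bar>x - y\<bar>)) * g y \<partial>lborel)\<^sup>2 \<partial>lborel)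
    \<le> (ennreal (2 / c))\<^sup>2 * (\<integral>\<^sup>+y. (g y)\<^sup>2 \<partial>lborel)"
proof -
  let ?k = "\<lambda>x y. ennreal (exp (- c * \<bar>x - y\<bar>))"
  have "(\<integral>\<^sup>+x. (\<integral>\<^sup>+y. ?k x y * g y \<partial>lborel)\<^sup>2 \<partial>lborel)
      \<le> (\<integral>\<^sup>+x. ennreal (2 / c) * (\<integral>\<^sup>+y. ?k x y * (g y)\<^sup>2 \<partial>lborel) \<partial>lborel)"
    by (intro nn_integral_mono exp_convolution_Cauchy_Schwarz c) measurable
  also have "\<dots> = ennreal (2 / c) * (\<integral>\<^sup>+x. (\<integral>\<^sup>+y. ?k x y * (g y)\<^sup>2 \<partial>lborel) \<partial>lborel)"
    by (rule nn_integral_cmult) measurable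
  also have "(\<integral>\<^sup>+x. (\<integral>\<^sup>+y. ?k x y * (g y)\<^sup>2 \<partial>lborel) \<partial>lborel)
      = (\<integral>\<^sup>+y. (\<integral>\<^sup>+x. ?k x y * (g y)\<^sup>2 \<partial>lborel) \<partial>lborel)"
    by (rule lborel_pair.Fubini'[symmetric]) measurable
  also have "\<dots> \<le> (\<integral>\<^sup>+y. ennreal (2 / c) * (g y)\<^sup>2 \<partial>lborel)"
  proof (rule nn_integral_mono)
    fix y
    have "(\<integral>\<^sup>+x. ?k x y * (g y)\<^sup>2 \<partial>lborel) = (\<integral>\<^sup>+x. ?k y x \<partial>lborel) * (g y)\<^sup>2"
      by (subst nn_integral_multc) (simp_all add: abs_minus_commute)
    also have "\<dots> \<le> ennreal (2 / c) * (g y)\<^sup>2"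
      by (intro mult_right_mono nn_integral_exp_abs_le c) simp
    finally show "(\<integral>\<^sup>+x. ?k x y * (g y)\<^sup>2 \<partial>lborel) \<le> ennreal (2 / c) * (g y)\<^sup>2" .
  qed
  also have "\<dots> = ennreal (2 / c) * (\<integral>\<^sup>+y. (g y)\<^sup>2 \<partial>lborel)"
    by (rule nn_integral_cmult) measurable
  finally show ?thesis by (simp add: mult_left_mono power2_eq_square mult.assoc)
qed

lemma square_integrable_nn_integral:
  assumes "square_integrable \<phi>"
  shows "(\<integral>\<^sup>+y. (ennreal (norm (\<phi> y)))\<^sup>2 \<partial>lborel) = ennreal (LINT y|lborel. (norm (\<phi> y))\<^sup>2)"
  using assms unfolding square_integrable_def
  by (subst nn_integral_eq_integral[symmetric]) (auto simp: ennreal_power)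

lemma integrable_exp_mult_square_integrable:
  assumes c: "c > 0" and \<phi>: "square_integrable \<phi>"
  shows "integrable lborel (\<lambda>y. exp (- c * \<bar>x - y\<bar>) * norm (\<phi> y))"
proof (rule integrableI_nonneg)
  have [measurable]: "\<phi> \<in> borel_measurable borel" using square_integrable_measurable[OF \<phi>] by simp
  show "(\<lambda>y. exp (- c * \<bar>x - y\<bar>) * norm (\<phi> y)) \<in> borel_measurable lborel" by measurable
  let ?k = "\<lambda>y. ennreal (exp (- c * \<bar>x - y\<bar>))"
  have "(\<integral>\<^sup>+y. ?k y * ennreal (norm (\<phi> y)) \<partial>lborel)\<^sup>2
      \<le> ennreal (2 / c) * (\<integral>\<^sup>+y. ?k y * (ennreal (norm (\<phi> y)))\<^sup>2 \<partial>lborel)"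
    by (rule exp_convolution_Cauchy_Schwarz[OF c]) measurable
  also have "\<dots> \<le> ennreal (2 / c) * (\<integral>\<^sup>+y. (ennreal (norm (\<phi> y)))\<^sup>2 \<partial>lborel)"
  proof (intro mult_left_mono nn_integral_mono)
    show "?k y * (ennreal (norm (\<phi> y)))\<^sup>2 \<le> (ennreal (norm (\<phi> y)))\<^sup>2" for y
      using mult_right_mono[of "?k y" 1 "(ennreal (norm (\<phi> y)))\<^sup>2"] c by simp
  qed simp
  also have "\<dots> < \<infinity>"
    unfolding square_integrable_nn_integral[OF \<phi>] by (simp add: ennreal_mult_less_top)
  finally have "(\<integral>\<^sup>+y. ?k y * ennreal (norm (\<phi> y)) \<partial>lborel) < \<infinity>"
    by (auto simp: power2_eq_square ennreal_mult_less_top)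
  then show "(\<integral>\<^sup>+y. ennreal (exp (- c * \<bar>x - y\<bar>) * norm (\<phi> y)) \<partial>lborel) < \<infinity>"
    by (simp add: ennreal_mult)
qed auto

lemma exp_convolution_square_integrable:
  fixes u :: "real \<Rightarrow> complex^2"
  assumes c: "c > 0" and \<phi>: "square_integrable \<phi>" and [measurable]: "u \<in> borel_measurable borel"
    and D: "D \<ge> 0" and bound: "\<And>x. norm (u x) \<le> D * (LINT y|lborel. exp (- c * \<bar>x - y\<bar>) * norm (\<phi> y))"
  shows "square_integrable u"
    and "(LINT x|lborel. (norm (u x))\<^sup>2) \<le> (2 * D / c)\<^sup>2 * (LINT x|lborel. (norm (\<phi> x))\<^sup>2)"
proof -
  have [measurable]: "\<phi> \<in> borel_measurable borel" using square_integrable_measurable[OF \<phi>] by simp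
  have L0: "0 \<le> (LINT x|lborel. (norm (\<phi> x))\<^sup>2)" by (intro Bochner_Integration.integral_nonneg) simp
  have "ennreal (norm (u x)) \<le> ennreal D * (\<integral>\<^sup>+y. ennreal (exp (- c * \<bar>x - y\<bar>)) * ennreal (norm (\<phi> y)) \<partial>lborel)" for x
  proof -
    have "(\<integral>\<^sup>+y. ennreal (exp (- c * \<bar>x - y\<bar>)) * ennreal (norm (\<phi> y)) \<partial>lborel)
        = ennreal (LINT y|lborel. exp (- c * \<bar>x - y\<bar>) * norm (\<phi> y))"
      using nn_integral_eq_integral[OF integrable_exp_mult_square_integrable[OF c \<phi>, of x]]
      by (simp add: ennreal_mult)
    then show ?thesis using bound[of x] D by (simp add: ennreal_mult'[symmetric] ennreal_leI)
  qed
  then have "(\<integral>\<^sup>+x. (ennreal (norm (u x)))\<^sup>2 \<partial>lborel) \<le>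
      (\<integral>\<^sup>+x. (ennreal D)\<^sup>2 * (\<integral>\<^sup>+y. ennreal (exp (- c * \<bar>x - y\<bar>)) * ennreal (norm (\<phi> y)) \<partial>lborel)\<^sup>2 \<partial>lborel)"
    unfolding power_mult_distrib[symmetric] by (intro nn_integral_mono power_mono) auto
  also have "\<dots> = (ennreal D)\<^sup>2 * (\<integral>\<^sup>+x. (\<integral>\<^sup>+y. ennreal (exp (- c * \<bar>x - y\<bar>)) * ennreal (norm (\<phi> y)) \<partial>lborel)\<^sup>2 \<partial>lborel)"
    by (rule nn_integral_cmult) measurable
  also have "\<dots> \<le> (ennreal D)\<^sup>2 * ((ennreal (2 / c))\<^sup>2 * (\<integral>\<^sup>+y. (ennreal (norm (\<phi> y)))\<^sup>2 \<partial>lborel))"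
    by (rule mult_left_mono[OF exp_convolution_Schur[OF c]]) simp_all
  also have "\<dots> = ennreal ((2 * D / c)\<^sup>2 * (LINT x|lborel. (norm (\<phi> x))\<^sup>2))"
    unfolding square_integrable_nn_integral[OF \<phi>] using c D L0
    by (simp add: ennreal_power ennreal_mult[symmetric] power_mult_distrib power_divide mult_ac)
  finally have le: "(\<integral>\<^sup>+x. ennreal ((norm (u x))\<^sup>2) \<partial>lborel)
      \<le> ennreal ((2 * D / c)\<^sup>2 * (LINT x|lborel. (norm (\<phi> x))\<^sup>2))"
    by (simp add: ennreal_power)
  then have int: "integrable lborel (\<lambda>x. (norm (u x))\<^sup>2)"
    by (intro integrableI_nonneg) (auto intro: le_less_trans)
  then show "square_integrable u" by (simp add: square_integrable_def)
  show "(LINT x|lborel. (norm (u x))\<^sup>2) \<le> (2 * D / c)\<^sup>2 * (LINT x|lborel. (norm (\<phi> x))\<^sup>2)"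
    using le L0 nn_integral_eq_integral[OF int] by (simp add: ennreal_le_iff)
qed

section \<open>Solutions of the homogeneous system\<close>

text \<open>
  The principal root has zero real part only when \<open>m\<^sup>2 - \<zeta>\<^sup>2 \<le> 0\<close>, that is, when \<open>\<zeta>\<close> is real with \<open>\<bar>\<zeta>\<bar> \<ge> m\<close>.
  It is applied with \<open>\<zeta> = z \<plusminus> \<i>\<close>, since \<open>\<mu>m\<close> and \<open>\<mu>p\<close> are roots of \<open>m\<^sup>2 - (z + \<i>)\<^sup>2\<close> and
  \<open>m\<^sup>2 - (z - \<i>)\<^sup>2\<close>.
\<close>

lemma Re_csqrt_diff_squares_pos:
  assumes "m \<ge> 0" and "\<not> (Im \<zeta> = 0 \<and> \<bar>Re \<zeta>\<bar> \<ge> m)"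
  shows "Re (csqrt (of_real (m\<^sup>2) - \<zeta>\<^sup>2)) > 0"
proof (rule ccontr)
  define s where "s = csqrt (of_real (m\<^sup>2) - \<zeta>\<^sup>2)"
  assume "\<not> Re (csqrt (of_real (m\<^sup>2) - \<zeta>\<^sup>2)) > 0"
  then have R: "Re s = 0" using csqrt_principal[of "of_real (m\<^sup>2) - \<zeta>\<^sup>2"] by (auto simp: s_def)
  have sq: "s\<^sup>2 = of_real (m\<^sup>2) - \<zeta>\<^sup>2" by (simp add: s_def)
  have "- ((Im s)\<^sup>2) = m\<^sup>2 - ((Re \<zeta>)\<^sup>2 - (Im \<zeta>)\<^sup>2)"
    using arg_cong[OF sq, of Re] R by (simp add: Re_power2 flip: of_real_power)
  then have re: "m\<^sup>2 + (Im \<zeta>)\<^sup>2 \<le> (Re \<zeta>)\<^sup>2" using zero_le_power2[of "Im s"] by linarith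
  have "Re \<zeta> * Im \<zeta> = 0"
    using arg_cong[OF sq, of Im] R by (simp add: Im_power2 flip: of_real_power)
  moreover have "Im \<zeta> = 0" if "Re \<zeta> = 0"
    using re that zero_le_power2[of m] zero_le_power2[of "Im \<zeta>"] by (simp add: sum_power2_le_zero_iff)
  ultimately have "Im \<zeta> = 0" by auto
  with re have "\<bar>m\<bar> \<le> \<bar>Re \<zeta>\<bar>" by (simp add: abs_le_square_iff)
  with \<open>Im \<zeta> = 0\<close> assms show False by simp
qed

text \<open>
  The first and, up to sign, the second component of the solution that decays as
  \<open>exp (- \<mu> x)\<close> for \<open>x > 0\<close>. On the other half line, where the parameters are \<open>\<mu>'\<close> and \<open>w'\<close>, it is the
  combination of the two exponentials that matches the values \<open>1\<close> and \<open>w\<close> at the origin. The reflection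
  \<open>x \<mapsto> - x\<close> exchanges the two half lines and changes the sign of the second component, so one pair of
  profiles serves for both decaying solutions.
\<close>

definition profile1 :: "complex \<Rightarrow> complex \<Rightarrow> complex \<Rightarrow> complex \<Rightarrow> real \<Rightarrow> complex" where
  "profile1 \<mu> w \<mu>' w' x =
    (if x \<le> 0 then (w' - w) / (2 * w') * exp (\<mu>' * x) + (w' + w) / (2 * w') * exp (- \<mu>' * x)
     else exp (- \<mu> * x))"

definition profile2 :: "complex \<Rightarrow> complex \<Rightarrow> complex \<Rightarrow> complex \<Rightarrow> real \<Rightarrow> complex" where
  "profile2 \<mu> w \<mu>' w' x =
    (if x \<le> 0 then (w - w') / 2 * exp (\<mu>' * x) + (w + w') / 2 * exp (- \<mu>' * x)
     else w * exp (- \<mu> * x))"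

lemma profile_continuous:
  assumes "w' \<noteq> 0"
  shows "continuous_on UNIV (profile1 \<mu> w \<mu>' w')" "continuous_on UNIV (profile2 \<mu> w \<mu>' w')"
  unfolding profile1_def[abs_def] profile2_def[abs_def]
  by (rule continuous_on_cases_le; (intro continuous_intros)?;
      use assms in \<open>simp add: field_simps\<close>)+

lemma has_vector_derivative_exp_linear:
  fixes c \<mu> :: complex
  shows
  "((\<lambda>x :: real. c * exp (\<mu> * x)) has_vector_derivative c * \<mu> * exp (\<mu> * x)) (at x)"
proof -
  have "((\<lambda>u. c * exp (\<mu> * u)) has_field_derivative c * \<mu> * exp (\<mu> * of_real x)) (at (of_real x))"
    by (auto intro!: derivative_eq_intros)
  then show ?thesis by (rule has_vector_derivative_real_field[where f = "\<lambda>u. c * exp (\<mu> * u)"])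
qed

lemma profile_derivative:
  assumes "w \<noteq> 0" "w' \<noteq> 0" "x \<noteq> 0"
  shows "(profile1 \<mu> w \<mu>' w' has_vector_derivative
      - ((if x \<le> 0 then \<mu>' / w' else \<mu> / w) * profile2 \<mu> w \<mu>' w' x)) (at x)"
    and "(profile2 \<mu> w \<mu>' w' has_vector_derivative
      - ((if x \<le> 0 then \<mu>' * w' else \<mu> * w) * profile1 \<mu> w \<mu>' w' x)) (at x)"
proof -
  note E = has_vector_derivative_exp_linear
  have "(profile1 \<mu> w \<mu>' w' has_vector_derivative
      - ((if x \<le> 0 then \<mu>' / w' else \<mu> / w) * profile2 \<mu> w \<mu>' w' x)) (at x) \<and>
    (profile2 \<mu> w \<mu>' w' has_vector_derivative
      - ((if x \<le> 0 then \<mu>' * w' else \<mu> * w) * profile1 \<mu> w \<mu>' w' x)) (at x)"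
  proof (cases "x < 0")
    case True
    have 1: "(profile1 \<mu> w \<mu>' w' has_vector_derivative
      (w' - w) / (2 * w') * \<mu>' * exp (\<mu>' * x) + (w' + w) / (2 * w') * - \<mu>' * exp (- \<mu>' * x)) (at x)"
      by (rule has_vector_derivative_transform_within_open
          [OF has_vector_derivative_add[OF E[of _ \<mu>'] E[of _ "- \<mu>'"]], of "{..<0}"])
        (use True in \<open>auto simp: profile1_def\<close>)
    have 2: "(profile2 \<mu> w \<mu>' w' has_vector_derivative
      (w - w') / 2 * \<mu>' * exp (\<mu>' * x) + (w + w') / 2 * - \<mu>' * exp (- \<mu>' * x)) (at x)"
      by (rule has_vector_derivative_transform_within_open
          [OF has_vector_derivative_add[OF E[of _ \<mu>'] E[of _ "- \<mu>'"]], of "{..<0}"])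
        (use True in \<open>auto simp: profile2_def\<close>)
    show ?thesis
    proof
      show "(profile1 \<mu> w \<mu>' w' has_vector_derivative
          - ((if x \<le> 0 then \<mu>' / w' else \<mu> / w) * profile2 \<mu> w \<mu>' w' x)) (at x)"
        by (rule has_vector_derivative_eq_rhs[OF 1])
          (use True assms in \<open>simp add: profile2_def field_simps\<close>)
      show "(profile2 \<mu> w \<mu>' w' has_vector_derivative
          - ((if x \<le> 0 then \<mu>' * w' else \<mu> * w) * profile1 \<mu> w \<mu>' w' x)) (at x)"
        by (rule has_vector_derivative_eq_rhs[OF 2])
          (use True assms in \<open>simp add: profile1_def field_simps\<close>)
    qed
  next
    case False
    then have "x > 0" using assms by simp
    have 1: "(profile1 \<mu> w \<mu>' w' has_vector_derivative 1 * - \<mu> * exp (- \<mu> * x)) (at x)"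
      by (rule has_vector_derivative_transform_within_open[OF E[of 1 "- \<mu>"], of "{0<..}"])
        (use \<open>x > 0\<close> in \<open>auto simp: profile1_def\<close>)
    have 2: "(profile2 \<mu> w \<mu>' w' has_vector_derivative w * - \<mu> * exp (- \<mu> * x)) (at x)"
      by (rule has_vector_derivative_transform_within_open[OF E[of w "- \<mu>"], of "{0<..}"])
        (use \<open>x > 0\<close> in \<open>auto simp: profile2_def\<close>)
    show ?thesis using 1 2 \<open>x > 0\<close> assms by (simp add: profile1_def profile2_def mult_ac)
  qed
  then show "(profile1 \<mu> w \<mu>' w' has_vector_derivative
      - ((if x \<le> 0 then \<mu>' / w' else \<mu> / w) * profile2 \<mu> w \<mu>' w' x)) (at x)"
    "(profile2 \<mu> w \<mu>' w' has_vector_derivative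
      - ((if x \<le> 0 then \<mu>' * w' else \<mu> * w) * profile1 \<mu> w \<mu>' w' x)) (at x)"
    by blast+
qed

lemma norm_exp_combination_le:
  assumes "Re \<mu> > 0" "x \<le> 0"
  shows "norm (c * exp (\<mu> * of_real x) + d * exp (- \<mu> * of_real x)) \<le> (norm c + norm d) * exp (- (Re \<mu> * x))"
proof -
  have "norm (c * exp (\<mu> * of_real x) + d * exp (- \<mu> * of_real x))
      \<le> norm c * exp (Re \<mu> * x) + norm d * exp (- (Re \<mu> * x))"
    by (rule order_trans[OF norm_triangle_ineq]) (simp add: norm_mult)
  also have "exp (Re \<mu> * x) \<le> exp (- (Re \<mu> * x))"
    using assms by (simp add: mult_nonneg_nonpos)
  finally show ?thesis by (simp add: distrib_right mult_left_mono)
qed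

lemma profile_bound:
  assumes "Re \<mu> > 0" "Re \<mu>' > 0"
  shows "\<exists>C\<ge>0. \<forall>x. norm (profile1 \<mu> w \<mu>' w' x) \<le> C * exp (- ((if x \<le> 0 then Re \<mu>' else Re \<mu>) * x))
    \<and> norm (profile2 \<mu> w \<mu>' w' x) \<le> C * exp (- ((if x \<le> 0 then Re \<mu>' else Re \<mu>) * x))"
proof -
  let ?A = "norm ((w' - w) / (2 * w')) + norm ((w' + w) / (2 * w'))"
  let ?B = "norm ((w - w') / 2) + norm ((w + w') / 2)"
  define C where "C = ?A + ?B + 1 + norm w"
  have C: "?A \<le> C" "?B \<le> C" "1 \<le> C" "norm w \<le> C" unfolding C_def by auto
  have "norm (profile1 \<mu> w \<mu>' w' x) \<le> C * exp (- ((if x \<le> 0 then Re \<mu>' else Re \<mu>) * x))" for x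
  proof (cases "x \<le> 0")
    case True
    then have "norm (profile1 \<mu> w \<mu>' w' x) \<le> ?A * exp (- (Re \<mu>' * x))"
      using norm_exp_combination_le[OF assms(2) True] by (simp only: profile1_def True if_True)
    also have "\<dots> \<le> C * exp (- (Re \<mu>' * x))" by (intro mult_right_mono C) simp
    finally show ?thesis using True by simp
  next
    case False
    have "norm (profile1 \<mu> w \<mu>' w' x) = 1 * exp (- (Re \<mu> * x))" using False by (simp add: profile1_def)
    also have "\<dots> \<le> C * exp (- (Re \<mu> * x))" by (intro mult_right_mono C) simp
    finally show ?thesis using False by simp
  qed
  moreover have "norm (profile2 \<mu> w \<mu>' w' x) \<le> C * exp (- ((if x \<le> 0 then Re \<mu>' else Re \<mu>) * x))" for x
  proof (cases "x \<le> 0")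
    case True
    then have "norm (profile2 \<mu> w \<mu>' w' x) \<le> ?B * exp (- (Re \<mu>' * x))"
      using norm_exp_combination_le[OF assms(2) True] by (simp only: profile2_def True if_True)
    also have "\<dots> \<le> C * exp (- (Re \<mu>' * x))" by (intro mult_right_mono C) simp
    finally show ?thesis using True by simp
  next
    case False
    have "norm (profile2 \<mu> w \<mu>' w' x) = norm w * exp (- (Re \<mu> * x))" using False by (simp add: profile2_def norm_mult)
    also have "\<dots> \<le> C * exp (- (Re \<mu> * x))" by (intro mult_right_mono C) simp
    finally show ?thesis using False by simp
  qed
  moreover have "C \<ge> 0" using C by linarith
  ultimately show ?thesis by blast
qed

definition homogeneous :: "real \<Rightarrow> complex \<Rightarrow> (real \<Rightarrow> complex) \<Rightarrow> (real \<Rightarrow> complex) \<Rightarrow> bool" where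
  "homogeneous m z U1 U2 \<longleftrightarrow> ac_deriv U1 (\<lambda>x. coeff_up m z x * U2 x) \<and>
     ac_deriv U2 (\<lambda>x. coeff_down m z x * U1 x)"

lemma homogeneousI:
  assumes "continuous_on UNIV U1" "continuous_on UNIV U2"
    and "\<And>x. x \<noteq> 0 \<Longrightarrow> (U1 has_vector_derivative coeff_up m z x * U2 x) (at x)"
    and "\<And>x. x \<noteq> 0 \<Longrightarrow> (U2 has_vector_derivative coeff_down m z x * U1 x) (at x)"
  shows "homogeneous m z U1 U2"
  unfolding homogeneous_def
proof
  show "ac_deriv U1 (\<lambda>x. coeff_up m z x * U2 x)"
    by (rule ac_deriv_piecewise[OF assms(1), of "{0}"])
      (auto intro: assms locally_integrable_mult_bounded[OF locally_integrable_continuous]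
        coeff_bounded coeff_measurable)
  show "ac_deriv U2 (\<lambda>x. coeff_down m z x * U1 x)"
    by (rule ac_deriv_piecewise[OF assms(2), of "{0}"])
      (auto intro: assms locally_integrable_mult_bounded[OF locally_integrable_continuous]
        coeff_bounded coeff_measurable)
qed

text \<open>
  The product rule gives derivative zero, because the matrix of the system is zero on the diagonal.
\<close>

lemma wronskian_constant:
  assumes "homogeneous m z U1 U2" "homogeneous m z V1 V2"
  shows "U1 x * V2 x - V1 x * U2 x = U1 y * V2 y - V1 y * U2 y"
proof (rule ac_deriv_zero_imp_const[where g = "\<lambda>x. U1 x * V2 x - V1 x * U2 x"])
  have "ac_deriv (\<lambda>x. U1 x * V2 x - V1 x * U2 x)
    (\<lambda>x. (V2 x * (coeff_up m z x * U2 x) + U1 x * (coeff_down m z x * V1 x))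
       - (U2 x * (coeff_up m z x * V2 x) + V1 x * (coeff_down m z x * U1 x)))"
    using assms unfolding homogeneous_def by (intro ac_deriv_diff ac_deriv_mult) auto
  then show "ac_deriv (\<lambda>x. U1 x * V2 x - V1 x * U2 x) (\<lambda>x. 0)"
    by (simp add: algebra_simps)
qed

text \<open>
  The sign \<open>s\<close> selects the half line on which the constant is dominated; integrating over an interval of
  length \<open>n\<close> in it bounds \<open>n k\<close> uniformly.
\<close>

lemma constant_dominated_by_integrable_zero:
  fixes g :: "real \<Rightarrow> real"
  assumes g: "integrable lborel g" and "\<And>x. g x \<ge> 0" and s: "s = 1 \<or> s = -1"
    and bound: "\<And>x. s * x \<ge> 0 \<Longrightarrow> k \<le> g x"
  shows "k \<le> 0"
proof (rule ccontr)
  assume "\<not> k \<le> 0"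
  then have k: "k > 0" by simp
  have "real n * k \<le> (LINT x|lborel. g x)" for n
  proof -
    \<comment> \<open>The interval \<open>[0, n]\<close> or \<open>[-n, 0]\<close>, according to the sign \<open>s\<close>.\<close>
    let ?A = "{min 0 (s * real n)..max 0 (s * real n)}"
    have "real n * k = (LINT x|lborel. indicator ?A x * k)"
      using s by auto
    also have "\<dots> \<le> (LINT x|lborel. g x)"
    proof (rule integral_mono)
      show "indicator ?A x * k \<le> g x" for x
        using bound[of x] assms(2)[of x] s by (auto simp: indicator_def min_def max_def split: if_splits)
    qed (use g in auto)
    finally show ?thesis .
  qed
  moreover obtain n where "(LINT x|lborel. g x) / k < real n" using reals_Archimedean2 by blast
  then have "(LINT x|lborel. g x) < real n * k" using k by (simp add: field_simps)
  ultimately show False by (simp add: not_le[symmetric])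
qed

lemma mat2_mult_vector:
  "mat2 a b c d *v v = vector [a * v $ 1 + b * v $ 2, c * v $ 1 + d * v $ 2]"
  by (simp add: vec_eq_iff forall_2 matrix_vector_mult_def sum_2 mat2_def)

lemma smult_mat_mult_vector: "(c *\<^sub>M A) *v v = c *s (A *v v)"
  by (simp add: vec_eq_iff smult_mat_def matrix_vector_mult_def sum_distrib_left mult.assoc)

lemma bounded_linear_vector_scalar_mult: "bounded_linear (\<lambda>c. c *s (v :: complex^2))"
  by (rule bounded_linear_intro[where K = "norm v"])
    (simp_all add: vec_eq_iff distrib_right norm_vector_scalar_mult)

locale resolvent_point =
  fixes m :: real and z :: complex
  assumes m_nonneg: "m \<ge> 0" and z_regular: "z \<notin> sing_set m"
begin

lemma z_off_cuts:
  "\<not> (Im (z + \<i>) = 0 \<and> \<bar>Re (z + \<i>)\<bar> \<ge> m)" "\<not> (Im (z - \<i>) = 0 \<and> \<bar>Re (z - \<i>)\<bar> \<ge> m)"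
  using z_regular m_nonneg by (auto simp: sing_set_def split: if_splits)

lemma Re_\<mu>_pos: "Re (\<mu>m m z) > 0" "Re (\<mu>p m z) > 0"
proof -
  have "(of_real m + \<i> + z) * (of_real m - \<i> - z) = of_real (m\<^sup>2) - (z + \<i>)\<^sup>2"
    "(of_real m - \<i> + z) * (of_real m + \<i> - z) = of_real (m\<^sup>2) - (z - \<i>)\<^sup>2"
    by (simp_all add: algebra_simps power2_eq_square)
  then show "Re (\<mu>m m z) > 0" "Re (\<mu>p m z) > 0"
    using Re_csqrt_diff_squares_pos[OF m_nonneg] z_off_cuts by (simp_all only: \<mu>m_def \<mu>p_def)
qed

lemma \<mu>_nonzero: "\<mu>m m z \<noteq> 0" "\<mu>p m z \<noteq> 0"
  using Re_\<mu>_pos by auto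

lemma \<mu>_square:
  "\<mu>m m z * \<mu>m m z = (of_real m + \<i> + z) * (of_real m - \<i> - z)"
  "\<mu>p m z * \<mu>p m z = (of_real m - \<i> + z) * (of_real m + \<i> - z)"
  by (simp_all add: \<mu>m_def \<mu>p_def flip: power2_eq_square)

lemma w_nonzero: "wm m z \<noteq> 0" "wp m z \<noteq> 0"
  using \<mu>_square \<mu>_nonzero by (auto simp: wm_def wp_def)

lemma coeff_up_eq:
  "x < 0 \<Longrightarrow> coeff_up m z x = \<mu>m m z / wm m z" "x > 0 \<Longrightarrow> coeff_up m z x = \<mu>p m z / wp m z"
  using \<mu>_square w_nonzero \<mu>_nonzero
  by (auto simp: coeff_up_def wm_def wp_def field_simps)

lemma coeff_down_eq:
  "x < 0 \<Longrightarrow> coeff_down m z x = \<mu>m m z * wm m z" "x > 0 \<Longrightarrow> coeff_down m z x = \<mu>p m z * wp m z"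
  using \<mu>_nonzero by (auto simp: coeff_down_def wm_def wp_def field_simps)

text \<open>
  If \<open>wp = - wm\<close>, then comparing squares gives \<open>(m - \<i> - z) (m - \<i> + z) = (m + \<i> - z) (m + \<i> + z)\<close>, which
  forces \<open>m = 0\<close>. In that case \<open>\<bar>Im z\<bar> > 1\<close>, so the two principal roots are \<open>- \<i> (z \<plusminus> \<i>)\<close> or both are
  \<open>\<i> (z \<plusminus> \<i>)\<close>, and \<open>wp\<close> and \<open>wm\<close> are equal to the same number \<open>- \<i>\<close> or \<open>\<i>\<close>.
\<close>

lemma w_sum_nonzero: "wp m z + wm m z \<noteq> 0"
proof
  assume "wp m z + wm m z = 0"
  then have eq: "wp m z = - wm m z" by (simp add: eq_neg_iff_add_eq_0)
  let ?a = "of_real m :: complex"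
  have up: "(?a + \<i> + z) \<noteq> 0" "(?a - \<i> + z) \<noteq> 0"
    using \<mu>_square \<mu>_nonzero by auto
  have wm2: "wm m z * wm m z = (?a - \<i> - z) / (?a + \<i> + z)"
    unfolding wm_def times_divide_times_eq \<mu>_square using up \<mu>_square \<mu>_nonzero
    by (auto simp: divide_simps)
  have wp2: "wp m z * wp m z = (?a + \<i> - z) / (?a - \<i> + z)"
    unfolding wp_def times_divide_times_eq \<mu>_square using up \<mu>_square \<mu>_nonzero
    by (auto simp: divide_simps)
  have "wm m z * wm m z = wp m z * wp m z" using eq by simp
  then have "(?a - \<i> - z) * (?a - \<i> + z) = (?a + \<i> - z) * (?a + \<i> + z)"
    unfolding wm2 wp2 using up by (simp add: frac_eq_eq)
  then have "4 * \<i> * ?a = 0" by (simp add: algebra_simps)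
  then have m0: "m = 0" by simp
  then have z: "\<bar>Im z\<bar> > 1" using z_regular by (simp add: sing_set_def)
  consider "Im z > 1" | "Im z < -1" using z by linarith
  then show False
  proof cases
    case 1
    have "\<mu>m m z = csqrt ((- \<i> * (z + \<i>))\<^sup>2)" "\<mu>p m z = csqrt ((- \<i> * (z - \<i>))\<^sup>2)"
      by (simp_all add: \<mu>m_def \<mu>p_def m0 power2_eq_square algebra_simps)
    then have \<mu>: "\<mu>m m z = - \<i> * (z + \<i>)" "\<mu>p m z = - \<i> * (z - \<i>)"
      using 1 by (simp_all only:) (subst csqrt_square; simp)+
    have "wm m z = - \<i>" "wp m z = - \<i>"
      using \<mu>_nonzero unfolding wm_def wp_def \<mu> by (auto simp: m0 field_simps)
    then show False using eq by (simp add: complex_eq_iff)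
  next
    case 2
    have "\<mu>m m z = csqrt ((\<i> * (z + \<i>))\<^sup>2)" "\<mu>p m z = csqrt ((\<i> * (z - \<i>))\<^sup>2)"
      by (simp_all add: \<mu>m_def \<mu>p_def m0 power2_eq_square algebra_simps)
    then have \<mu>: "\<mu>m m z = \<i> * (z + \<i>)" "\<mu>p m z = \<i> * (z - \<i>)"
      using 2 by (simp_all only:) (subst csqrt_square; simp)+
    have "wm m z = \<i>" "wp m z = \<i>"
      using \<mu>_nonzero unfolding wm_def wp_def \<mu> by (auto simp: m0 field_simps)
    then show False using eq by (simp add: complex_eq_iff)
  qed
qed

text \<open>
  The components of the solution that decays at \<open>\<infinity>\<close>, normalised to the value \<open>(1, - wp)\<close> at the origin,
  and of the one that decays at \<open>-\<infinity>\<close>, with value \<open>(1, wm)\<close> there.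
\<close>

definition right1 :: "real \<Rightarrow> complex" where
  "right1 = profile1 (\<mu>p m z) (wp m z) (\<mu>m m z) (wm m z)"

definition right2 :: "real \<Rightarrow> complex" where
  "right2 x = - profile2 (\<mu>p m z) (wp m z) (\<mu>m m z) (wm m z) x"

definition left1 :: "real \<Rightarrow> complex" where
  "left1 x = profile1 (\<mu>m m z) (wm m z) (\<mu>p m z) (wp m z) (- x)"

definition left2 :: "real \<Rightarrow> complex" where
  "left2 x = profile2 (\<mu>m m z) (wm m z) (\<mu>p m z) (wp m z) (- x)"

lemma right_homogeneous: "homogeneous m z right1 right2"
proof (rule homogeneousI)
  show "continuous_on UNIV right1" "continuous_on UNIV right2"
    unfolding right1_def right2_def[abs_def]
    by (intro continuous_on_minus profile_continuous w_nonzero)+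
  fix x :: real assume x: "x \<noteq> 0"
  note D = profile_derivative[OF w_nonzero(2,1) x, of "\<mu>p m z" "\<mu>m m z"]
  show "(right1 has_vector_derivative coeff_up m z x * right2 x) (at x)"
    using D(1) x coeff_up_eq[of x] by (simp add: right1_def right2_def not_le split: if_splits)
  show "(right2 has_vector_derivative coeff_down m z x * right1 x) (at x)"
    using has_vector_derivative_minus[OF D(2)] x coeff_down_eq[of x]
    by (simp add: right1_def right2_def[abs_def] not_le split: if_splits)
qed

lemma left_homogeneous: "homogeneous m z left1 left2"
proof (rule homogeneousI)
  show "continuous_on UNIV left1" "continuous_on UNIV left2"
    unfolding left1_def[abs_def] left2_def[abs_def]
    by (rule continuous_on_compose2[OF profile_continuous(1)[OF w_nonzero(2)]]
        continuous_on_compose2[OF profile_continuous(2)[OF w_nonzero(2)]];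
      auto intro!: continuous_intros)+
  fix x :: real assume x: "x \<noteq> 0"
  have u: "(uminus has_vector_derivative -1) (at x)"
    by (auto intro!: derivative_eq_intros simp flip: has_real_derivative_iff_has_vector_derivative)
  have "- x \<noteq> 0" using x by simp
  note D = profile_derivative[OF w_nonzero this, of "\<mu>m m z" "\<mu>p m z"]
  show "(left1 has_vector_derivative coeff_up m z x * left2 x) (at x)"
    using vector_diff_chain_at[OF u D(1)] x coeff_up_eq[of x]
    by (simp add: left1_def[abs_def] left2_def o_def not_le split: if_splits)
  show "(left2 has_vector_derivative coeff_down m z x * left1 x) (at x)"
    using vector_diff_chain_at[OF u D(2)] x coeff_down_eq[of x]
    by (simp add: left1_def left2_def[abs_def] o_def not_le split: if_splits)
qed

lemma wronskian_eq: "right1 x * left2 x - left1 x * right2 x = wp m z + wm m z"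
  using wronskian_constant[OF right_homogeneous left_homogeneous, of x 0] w_nonzero
  by (simp add: right1_def right2_def left1_def left2_def profile1_def profile2_def field_simps)

text \<open>
  The logarithmic size of the two solutions: \<open>left\<close> is bounded by a multiple of \<open>exp (rate x)\<close> and \<open>right\<close>
  by one of \<open>exp (- rate x)\<close>, also on the half line where they grow. As the slope of \<open>rate\<close> is at least
  \<open>gap\<close>, the products \<open>right(x) left(y)\<close> for \<open>y \<le> x\<close> decay exponentially in \<open>x - y\<close>.
\<close>

definition rate :: "real \<Rightarrow> real" where
  "rate x = (if x \<le> 0 then Re (\<mu>m m z) else Re (\<mu>p m z)) * x"

definition gap :: real where
  "gap = min (Re (\<mu>m m z)) (Re (\<mu>p m z))"

lemma gap_pos: "gap > 0"
  using Re_\<mu>_pos by (simp add: gap_def)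

lemma rate_increase:
  assumes "y \<le> x"
  shows "gap * (x - y) \<le> rate x - rate y"
proof -
  have "gap \<le> Re (\<mu>m m z)" "gap \<le> Re (\<mu>p m z)" by (auto simp: gap_def)
  note g = mult_right_mono[OF this(1)] mult_right_mono[OF this(2)]
  consider "x \<le> 0" | "y \<le> 0" "0 < x" | "0 < y" using assms by linarith
  then show ?thesis
  proof cases
    case 1
    then have "rate x = Re (\<mu>m m z) * x" "rate y = Re (\<mu>m m z) * y"
      using assms by (simp_all add: rate_def)
    then show ?thesis using g(1)[of "x - y"] assms by (simp add: right_diff_distrib)
  next
    case 2
    have r: "rate x = Re (\<mu>p m z) * x" "rate y = Re (\<mu>m m z) * y"
      using 2 by (simp_all add: rate_def)
    have "gap * x \<le> Re (\<mu>p m z) * x" "gap * (- y) \<le> Re (\<mu>m m z) * (- y)"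
      by (intro g; use 2 in simp)+
    then show ?thesis unfolding r right_diff_distrib by linarith
  next
    case 3
    then have "rate x = Re (\<mu>p m z) * x" "rate y = Re (\<mu>p m z) * y"
      using assms by (simp_all add: rate_def)
    then show ?thesis using g(2)[of "x - y"] assms by (simp add: right_diff_distrib)
  qed
qed

lemma jost_bounds:
  obtains C where "C \<ge> 0"
    "\<And>x. norm (right1 x) \<le> C * exp (- rate x)" "\<And>x. norm (right2 x) \<le> C * exp (- rate x)"
    "\<And>x. norm (left1 x) \<le> C * exp (rate x)" "\<And>x. norm (left2 x) \<le> C * exp (rate x)"
proof -
  obtain A where "A \<ge> 0" and A: "\<And>x. norm (right1 x) \<le> A * exp (- rate x)"
      "\<And>x. norm (right2 x) \<le> A * exp (- rate x)"
    using profile_bound[OF Re_\<mu>_pos(2,1), of "wp m z" "wm m z"]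
    unfolding right1_def right2_def rate_def by auto
  obtain B where "B \<ge> 0"
    and B: "\<And>x. norm (profile1 (\<mu>m m z) (wm m z) (\<mu>p m z) (wp m z) x)
          \<le> B * exp (- ((if x \<le> 0 then Re (\<mu>p m z) else Re (\<mu>m m z)) * x))"
      "\<And>x. norm (profile2 (\<mu>m m z) (wm m z) (\<mu>p m z) (wp m z) x)
          \<le> B * exp (- ((if x \<le> 0 then Re (\<mu>p m z) else Re (\<mu>m m z)) * x))"
    using profile_bound[OF Re_\<mu>_pos(1,2), of "wm m z" "wp m z"] by auto
  have r: "- ((if - x \<le> 0 then Re (\<mu>p m z) else Re (\<mu>m m z)) * - x) = rate x" for x
    by (auto simp: rate_def)
  have le: "A * exp t \<le> max A B * exp t" "B * exp t \<le> max A B * exp t" for t :: real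
    by simp_all
  have B': "norm (left1 x) \<le> B * exp (rate x)" "norm (left2 x) \<le> B * exp (rate x)" for x
    using B(1)[of "- x"] B(2)[of "- x"] unfolding r left1_def left2_def by auto
  then show ?thesis
    using \<open>A \<ge> 0\<close> A[THEN order_trans, OF le(1)] B'[THEN order_trans, OF le(2)]
    by (intro that[of "max A B"]) auto
qed

section \<open>The kernel as a product of the two solutions\<close>

text \<open>
  In each of the three regions \<open>y < x < 0\<close>, \<open>y < 0 < x\<close> and \<open>0 < y < x\<close> the kernel is
  \<open>- right(x) left(y)\<^sup>T / (wp + wm)\<close>. Solving \<open>wp + wm = s\<close> for one of the two numbers leaves only monomial
  denominators, so that clearing them succeeds.
\<close>

lemma resolvent_kernel_below:
  assumes "y < x" "x \<noteq> 0" "y \<noteq> 0"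
  shows "resolvent_kernel m z x y *v v =
    (- (left1 y * v $ 1 + left2 y * v $ 2) / (wp m z + wm m z)) *s vector [right1 x, right2 x]"
proof -
  note nz = w_nonzero w_sum_nonzero
  define s where "s = wp m z + wm m z"
  have s: "s \<noteq> 0" and wp: "wp m z = s - wm m z" and wm: "wm m z = s - wp m z"
    using w_sum_nonzero by (simp_all add: s_def)
  consider "x < 0" | "y < 0" "0 < x" | "0 < y" using assms by linarith
  then show ?thesis
  proof cases
    case 1
    then show ?thesis using assms nz
      by (simp add: resolvent_kernel_def N1_def N2_def matrix_vector_mult_add_rdistrib
        smult_mat_mult_vector mat2_mult_vector vec_eq_iff forall_2 right1_def right2_def left1_def
        left2_def profile1_def profile2_def kz_def distrib_left right_diff_distrib exp_add exp_diff exp_minus)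
       (use s in \<open>simp add: wp field_simps\<close>)
  next
    case 2
    then show ?thesis using assms nz
      by (simp add: resolvent_kernel_def N3_def
        smult_mat_mult_vector mat2_mult_vector vec_eq_iff forall_2 right1_def right2_def left1_def
        left2_def profile1_def profile2_def kz_def distrib_left right_diff_distrib exp_add exp_diff exp_minus)
       (use s in \<open>simp add: wp field_simps\<close>)
  next
    case 3
    then show ?thesis using assms nz
      by (simp add: resolvent_kernel_def N4_def N5_def matrix_vector_mult_add_rdistrib
        smult_mat_mult_vector mat2_mult_vector vec_eq_iff forall_2 right1_def right2_def left1_def
        left2_def profile1_def profile2_def kz_def distrib_left right_diff_distrib exp_add exp_diff exp_minus)
       (use s in \<open>simp add: wm field_simps\<close>)
  qed
qed

lemma resolvent_kernel_above:
  assumes "x < y" "x \<noteq> 0" "y \<noteq> 0"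
  shows "resolvent_kernel m z x y *v v =
    (- (right1 y * v $ 1 + right2 y * v $ 2) / (wp m z + wm m z)) *s vector [left1 x, left2 x]"
proof -
  note nz = w_nonzero w_sum_nonzero
  define s where "s = wp m z + wm m z"
  have s: "s \<noteq> 0" and wp: "wp m z = s - wm m z" and wm: "wm m z = s - wp m z"
    using w_sum_nonzero by (simp_all add: s_def)
  consider "y < 0" | "x < 0" "0 < y" | "0 < x" using assms by linarith
  then show ?thesis
  proof cases
    case 1
    then show ?thesis using assms nz
      by (simp add: resolvent_kernel_def N9_def N1_def matrix_vector_mult_add_rdistrib
        smult_mat_mult_vector mat2_mult_vector vec_eq_iff forall_2 right1_def right2_def left1_def
        left2_def profile1_def profile2_def kz_def distrib_left right_diff_distrib exp_add exp_diff exp_minus)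
       (use s in \<open>simp add: wp field_simps\<close>)
  next
    case 2
    then show ?thesis using assms nz
      by (simp add: resolvent_kernel_def N8_def
        smult_mat_mult_vector mat2_mult_vector vec_eq_iff forall_2 right1_def right2_def left1_def
        left2_def profile1_def profile2_def kz_def distrib_left right_diff_distrib exp_add exp_diff exp_minus)
       (use s in \<open>simp add: wp field_simps\<close>)
  next
    case 3
    then show ?thesis using assms nz
      by (simp add: resolvent_kernel_def N4_def N6_def matrix_vector_mult_add_rdistrib
        smult_mat_mult_vector mat2_mult_vector vec_eq_iff forall_2 right1_def right2_def left1_def
        left2_def profile1_def profile2_def kz_def distrib_left right_diff_distrib exp_add exp_diff exp_minus)
       (use s in \<open>simp add: wm field_simps\<close>)
  qed
qed

section \<open>Uniqueness\<close>

text \<open>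
  The Wronskians with the two decaying solutions are constants whose square is dominated, each on one half
  line, by a multiple of the integrable function \<open>\<bar>U1\<bar>\<^sup>2 + \<bar>U2\<bar>\<^sup>2\<close>. So both vanish, and the solution
  is proportional to two independent ones.
\<close>

lemma homogeneous_square_integrable_zero:
  assumes U: "homogeneous m z U1 U2" and sq: "square_integrable u"
    and rep: "AE x in lborel. u x = vector [U1 x, U2 x]"
  shows "U1 x = 0 \<and> U2 x = 0"
proof -
  obtain C where C: "C \<ge> 0"
    "\<And>x. norm (right1 x) \<le> C * exp (- rate x)" "\<And>x. norm (right2 x) \<le> C * exp (- rate x)"
    "\<And>x. norm (left1 x) \<le> C * exp (rate x)" "\<And>x. norm (left2 x) \<le> C * exp (rate x)"
    using jost_bounds by blast
  define G where "G x = 2 * C * (norm (U1 x) + norm (U2 x))" for x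
  have [measurable]: "U1 \<in> borel_measurable borel" "U2 \<in> borel_measurable borel"
    using U ac_deriv_measurable by (auto simp: homogeneous_def)
  have "square_integrable (\<lambda>x. vector [U1 x, U2 x])"
  proof (rule square_integrable_bound[OF sq sq, where C = 1])
    show "(\<lambda>x. vector [U1 x, U2 x] :: complex^2) \<in> borel_measurable borel"
      by (intro vector_2_measurable) measurable
    show "AE x in lborel. norm (vector [U1 x, U2 x] :: complex^2) \<le> 1 * (norm (u x) + norm (u x))"
      using rep by eventually_elim simp
  qed
  then have "integrable lborel (\<lambda>x. (norm (vector [U1 x, U2 x] :: complex^2))\<^sup>2)"
    by (simp add: square_integrable_def)
  then have int: "integrable lborel (\<lambda>x. 2 * C\<^sup>2 * ((norm (U1 x))\<^sup>2 + (norm (U2 x))\<^sup>2))"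
    by (simp add: norm_vec_def L2_set_def sum_2)
  have zero: "c = 0" if s: "s = 1 \<or> s = -1"
    and const: "\<And>x. U1 x * V2 x - V1 x * U2 x = c"
    and b: "\<And>x. s * x \<ge> 0 \<Longrightarrow> norm (V1 x) \<le> C \<and> norm (V2 x) \<le> C" for s c V1 V2
  proof -
    have "(norm c)\<^sup>2 \<le> 0"
    proof (rule constant_dominated_by_integrable_zero[OF int _ s])
      fix x assume x: "s * x \<ge> 0"
      have "norm c \<le> norm (U1 x) * norm (V2 x) + norm (V1 x) * norm (U2 x)"
        using norm_triangle_ineq4[of "U1 x * V2 x" "V1 x * U2 x"] by (simp add: const norm_mult)
      also have "\<dots> \<le> norm (U1 x) * C + C * norm (U2 x)"
        using b[OF x] by (intro add_mono mult_mono) (auto intro: C)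
      also have "\<dots> = C * (norm (U1 x) + norm (U2 x))" by (simp add: algebra_simps)
      finally have "(norm c)\<^sup>2 \<le> (C * (norm (U1 x) + norm (U2 x)))\<^sup>2" by (rule power_mono) simp
      also have "\<dots> = C\<^sup>2 * (norm (U1 x) + norm (U2 x))\<^sup>2" by (simp add: power_mult_distrib)
      also have "\<dots> \<le> C\<^sup>2 * (2 * ((norm (U1 x))\<^sup>2 + (norm (U2 x))\<^sup>2))"
        using zero_le_power2[of "norm (U1 x) - norm (U2 x)"]
        by (intro mult_left_mono) (simp_all add: power2_sum power2_diff)
      finally show "(norm c)\<^sup>2 \<le> 2 * C\<^sup>2 * ((norm (U1 x))\<^sup>2 + (norm (U2 x))\<^sup>2)"
        by (simp add: algebra_simps)
    qed auto
    then show ?thesis by simp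
  qed
  have sign: "s * x \<ge> 0 \<Longrightarrow> s * rate x \<ge> 0" if "s = 1 \<or> s = -1" for s x
    using that Re_\<mu>_pos by (auto simp: rate_def mult_le_0_iff zero_le_mult_iff)
  have e: "C * exp t \<le> C" if "t \<le> 0" for t using C(1) that by (simp add: mult_left_le)
  have "U1 x * left2 x - left1 x * U2 x = 0"
  proof (rule zero[of "-1"])
    show "U1 t * left2 t - left1 t * U2 t = U1 x * left2 x - left1 x * U2 x" for t
      by (rule wronskian_constant[OF U left_homogeneous])
    show "norm (left1 t) \<le> C \<and> norm (left2 t) \<le> C" if "- 1 * t \<ge> 0" for t
      using sign[of "-1" t] that C(4,5)[of t] e[of "rate t"] by auto
  qed simp
  moreover have "U1 x * right2 x - right1 x * U2 x = 0"
  proof (rule zero[of 1])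
    show "U1 t * right2 t - right1 t * U2 t = U1 x * right2 x - right1 x * U2 x" for t
      by (rule wronskian_constant[OF U right_homogeneous])
    show "norm (right1 t) \<le> C \<and> norm (right2 t) \<le> C" if "1 * t \<ge> 0" for t
      using sign[of 1 t] that C(2,3)[of t] e[of "- rate t"] by auto
  qed simp
  ultimately have 1: "U1 x * left2 x = left1 x * U2 x" and 2: "U1 x * right2 x = right1 x * U2 x"
    by simp_all
  have "U1 x * (right1 x * left2 x - left1 x * right2 x)
      = right1 x * (U1 x * left2 x) - left1 x * (U1 x * right2 x)" by (simp add: algebra_simps)
  also have "\<dots> = 0" unfolding 1 2 by simp
  finally have "U1 x = 0" using w_sum_nonzero by (simp add: wronskian_eq)
  have "U2 x * (right1 x * left2 x - left1 x * right2 x)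
      = (right1 x * U2 x) * left2 x - (left1 x * U2 x) * right2 x" by (simp add: algebra_simps)
  also have "\<dots> = 0" unfolding 1[symmetric] 2[symmetric] by simp
  finally have "U2 x = 0" using w_sum_nonzero by (simp add: wronskian_eq)
  with \<open>U1 x = 0\<close> show ?thesis by simp
qed

lemma dirac_injective:
  "inj_on (\<lambda>u. dirac_op m u - z *\<^sub>C u) H1"
proof (rule inj_onI)
  fix u v assume uv: "u \<in> H1" "v \<in> H1" "dirac_op m u - z *\<^sub>C u = dirac_op m v - z *\<^sub>C v"
  define f where "f = dirac_op m u - z *\<^sub>C u"
  obtain U1 U2 where U: "ac_deriv U1 (\<lambda>x. coeff_up m z x * U2 x + rep_l2 f x $ 2)"
      "ac_deriv U2 (\<lambda>x. coeff_down m z x * U1 x - rep_l2 f x $ 1)"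
      "AE x in lborel. rep_l2 u x = vector [U1 x, U2 x]"
    using dirac_equation_iff_ac[of u m z f] uv(1) by (auto simp: f_def)
  obtain V1 V2 where V: "ac_deriv V1 (\<lambda>x. coeff_up m z x * V2 x + rep_l2 f x $ 2)"
      "ac_deriv V2 (\<lambda>x. coeff_down m z x * V1 x - rep_l2 f x $ 1)"
      "AE x in lborel. rep_l2 v x = vector [V1 x, V2 x]"
    using dirac_equation_iff_ac[of v m z f] uv(2,3) by (auto simp: f_def)
  have "homogeneous m z (\<lambda>x. U1 x - V1 x) (\<lambda>x. U2 x - V2 x)"
    unfolding homogeneous_def
    using ac_deriv_diff[OF U(1) V(1)] ac_deriv_diff[OF U(2) V(2)] by (simp add: right_diff_distrib)
  moreover have "AE x in lborel. rep_l2 (u - v) x = vector [U1 x - V1 x, U2 x - V2 x]"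
    using rep_l2_diff_AE[of u v] U(3) V(3) by eventually_elim (simp add: vec_eq_iff forall_2)
  ultimately have "U1 x - V1 x = 0 \<and> U2 x - V2 x = 0" for x
    using homogeneous_square_integrable_zero[OF _ square_integrable_rep_l2] by blast
  then have eq: "U1 = V1" "U2 = V2" by auto
  have "AE x in lborel. rep_l2 u x = rep_l2 v x"
    using U(3) V(3) by eventually_elim (simp add: eq)
  then show "u = v" by (rule l2_eqI)
qed

section \<open>Variation of constants\<close>

definition left_pairing :: "(real \<Rightarrow> complex^2) \<Rightarrow> real \<Rightarrow> complex" where
  "left_pairing \<phi> y = left1 y * \<phi> y $ 1 + left2 y * \<phi> y $ 2"

definition right_pairing :: "(real \<Rightarrow> complex^2) \<Rightarrow> real \<Rightarrow> complex" where
  "right_pairing \<phi> y = right1 y * \<phi> y $ 1 + right2 y * \<phi> y $ 2"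

text \<open>
  Variation of constants. The two half line integrals have derivatives \<open>left\<cdot>f\<close> and \<open>- right\<cdot>f\<close>, and the
  integrals converge because the solutions decay in the respective direction.
\<close>

definition solution1 :: "(real \<Rightarrow> complex^2) \<Rightarrow> real \<Rightarrow> complex" where
  "solution1 \<phi> x = 1 / (wp m z + wm m z) *
    (right1 x * (LINT y:{..x}|lborel. left_pairing \<phi> y) + left1 x * (LINT y:{x..}|lborel. right_pairing \<phi> y))"

definition solution2 :: "(real \<Rightarrow> complex^2) \<Rightarrow> real \<Rightarrow> complex" where
  "solution2 \<phi> x = 1 / (wp m z + wm m z) *
    (right2 x * (LINT y:{..x}|lborel. left_pairing \<phi> y) + left2 x * (LINT y:{x..}|lborel. right_pairing \<phi> y))"

lemma jost_continuous:
  "continuous_on UNIV right1" "continuous_on UNIV right2"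
  "continuous_on UNIV left1" "continuous_on UNIV left2"
  using right_homogeneous left_homogeneous ac_deriv_continuous unfolding homogeneous_def by blast+

lemma pairing_locally_integrable:
  assumes "square_integrable \<phi>"
  shows "locally_integrable (left_pairing \<phi>)" "locally_integrable (right_pairing \<phi>)"
  unfolding left_pairing_def[abs_def] right_pairing_def[abs_def]
  by (intro locally_integrable_add locally_integrable_mult_continuous jost_continuous
      locally_integrable_component square_integrable_locally_integrable assms)+

lemma pairing_bound:
  obtains C where "C \<ge> 0"
    "\<And>\<phi> x y. y \<le> x \<Longrightarrow> norm (left_pairing \<phi> y) \<le> C * exp (rate x) * (exp (- gap * \<bar>x - y\<bar>) * norm (\<phi> y))"
    "\<And>\<phi> x y. x \<le> y \<Longrightarrow> norm (right_pairing \<phi> y) \<le> C * exp (- rate x) * (exp (- gap * \<bar>x - y\<bar>) * norm (\<phi> y))"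
    "\<And>x. norm (right1 x) \<le> C * exp (- rate x)" "\<And>x. norm (right2 x) \<le> C * exp (- rate x)"
    "\<And>x. norm (left1 x) \<le> C * exp (rate x)" "\<And>x. norm (left2 x) \<le> C * exp (rate x)"
proof -
  obtain C where C: "C \<ge> 0"
    "\<And>x. norm (right1 x) \<le> C * exp (- rate x)" "\<And>x. norm (right2 x) \<le> C * exp (- rate x)"
    "\<And>x. norm (left1 x) \<le> C * exp (rate x)" "\<And>x. norm (left2 x) \<le> C * exp (rate x)"
    using jost_bounds by blast
  have pair: "norm (a * v $ 1 + b * v $ 2) \<le> (2 * C) * (exp t * norm v)"
    if "norm a \<le> C * exp t" "norm b \<le> C * exp t" for a b t and v :: "complex^2"
  proof -
    have "norm (a * v $ 1 + b * v $ 2) \<le> norm a * norm (v $ 1) + norm b * norm (v $ 2)"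
      by (rule order_trans[OF norm_triangle_ineq]) (simp add: norm_mult)
    also have "\<dots> \<le> (C * exp t) * norm v + (C * exp t) * norm v"
      using that C(1) by (intro add_mono mult_mono Finite_Cartesian_Product.norm_nth_le) auto
    finally show ?thesis by (simp add: algebra_simps)
  qed
  have *: "(2 * C) * (exp t * n) \<le> 2 * C * exp s * (exp r * n)" if "t \<le> s + r" "n \<ge> 0" for t s r n :: real
  proof -
    have "exp t \<le> exp s * exp r" using that by (simp add: exp_add[symmetric])
    then have "(2 * C) * (exp t * n) \<le> (2 * C) * ((exp s * exp r) * n)"
      using C(1) that by (intro mult_left_mono mult_right_mono) auto
    then show ?thesis by (simp add: mult_ac)
  qed
  show ?thesis
  proof (rule that[of "2 * C"])
    fix \<phi> x y
    show "norm (left_pairing \<phi> y) \<le> 2 * C * exp (rate x) * (exp (- gap * \<bar>x - y\<bar>) * norm (\<phi> y))" if "y \<le> x"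
      unfolding left_pairing_def
      by (rule order_trans[OF pair *], rule C, rule C) (use rate_increase[OF that] that in auto)
    show "norm (right_pairing \<phi> y) \<le> 2 * C * exp (- rate x) * (exp (- gap * \<bar>x - y\<bar>) * norm (\<phi> y))" if "x \<le> y"
      unfolding right_pairing_def
      by (rule order_trans[OF pair *], rule C, rule C)
        (use rate_increase[OF that] that in \<open>auto simp: abs_if algebra_simps\<close>)
    have d: "C * exp t \<le> 2 * C * exp t" for t using C(1) by simp
    show "norm (right1 x) \<le> 2 * C * exp (- rate x)" "norm (right2 x) \<le> 2 * C * exp (- rate x)"
      "norm (left1 x) \<le> 2 * C * exp (rate x)" "norm (left2 x) \<le> 2 * C * exp (rate x)" for x
      by (rule order_trans[OF C(2) d] order_trans[OF C(3) d] order_trans[OF C(4) d] order_trans[OF C(5) d])+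
  qed (use C(1) in simp)
qed

text \<open>
  Applied to the two pairings on \<open>{..x}\<close> and \<open>{x..}\<close>, where \<open>exp (rate x)\<close> and \<open>exp (- rate x)\<close> can be
  factored out at the cost of the exponential kernel.
\<close>

lemma half_line_integral_bound:
  fixes h :: "real \<Rightarrow> complex"
  assumes \<phi>: "square_integrable \<phi>" and h: "h \<in> borel_measurable borel" and A: "A \<in> sets borel"
    and B: "B \<ge> 0" and bound: "\<And>y. y \<in> A \<Longrightarrow> norm (h y) \<le> B * (exp (- gap * \<bar>x - y\<bar>) * norm (\<phi> y))"
  shows "set_integrable lborel A h"
    and "norm (LINT y:A|lborel. h y) \<le> B * (LINT y|lborel. exp (- gap * \<bar>x - y\<bar>) * norm (\<phi> y))"
proof -
  note [measurable] = h A
  have int: "integrable lborel (\<lambda>y. B * (exp (- gap * \<bar>x - y\<bar>) * norm (\<phi> y)))"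
    by (intro integrable_mult_right integrable_exp_mult_square_integrable gap_pos \<phi>)
  have le: "norm (indicator A y *\<^sub>R h y) \<le> B * (exp (- gap * \<bar>x - y\<bar>) * norm (\<phi> y))" for y
    using bound[of y] B by (cases "y \<in> A") auto
  have "integrable lborel (\<lambda>y. indicator A y *\<^sub>R h y)"
    by (rule Bochner_Integration.integrable_bound[OF int], measurable)
      (intro AE_I2 order_trans[OF le], simp)
  then show "set_integrable lborel A h" by (simp add: set_integrable_def)
  have "norm (LINT y:A|lborel. h y) \<le> (LINT y|lborel. B * (exp (- gap * \<bar>x - y\<bar>) * norm (\<phi> y)))"
    unfolding set_lebesgue_integral_def by (rule Bochner_Integration.integral_norm_bound_integral[OF _ int le]) fact
  then show "norm (LINT y:A|lborel. h y) \<le> B * (LINT y|lborel. exp (- gap * \<bar>x - y\<bar>) * norm (\<phi> y))"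
    by simp
qed

lemma pairing_integrable:
  assumes \<phi>: "square_integrable \<phi>"
  shows "set_integrable lborel {..x} (left_pairing \<phi>)" "set_integrable lborel {x..} (right_pairing \<phi>)"
proof -
  note m = pairing_locally_integrable[OF \<phi>, THEN locally_integrable_measurable]
  obtain C where C: "C \<ge> 0"
    "\<And>y. y \<le> x \<Longrightarrow> norm (left_pairing \<phi> y) \<le> C * exp (rate x) * (exp (- gap * \<bar>x - y\<bar>) * norm (\<phi> y))"
    "\<And>y. x \<le> y \<Longrightarrow> norm (right_pairing \<phi> y) \<le> C * exp (- rate x) * (exp (- gap * \<bar>x - y\<bar>) * norm (\<phi> y))"
    by (rule pairing_bound) blast
  show "set_integrable lborel {..x} (left_pairing \<phi>)"
    by (rule half_line_integral_bound(1)[OF \<phi> m(1), of _ "C * exp (rate x)" x]) (use C in auto)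
  show "set_integrable lborel {x..} (right_pairing \<phi>)"
    by (rule half_line_integral_bound(1)[OF \<phi> m(2), of _ "C * exp (- rate x)" x]) (use C in auto)
qed

lemma solution_bound:
  obtains D where "D \<ge> 0"
    "\<And>\<phi> x. square_integrable \<phi> \<Longrightarrow> norm (vector [solution1 \<phi> x, solution2 \<phi> x] :: complex^2)
      \<le> D * (LINT y|lborel. exp (- gap * \<bar>x - y\<bar>) * norm (\<phi> y))"
proof -
  obtain C where C: "C \<ge> 0"
    "\<And>\<phi> x y. y \<le> x \<Longrightarrow> norm (left_pairing \<phi> y) \<le> C * exp (rate x) * (exp (- gap * \<bar>x - y\<bar>) * norm (\<phi> y))"
    "\<And>\<phi> x y. x \<le> y \<Longrightarrow> norm (right_pairing \<phi> y) \<le> C * exp (- rate x) * (exp (- gap * \<bar>x - y\<bar>) * norm (\<phi> y))"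
    and R: "\<And>x. norm (right1 x) \<le> C * exp (- rate x)" "\<And>x. norm (right2 x) \<le> C * exp (- rate x)"
    and L: "\<And>x. norm (left1 x) \<le> C * exp (rate x)" "\<And>x. norm (left2 x) \<le> C * exp (rate x)"
    by (rule pairing_bound) blast
  let ?s = "norm (1 / (wp m z + wm m z))"
  define D where "D = 4 * (?s * C\<^sup>2)"
  show ?thesis
  proof (rule that[of D])
    show "D \<ge> 0" by (simp add: D_def)
    fix \<phi> x assume \<phi>: "square_integrable \<phi>"
    note m = pairing_locally_integrable[OF \<phi>, THEN locally_integrable_measurable]
    let ?J = "LINT y|lborel. exp (- gap * \<bar>x - y\<bar>) * norm (\<phi> y)"
    have J: "?J \<ge> 0" by (intro Bochner_Integration.integral_nonneg) simp
    have 1: "norm (LINT y:{..x}|lborel. left_pairing \<phi> y) \<le> C * exp (rate x) * ?J"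
      by (rule half_line_integral_bound(2)[OF \<phi> m(1)]) (use C in auto)
    have 2: "norm (LINT y:{x..}|lborel. right_pairing \<phi> y) \<le> C * exp (- rate x) * ?J"
      by (rule half_line_integral_bound(2)[OF \<phi> m(2)]) (use C in auto)
    have c: "norm (1 / (wp m z + wm m z) * (r * (LINT y:{..x}|lborel. left_pairing \<phi> y)
        + l * (LINT y:{x..}|lborel. right_pairing \<phi> y))) \<le> 2 * (?s * C\<^sup>2) * ?J"
      if "norm r \<le> C * exp (- rate x)" "norm l \<le> C * exp (rate x)" for r l
    proof -
      have "norm (r * (LINT y:{..x}|lborel. left_pairing \<phi> y) + l * (LINT y:{x..}|lborel. right_pairing \<phi> y))
          \<le> norm r * norm (LINT y:{..x}|lborel. left_pairing \<phi> y)
            + norm l * norm (LINT y:{x..}|lborel. right_pairing \<phi> y)"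
        by (rule order_trans[OF norm_triangle_ineq]) (simp add: norm_mult)
      also have "\<dots> \<le> (C * exp (- rate x)) * (C * exp (rate x) * ?J) + (C * exp (rate x)) * (C * exp (- rate x) * ?J)"
        using that 1 2 C(1) J by (intro add_mono mult_mono) auto
      also have "\<dots> = 2 * C\<^sup>2 * (exp (- rate x) * exp (rate x)) * ?J"
        by (simp add: power2_eq_square algebra_simps)
      also have "exp (- rate x) * exp (rate x) = 1" by (simp add: exp_minus)
      finally have "norm (r * (LINT y:{..x}|lborel. left_pairing \<phi> y) + l * (LINT y:{x..}|lborel. right_pairing \<phi> y))
          \<le> 2 * C\<^sup>2 * 1 * ?J" .
      from mult_left_mono[OF this, of ?s] show ?thesis
        by (simp only: norm_mult norm_ge_zero mult_ac mult_1)
    qed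
    have "norm (vector [solution1 \<phi> x, solution2 \<phi> x] :: complex^2) \<le> norm (solution1 \<phi> x) + norm (solution2 \<phi> x)"
      using norm_vector_2_le[of "vector [solution1 \<phi> x, solution2 \<phi> x]"] by simp
    also have "\<dots> \<le> 2 * (?s * C\<^sup>2) * ?J + 2 * (?s * C\<^sup>2) * ?J"
      unfolding solution1_def solution2_def by (intro add_mono c R L)
    finally show "norm (vector [solution1 \<phi> x, solution2 \<phi> x] :: complex^2) \<le> D * ?J"
      by (simp add: D_def algebra_simps)
  qed
qed

text \<open>
  Differentiating the two solutions reproduces the homogeneous system; differentiating the integrals
  leaves \<open>right (left\<cdot>f) - left (right\<cdot>f)\<close>, which by the value of the Wronskian is
  \<open>(wp + wm) (f\<^sub>2, - f\<^sub>1)\<close>.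
\<close>

lemma solution_ac:
  assumes \<phi>: "square_integrable \<phi>"
  shows "ac_deriv (solution1 \<phi>) (\<lambda>x. coeff_up m z x * solution2 \<phi> x + \<phi> x $ 2)"
    and "ac_deriv (solution2 \<phi>) (\<lambda>x. coeff_down m z x * solution1 \<phi> x - \<phi> x $ 1)"
proof -
  let ?F = "\<lambda>x. LINT y:{..x}|lborel. left_pairing \<phi> y" and ?G = "\<lambda>x. LINT y:{x..}|lborel. right_pairing \<phi> y"
  let ?s = "wp m z + wm m z"
  have F: "ac_deriv ?F (left_pairing \<phi>)"
    by (intro ac_deriv_integral_atMost pairing_integrable pairing_locally_integrable \<phi>)
  have G: "ac_deriv ?G (\<lambda>x. - right_pairing \<phi> x)"
    by (intro ac_deriv_integral_atLeast pairing_integrable pairing_locally_integrable \<phi>)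
  \<comment> \<open>The jump of the kernel across the diagonal, which is where \<open>f\<close> enters.\<close>
  have jump: "1 / ?s * (right1 x * left_pairing \<phi> x - left1 x * right_pairing \<phi> x) = \<phi> x $ 2"
    "1 / ?s * (right2 x * left_pairing \<phi> x - left2 x * right_pairing \<phi> x) = - \<phi> x $ 1" for x
  proof -
    have "right1 x * left_pairing \<phi> x - left1 x * right_pairing \<phi> x
        = (right1 x * left2 x - left1 x * right2 x) * \<phi> x $ 2"
      by (simp add: left_pairing_def right_pairing_def algebra_simps)
    then show "1 / ?s * (right1 x * left_pairing \<phi> x - left1 x * right_pairing \<phi> x) = \<phi> x $ 2"
      using w_sum_nonzero by (simp add: wronskian_eq)
    have "right2 x * left_pairing \<phi> x - left2 x * right_pairing \<phi> x
        = - ((right1 x * left2 x - left1 x * right2 x) * \<phi> x $ 1)"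
      by (simp add: left_pairing_def right_pairing_def algebra_simps)
    then show "1 / ?s * (right2 x * left_pairing \<phi> x - left2 x * right_pairing \<phi> x) = - \<phi> x $ 1"
      using w_sum_nonzero by (simp add: wronskian_eq)
  qed
  have R: "ac_deriv right1 (\<lambda>x. coeff_up m z x * right2 x)" "ac_deriv right2 (\<lambda>x. coeff_down m z x * right1 x)"
    and L: "ac_deriv left1 (\<lambda>x. coeff_up m z x * left2 x)" "ac_deriv left2 (\<lambda>x. coeff_down m z x * left1 x)"
    using right_homogeneous left_homogeneous by (auto simp: homogeneous_def)
  have "ac_deriv (solution1 \<phi>) (\<lambda>x. 1 / ?s *
      ((?F x * (coeff_up m z x * right2 x) + right1 x * left_pairing \<phi> x)
      + (?G x * (coeff_up m z x * left2 x) + left1 x * - right_pairing \<phi> x)))"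
    unfolding solution1_def[abs_def] by (intro ac_deriv_cmult ac_deriv_add ac_deriv_mult R L F G)
  also have "(\<lambda>x. 1 / ?s *
      ((?F x * (coeff_up m z x * right2 x) + right1 x * left_pairing \<phi> x)
      + (?G x * (coeff_up m z x * left2 x) + left1 x * - right_pairing \<phi> x)))
      = (\<lambda>x. coeff_up m z x * solution2 \<phi> x
          + 1 / ?s * (right1 x * left_pairing \<phi> x - left1 x * right_pairing \<phi> x))"
    unfolding solution2_def by (simp add: algebra_simps)
  finally show "ac_deriv (solution1 \<phi>) (\<lambda>x. coeff_up m z x * solution2 \<phi> x + \<phi> x $ 2)"
    unfolding jump .
  have "ac_deriv (solution2 \<phi>) (\<lambda>x. 1 / ?s *
      ((?F x * (coeff_down m z x * right1 x) + right2 x * left_pairing \<phi> x)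
      + (?G x * (coeff_down m z x * left1 x) + left2 x * - right_pairing \<phi> x)))"
    unfolding solution2_def[abs_def] by (intro ac_deriv_cmult ac_deriv_add ac_deriv_mult R L F G)
  also have "(\<lambda>x. 1 / ?s *
      ((?F x * (coeff_down m z x * right1 x) + right2 x * left_pairing \<phi> x)
      + (?G x * (coeff_down m z x * left1 x) + left2 x * - right_pairing \<phi> x)))
      = (\<lambda>x. coeff_down m z x * solution1 \<phi> x
          + 1 / ?s * (right2 x * left_pairing \<phi> x - left2 x * right_pairing \<phi> x))"
    unfolding solution1_def by (simp add: algebra_simps)
  finally show "ac_deriv (solution2 \<phi>) (\<lambda>x. coeff_down m z x * solution1 \<phi> x - \<phi> x $ 1)"
    unfolding jump by simp
qed

text \<open>
  Off the points \<open>y = 0\<close> and \<open>y = x\<close>, at which the kernel is zero by convention, the integrand is the sum of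
  two half line integrands; this gives its measurability as well.
\<close>

lemma kernel_integral:
  assumes \<phi>: "square_integrable \<phi>" and x: "x \<noteq> 0"
  shows "integrable lborel (\<lambda>y. resolvent_kernel m z x y *v \<phi> y)"
    and "vector [solution1 \<phi> x, solution2 \<phi> x] = - (LINT y|lborel. resolvent_kernel m z x y *v \<phi> y)"
proof -
  let ?s = "wp m z + wm m z"
  let ?T = "\<lambda>c. (- c / ?s) *s (vector [right1 x, right2 x] :: complex^2)"
  let ?S = "\<lambda>c. (- c / ?s) *s (vector [left1 x, left2 x] :: complex^2)"
  define n where "n y = ?T (indicator {..x} y *\<^sub>R left_pairing \<phi> y) + ?S (indicator {x..} y *\<^sub>R right_pairing \<phi> y)" for y
  have bl: "bounded_linear (\<lambda>c. (- c / ?s) *s (v :: complex^2))" for v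
    by (intro bounded_linear_compose[OF bounded_linear_vector_scalar_mult]
      bounded_linear_compose[OF bounded_linear_divide] bounded_linear_minus bounded_linear_ident)
  note li = pairing_integrable(1)[OF \<phi>, of x, unfolded set_integrable_def]
  note ri = pairing_integrable(2)[OF \<phi>, of x, unfolded set_integrable_def]
  note Ti = integrable_bounded_linear[OF bl li] integral_bounded_linear[OF bl li]
  note Si = integrable_bounded_linear[OF bl ri] integral_bounded_linear[OF bl ri]
  have n: "integrable lborel n" unfolding n_def[abs_def] by (intro Bochner_Integration.integrable_add Ti Si)
  have "(LINT y|lborel. n y) = ?T (LINT y:{..x}|lborel. left_pairing \<phi> y) + ?S (LINT y:{x..}|lborel. right_pairing \<phi> y)"
    unfolding n_def[abs_def] set_lebesgue_integral_def
    by (subst Bochner_Integration.integral_add[OF Ti(1) Si(1)]) (simp only: Ti(2) Si(2))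
  then have int_n: "- (LINT y|lborel. n y) = vector [solution1 \<phi> x, solution2 \<phi> x]"
    by (simp only:) (simp add: vec_eq_iff forall_2 solution1_def solution2_def algebra_simps add_divide_distrib)
  have eq: "resolvent_kernel m z x y *v \<phi> y = indicator (- {0, x}) y *\<^sub>R n y" for y
  proof -
    consider "y = 0 \<or> y = x" | "y \<noteq> 0" "y < x" | "y \<noteq> 0" "x < y" by linarith
    then show ?thesis
    proof cases
      case 1
      then have "resolvent_kernel m z x y = 0" by (auto simp: resolvent_kernel_def)
      then show ?thesis using 1 by auto
    next
      case 2
      then show ?thesis using resolvent_kernel_below[OF 2(2) x 2(1)]
        by (simp add: n_def left_pairing_def)
    next
      case 3
      then show ?thesis using resolvent_kernel_above[OF 3(2) x 3(1)]
        by (simp add: n_def right_pairing_def)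
    qed
  qed
  show int: "integrable lborel (\<lambda>y. resolvent_kernel m z x y *v \<phi> y)"
    unfolding eq by (intro integrable_mult_indicator n) simp
  have "(LINT y|lborel. resolvent_kernel m z x y *v \<phi> y) = (LINT y|lborel. n y)"
  proof (rule integral_cong_AE)
    show "AE y in lborel. resolvent_kernel m z x y *v \<phi> y = n y"
      using AE_lborel_singleton[of 0] AE_lborel_singleton[of x] by eventually_elim (simp add: eq)
  qed (use int n in auto)
  then show "vector [solution1 \<phi> x, solution2 \<phi> x] = - (LINT y|lborel. resolvent_kernel m z x y *v \<phi> y)"
    using int_n by simp
qed

section \<open>The resolvent\<close>

definition solution :: "l2 \<Rightarrow> l2" where
  "solution f = abs_l2 (\<lambda>x. vector [solution1 (rep_l2 f) x, solution2 (rep_l2 f) x])"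

lemma solution_measurable:
  assumes "square_integrable \<phi>"
  shows "(\<lambda>x. vector [solution1 \<phi> x, solution2 \<phi> x] :: complex^2) \<in> borel_measurable borel"
  by (intro vector_2_measurable ac_deriv_measurable[OF solution_ac(1)[OF assms]]
      ac_deriv_measurable[OF solution_ac(2)[OF assms]])

lemma rep_solution:
  "AE x in lborel. rep_l2 (solution f) x = vector [solution1 (rep_l2 f) x, solution2 (rep_l2 f) x]"
proof -
  obtain D where D: "D \<ge> 0"
    "\<And>\<phi> x. square_integrable \<phi> \<Longrightarrow> norm (vector [solution1 \<phi> x, solution2 \<phi> x] :: complex^2)
      \<le> D * (LINT y|lborel. exp (- gap * \<bar>x - y\<bar>) * norm (\<phi> y))"
    by (rule solution_bound) blast
  show ?thesis
    unfolding solution_def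
    by (intro rep_abs_l2_AE exp_convolution_square_integrable(1)[OF gap_pos square_integrable_rep_l2
        solution_measurable D(1) D(2)] square_integrable_rep_l2)
qed

lemma solution_norm_bound: "\<exists>K. \<forall>f. norm (solution f) \<le> norm f * K"
proof -
  obtain D where D: "D \<ge> 0"
    "\<And>\<phi> x. square_integrable \<phi> \<Longrightarrow> norm (vector [solution1 \<phi> x, solution2 \<phi> x] :: complex^2)
      \<le> D * (LINT y|lborel. exp (- gap * \<bar>x - y\<bar>) * norm (\<phi> y))"
    by (rule solution_bound) blast
  have "norm (solution f) \<le> norm f * (2 * D / gap)" for f
  proof -
    let ?u = "\<lambda>x. vector [solution1 (rep_l2 f) x, solution2 (rep_l2 f) x] :: complex^2"
    note m = solution_measurable[OF square_integrable_rep_l2[of f]]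
    have [measurable]: "?u \<in> borel_measurable borel" "rep_l2 (solution f) \<in> borel_measurable borel"
      using m square_integrable_measurable[OF square_integrable_rep_l2] by auto
    have "(LINT x|lborel. (norm (rep_l2 (solution f) x))\<^sup>2) = (LINT x|lborel. (norm (?u x))\<^sup>2)"
      by (rule integral_cong_AE) (use rep_solution[of f] in auto)
    also have "\<dots> \<le> (2 * D / gap)\<^sup>2 * (LINT x|lborel. (norm (rep_l2 f x))\<^sup>2)"
      by (rule exp_convolution_square_integrable(2)[OF gap_pos square_integrable_rep_l2 m D(1)
          D(2)[OF square_integrable_rep_l2]])
    finally have "norm (solution f) \<le> sqrt ((2 * D / gap)\<^sup>2 * (LINT x|lborel. (norm (rep_l2 f x))\<^sup>2))"
      unfolding norm_l2_eq by simp
    also have "\<dots> = norm f * (2 * D / gap)"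
      using D(1) gap_pos by (simp add: norm_l2_eq real_sqrt_mult)
    finally show ?thesis .
  qed
  then show ?thesis by blast
qed

lemma solution_solves: "solution f \<in> H1 \<and> dirac_op m (solution f) - z *\<^sub>C solution f = f"
  unfolding dirac_equation_iff_ac
  using solution_ac[OF square_integrable_rep_l2[of f]] rep_solution[of f] by blast

lemma resolvent_eq_solution: "resolvent H1 (dirac_op m) z = solution"
  unfolding resolvent_def
  by (intro ext inv_into_f_eq[OF dirac_injective]) (use solution_solves in auto)

lemma solution_kernel:
  "AE x in lborel. integrable lborel (\<lambda>y. resolvent_kernel m z x y *v rep_l2 f y) \<and>
     rep_l2 (solution f) x = - (LINT y|lborel. resolvent_kernel m z x y *v rep_l2 f y)"
  using rep_solution[of f] AE_lborel_singleton[of 0]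
  by eventually_elim (simp add: kernel_integral[OF square_integrable_rep_l2])

lemma solution_additive: "solution (f + g) = solution f + solution g"
proof (rule l2_eqI)
  show "AE x in lborel. rep_l2 (solution (f + g)) x = rep_l2 (solution f + solution g) x"
    using solution_kernel[of f] solution_kernel[of g] solution_kernel[of "f + g"]
      rep_l2_add_AE[of "solution f" "solution g"]
  proof eventually_elim
    case (elim x)
    let ?K = "\<lambda>f y. resolvent_kernel m z x y *v rep_l2 f y"
    have "(LINT y|lborel. ?K (f + g) y) = (LINT y|lborel. ?K f y + ?K g y)"
    proof (rule integral_cong_AE)
      show "AE y in lborel. ?K (f + g) y = ?K f y + ?K g y"
        using rep_l2_add_AE[of f g] by eventually_elim (simp add: matrix_vector_right_distrib)
    qed (use elim in auto)
    then show ?case using elim by simp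
  qed
qed

lemma solution_scaleR: "solution (r *\<^sub>R f) = r *\<^sub>R solution f"
proof (rule l2_eqI)
  show "AE x in lborel. rep_l2 (solution (r *\<^sub>R f)) x = rep_l2 (r *\<^sub>R solution f) x"
    using solution_kernel[of f] solution_kernel[of "r *\<^sub>R f"] rep_l2_scaleR_AE[of r "solution f"]
  proof eventually_elim
    case (elim x)
    let ?K = "\<lambda>f y. resolvent_kernel m z x y *v rep_l2 f y"
    have s: "A *v (r *\<^sub>R v) = r *\<^sub>R (A *v v)" for A :: "complex^2^2" and v
      by (simp add: vec_eq_iff matrix_vector_mult_def scaleR_sum_right)
    have "(LINT y|lborel. ?K (r *\<^sub>R f) y) = (LINT y|lborel. r *\<^sub>R ?K f y)"
    proof (rule integral_cong_AE)
      show "AE y in lborel. ?K (r *\<^sub>R f) y = r *\<^sub>R ?K f y"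
        using rep_l2_scaleR_AE[of r f] by eventually_elim (simp add: s)
    qed (use elim in auto)
    then show ?case using elim by simp
  qed
qed

lemma bounded_linear_solution: "bounded_linear solution"
proof -
  obtain K where "\<forall>f. norm (solution f) \<le> norm f * K" using solution_norm_bound by blast
  then show ?thesis
    by (intro bounded_linear_intro[of solution K] solution_additive solution_scaleR) auto
qed

lemma in_resolvent_set: "z \<in> resolvent_set H1 (dirac_op m)"
  unfolding resolvent_set_def mem_Collect_eq
proof
  show "bij_betw (\<lambda>u. dirac_op m u - z *\<^sub>C u) H1 UNIV"
    unfolding bij_betw_def
  proof
    show "(\<lambda>u. dirac_op m u - z *\<^sub>C u) ` H1 = UNIV"
    proof (rule UNIV_eq_I[symmetric])
      show "f \<in> (\<lambda>u. dirac_op m u - z *\<^sub>C u) ` H1" for f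
        by (rule image_eqI[of _ _ "solution f"]) (simp_all add: solution_solves)
    qed
  qed (rule dirac_injective)
  show "bounded_linear (resolvent H1 (dirac_op m) z)"
    unfolding resolvent_eq_solution by (rule bounded_linear_solution)
qed

end

theorem proposition3p1:
  fixes m :: real
  assumes "m \<ge> 0"
  shows "UNIV - sing_set m \<subseteq> resolvent_set H1 (dirac_op m) \<and>
    (\<forall>z \<in> UNIV - sing_set m. \<forall>f :: l2.
      AE x in lborel.
        integrable lborel (\<lambda>y. resolvent_kernel m z x y *v rep_l2 f y) \<and>
        rep_l2 (resolvent H1 (dirac_op m) z f) x =
          - (LINT y|lborel. resolvent_kernel m z x y *v rep_l2 f y))"
proof -
  have rp: "resolvent_point m z" if "z \<in> UNIV - sing_set m" for z
    using that assms by unfold_locales auto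
  show ?thesis
  proof (intro conjI subsetI ballI allI)
    show "z \<in> resolvent_set H1 (dirac_op m)" if "z \<in> UNIV - sing_set m" for z
      by (rule resolvent_point.in_resolvent_set[OF rp[OF that]])
    show "AE x in lborel.
        integrable lborel (\<lambda>y. resolvent_kernel m z x y *v rep_l2 f y) \<and>
        rep_l2 (resolvent H1 (dirac_op m) z f) x =
          - (LINT y|lborel. resolvent_kernel m z x y *v rep_l2 f y)"
      if "z \<in> UNIV - sing_set m" for z f
      unfolding resolvent_point.resolvent_eq_solution[OF rp[OF that]]
      by (rule resolvent_point.solution_kernel[OF rp[OF that]])
  qed
qed

end
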